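(* Let $\lambda$ be a partition and let $X$ be an alphabet (a set of indeterminates). Then $$Q'_\lambda(X+1)=\sum_{\mu\subseteq\lambda} Q'_\mu(X)\,\aleph(\lambda/\mu),$$ where the sum runs over partitions $\mu$ whose diagram is contained in that of $\lambda$. Equivalently, for every partition $\mu\subseteq\lambda$ the skew function evaluated at $1$ is $$Q'_{\lambda/\mu}(1)=\aleph(\lambda/\mu):=b_\mu^{-1}\,t^{\mathbf n(\lambda/\mu)}\,(1-t^{\nu_1-0})(1-t^{\nu_2-1})\cdots(1-t^{\nu_r-r+1}),$$ where $r=\ell(\mu)$ and $\nu_i=\lambda^\sim_{\mu_i}$ for $i=1,\dots,r$ (the part of index $\mu_i$ of the partition $\lambda^\sim$ conjugate to $\lambda$).
   Context: Symmetric functions have coefficients in $\mathbb Q[[t]]$, $t$ an indeterminate. Arguments of symmetric functions are understood in the $\lambda$-ring sense: a symmetric function is a polynomial in the power sums $p_i$, and $p_i(X+Y)=p_iX+p_iY$, $p_i(XY)=p_iX\,p_iY$, $p_i(X(1-t))=(1-t^i)p_iX$, $p_i(X\pm1)=p_iX\pm1$. $Q_\lambda$ denotes Macdonald's Hall–Littlewood $Q$-function and $Q'_\lambda(X)=Q_\lambda\big(X/(1-t)\big)$ the modified Hall–Littlewood function, i.e. $Q_\lambda(X)=Q'_\lambda(X(1-t))$; equivalently $Q'_\mu=\sum_T t^{\mathrm{charge}(T)}S_{\mathrm{shape}(T)}$, summed over semistandard tableaux $T$ of weight $\mu$. Skew functions $Q'_{\lambda/\mu}$ are defined by $Q'_\lambda(X+Y)=\sum_\mu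 Q'_{\lambda/\mu}(X)\,Q'_\mu(Y)$. For $\lambda=1^{m_1}2^{m_2}\cdots$, $b_\lambda=\prod_i\prod_{j=1}^{m_i}(1-t^j)$. For partitions $\lambda,\mu$, $\mathbf n(\lambda/\mu)=\sum_i(\lambda^\sim_i-\mu^\sim_i)(\lambda^\sim_i-\mu^\sim_i-1)/2$, where $\sim$ denotes the conjugate partition. *)

theory Defs
  imports
    "HOL-Library.Poly_Mapping"
    "HOL-Computational_Algebra.Formal_Power_Series"
    "HOL-Computational_Algebra.Fraction_Field"
    "HOL-Combinatorics.Permutations"
begin

section \<open>Partitions\<close>

text \<open>A partition is the list of its nonzero parts in weakly decreasing order.
  The letter \<open>\<lambda>\<close> being reserved, \<open>\<kappa>\<close> is used in its place.
  List positions start at 0, so the part usually written with index \<open>i\<close> has position \<open>i - 1\<close>.\<close>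

definition is_partition :: "nat list \<Rightarrow> bool" where
  "is_partition \<kappa> \<longleftrightarrow> sorted_wrt (\<ge>) \<kappa> \<and> 0 \<notin> set \<kappa>"

definition part :: "nat list \<Rightarrow> nat \<Rightarrow> nat" where
  "part \<kappa> i = (if i < length \<kappa> then \<kappa> ! i else 0)"

definition diagram_subset :: "nat list \<Rightarrow> nat list \<Rightarrow> bool" where
  "diagram_subset \<mu> \<kappa> \<longleftrightarrow> (\<forall>i. part \<mu> i \<le> part \<kappa> i)"

text \<open>\<open>conj_part \<kappa> j\<close> is the part of index \<open>j\<close> of the conjugate partition, for \<open>j \<ge> 1\<close>
  (here \<open>j\<close> counts from 1).\<close>

definition conj_part :: "nat list \<Rightarrow> nat \<Rightarrow> nat" where
  "conj_part \<kappa> j = card {i. i < length \<kappa> \<and> j \<le> \<kappa> ! i}"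

definition n_skew :: "nat list \<Rightarrow> nat list \<Rightarrow> nat" where
  "n_skew \<kappa> \<mu> = nat (\<Sum>j = 1..max (part \<kappa> 0) (part \<mu> 0).
     (int (conj_part \<kappa> j) - int (conj_part \<mu> j)) *
     (int (conj_part \<kappa> j) - int (conj_part \<mu> j) - 1) div 2)"


section \<open>Symmetric functions in the \<open>\<lambda>\<close>-ring sense\<close>

abbreviation t :: "rat fps" where
  "t \<equiv> fps_X"

text \<open>The type \<open>('v \<Rightarrow>\<^sub>0 nat) \<Rightarrow>\<^sub>0 rat fps\<close> is the polynomial ring over \<open>\<rat>[[t]]\<close>
  in the indeterminates \<open>indet v\<close>; more generally \<open>'m \<Rightarrow>\<^sub>0 rat fps\<close> is a monoid algebra
  over \<open>\<rat>[[t]]\<close>, with coefficient embedding \<open>scal\<close>.\<close>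

definition indet :: "'v \<Rightarrow> ('v \<Rightarrow>\<^sub>0 nat) \<Rightarrow>\<^sub>0 rat fps" where
  "indet v = Poly_Mapping.single (Poly_Mapping.single v 1) 1"

definition scal :: "rat fps \<Rightarrow> ('m::comm_monoid_add \<Rightarrow>\<^sub>0 rat fps)" where
  "scal c = Poly_Mapping.single 0 c"

text \<open>A symmetric function is a polynomial in the power sums \<open>psum 1, psum 2, \<dots>\<close>;
  the indeterminate with number \<open>k\<close> stands for \<open>psum (k + 1)\<close>.\<close>

type_synonym sym = "(nat \<Rightarrow>\<^sub>0 nat) \<Rightarrow>\<^sub>0 rat fps"

definition psum :: "nat \<Rightarrow> sym" where
  "psum i = indet (i - 1)"

text \<open>Evaluation of a symmetric function at an alphabet. An alphabet \<open>X\<close> is given by the family of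
  its power sums \<open>X i\<close> for \<open>i \<ge> 1\<close> (the value \<open>X 0\<close> is never used); \<open>\<phi>\<close> maps the coefficients
  to the target ring.\<close>

definition eval_with ::
    "(rat fps \<Rightarrow> 'a::comm_ring_1) \<Rightarrow> sym \<Rightarrow> (nat \<Rightarrow> 'a) \<Rightarrow> 'a" where
  "eval_with \<phi> f X =
     (\<Sum>m\<in>Poly_Mapping.keys f. \<phi> (Poly_Mapping.lookup f m) *
        (\<Prod>k\<in>Poly_Mapping.keys m. X (Suc k) ^ Poly_Mapping.lookup m k))"

definition eval_at ::
    "sym \<Rightarrow> (nat \<Rightarrow> ('m::comm_monoid_add \<Rightarrow>\<^sub>0 rat fps)) \<Rightarrow> ('m \<Rightarrow>\<^sub>0 rat fps)" where
  "eval_at f X = eval_with scal f X"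

definition eval_one :: "sym \<Rightarrow> rat fps" where
  "eval_one f = eval_with (\<lambda>c. c) f (\<lambda>i. 1)"


section \<open>Hall--Littlewood functions\<close>

definition b_poly :: "nat list \<Rightarrow> rat fps" where
  "b_poly \<kappa> = (\<Prod>i\<in>set \<kappa>. \<Prod>j = 1..count_list \<kappa> i. 1 - t ^ j)"

text \<open>Macdonald's Hall--Littlewood polynomial in the variables \<open>indet 0, \<dots>, indet (n - 1)\<close>,
  for \<open>n \<ge> length \<kappa>\<close>:
  \<open>P\<close> is \<open>1 / v\<close> times the sum over \<open>w \<in> S\<^sub>n\<close> of
  \<open>w (x\<^sup>\<lambda> \<Prod>\<^sub>i\<^sub><\<^sub>j (x\<^sub>i - t x\<^sub>j) / (x\<^sub>i - x\<^sub>j))\<close>, computed in the field of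
  fractions, where \<open>v\<close> is the product over all \<open>i \<ge> 0\<close> of \<open>(1 - t) \<cdots> (1 - t ^ m\<^sub>i) / (1 - t) ^ m\<^sub>i\<close>
  and \<open>m\<^sub>0 = n - length \<kappa>\<close>.\<close>

definition v_fact :: "nat \<Rightarrow> rat fps" where
  "v_fact m = (\<Prod>j = 1..m. (1 - t ^ j) / (1 - t))"

definition v_poly :: "nat \<Rightarrow> nat list \<Rightarrow> rat fps" where
  "v_poly n \<kappa> = v_fact (n - length \<kappa>) * (\<Prod>i\<in>set \<kappa>. v_fact (count_list \<kappa> i))"

abbreviation to_frac :: "'a::idom \<Rightarrow> 'a fract" where
  "to_frac a \<equiv> Fract a 1"

definition HL_poly :: "nat \<Rightarrow> nat list \<Rightarrow> ((nat \<Rightarrow>\<^sub>0 nat) \<Rightarrow>\<^sub>0 rat fps) fract" where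
  "HL_poly n \<kappa> = to_frac (scal (inverse (v_poly n \<kappa>))) *
     (\<Sum>w | w permutes {..<n}.
        (\<Prod>i<n. to_frac (indet (w i)) ^ part \<kappa> i) *
        (\<Prod>j<n. \<Prod>i<j.
           to_frac (indet (w i) - scal t * indet (w j)) / to_frac (indet (w i) - indet (w j))))"

text \<open>The symmetric function \<open>P\<close> is the one whose restriction to \<open>n\<close> variables is \<open>HL_poly n \<kappa>\<close>
  for all \<open>n \<ge> length \<kappa>\<close>.\<close>

definition HL_P :: "nat list \<Rightarrow> sym" where
  "HL_P \<kappa> = (THE f. \<forall>n\<ge>length \<kappa>.
     to_frac (eval_at f (\<lambda>k. \<Sum>i<n. indet i ^ k)) = HL_poly n \<kappa>)"

definition HL_Q :: "nat list \<Rightarrow> sym" where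
  "HL_Q \<kappa> = scal (b_poly \<kappa>) * HL_P \<kappa>"

definition HL_Q' :: "nat list \<Rightarrow> sym" where
  "HL_Q' \<kappa> = eval_at (HL_Q \<kappa>) (\<lambda>i. scal (inverse (1 - t ^ i)) * psum i)"

text \<open>Two generic alphabets: all their power sums are independent indeterminates.\<close>

definition pX :: "nat \<Rightarrow> ((nat + nat) \<Rightarrow>\<^sub>0 nat) \<Rightarrow>\<^sub>0 rat fps" where
  "pX i = indet (Inl (i - 1))"

definition pY :: "nat \<Rightarrow> ((nat + nat) \<Rightarrow>\<^sub>0 nat) \<Rightarrow>\<^sub>0 rat fps" where
  "pY i = indet (Inr (i - 1))"

text \<open>\<open>HL_Q'_skew \<kappa> \<mu>\<close> is the skew function of \<open>\<kappa>/\<mu>\<close>: the family of coefficients, indexed by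
  partitions \<open>\<mu>\<close>, of the (finite) expansion of the function of \<open>X + Y\<close> in the functions of \<open>Y\<close>.\<close>

definition HL_Q'_skew :: "nat list \<Rightarrow> nat list \<Rightarrow> sym" where
  "HL_Q'_skew \<kappa> = (THE F.
     finite {\<mu>. F \<mu> \<noteq> 0} \<and> (\<forall>\<mu>. F \<mu> \<noteq> 0 \<longrightarrow> is_partition \<mu>) \<and>
     eval_at (HL_Q' \<kappa>) (\<lambda>i. pX i + pY i) =
       (\<Sum>\<mu> | F \<mu> \<noteq> 0. eval_at (F \<mu>) pX * eval_at (HL_Q' \<mu>) pY))"

text \<open>For \<open>\<mu>\<close> contained in \<open>\<kappa>\<close> the exponents below are positive, so subtraction does not truncate.\<close>

definition aleph :: "nat list \<Rightarrow> nat list \<Rightarrow> rat fps" where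
  "aleph \<kappa> \<mu> = inverse (b_poly \<mu>) * t ^ n_skew \<kappa> \<mu> *
     (\<Prod>i<length \<mu>. 1 - t ^ (conj_part \<kappa> (part \<mu> i) - i))"

end

theory Submission
  imports
    Defs
    "HOL-Computational_Algebra.Polynomial"
    "HOL-Combinatorics.Multiset_Permutations"
begin

text \<open>
  Let \<open>B\<^sub>m f\<close> be the coefficient of \<open>u\<^sup>m\<close> in \<open>f[X - (1 - t)/u] \<Sum>\<^sub>n h\<^sub>n u\<^sup>n\<close>. Expanding the
  symmetrization that defines \<open>P\<close> along the image of the first index, and summing by partial
  fractions, one finds \<open>Q'\<^sub>\<kappa> = B\<^bsub>\<kappa>\<^sub>1\<^esub> B\<^bsub>\<kappa>\<^sub>2\<^esub> \<cdots> 1\<close>. If \<open>S\<close> denotes the substitution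
  \<open>X \<rightarrow> X - 1\<close>, then \<open>S B\<^sub>m = (B\<^sub>m - B\<^bsub>m-1\<^esub>) S\<close> and \<open>B\<^bsub>m-1\<^esub> B\<^sub>m = t B\<^sub>m B\<^bsub>m-1\<^esub>\<close>, so the
  \<open>q\<close>-binomial theorem applied to each block of equal parts expands \<open>Q'\<^sub>\<kappa>(X - 1)\<close> over the vertical
  strips of \<open>\<kappa>\<close>. The matrix of coefficients \<open>aleph\<close> is the inverse of that matrix: for fixed outer
  and inner partitions the sum over the intermediate one factorizes over the columns, and the factor
  of the first column in which they differ is an alternating sum of \<open>q\<close>-binomial coefficients.

  The functions \<open>Q'\<^sub>\<mu>\<close> are linearly independent because the part of \<open>Q'\<^sub>\<mu>(X - s)\<close> of highest degree
  in \<open>s\<close> is \<open>Q'\<close> of \<open>\<mu>\<close> without its first column. They span enough for the skew functions to exist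
  because \<open>Q'\<^sub>\<kappa>(X + r\<^sub>1 + \<cdots> + r\<^sub>n)\<close> is in their span for all rationals \<open>r\<^sub>i\<close> and the
  monomials in power sums, as functions of the \<open>r\<^sub>i\<close>, are distinct multiplicative characters.
\<close>

section \<open>Polynomials and their evaluation\<close>

text \<open>The letter is first subtracted because subtracting \<open>s\<close> multiplies the
  series of complete functions by \<open>1 - s u\<close>, which relates \<open>B_m\<close> to two
  operators only. Adding \<open>s\<close> would divide by this factor and involve every
  \<open>B_(m-i)\<close>, negative indices included. The price is a matrix inversion. It can be
  carried out because \<open>aleph\<close>, read by columns, is a product in which each column
  length of the intermediate partition is coupled to its neighbours only, and the trinomial identity
  for q-binomials dissolves this coupling. The letter \<open>s\<close> stays general although the
  theorem is about 1: arbitrary rational values serve the existence of the skew functions, and the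
  powers of \<open>s\<close> serve linear independence. \<open>HL_P\<close> and
  \<open>HL_Q'_skew\<close> are descriptions, so nothing is known about them before existence and
  uniqueness are proved. Both uniqueness proofs test a symmetric function on finite alphabets of
  rational numbers. As Q[[t]] is not a field, the argument with characters divides by rational
  numbers only.\<close>

definition is_ring_hom :: "('a::comm_ring_1 \<Rightarrow> 'b::comm_ring_1) \<Rightarrow> bool" where
  "is_ring_hom h \<longleftrightarrow> h 1 = 1 \<and> (\<forall>a b. h (a + b) = h a + h b) \<and> (\<forall>a b. h (a * b) = h a * h b)"

lemma is_ring_homI:
  assumes "h 1 = 1" "\<And>a b. h (a + b) = h a + h b" "\<And>a b. h (a * b) = h a * h b"
  shows "is_ring_hom h"
  using assms by (simp add: is_ring_hom_def)

lemma hom_one: "is_ring_hom h \<Longrightarrow> h 1 = 1"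
  and hom_add: "is_ring_hom h \<Longrightarrow> h (a + b) = h a + h b"
  and hom_mult: "is_ring_hom h \<Longrightarrow> h (a * b) = h a * h b"
  by (simp_all add: is_ring_hom_def)

lemma hom_zero: "is_ring_hom h \<Longrightarrow> h 0 = 0"
  using hom_add[of h 0 0] by simp

lemma hom_uminus: "is_ring_hom h \<Longrightarrow> h (- a) = - h a"
  using hom_add[of h a "- a"] hom_zero[of h] by (simp add: eq_neg_iff_add_eq_0 add.commute)

lemma hom_diff: "is_ring_hom h \<Longrightarrow> h (a - b) = h a - h b"
  using hom_add[of h a "- b"] by (simp add: hom_uminus)

lemma hom_sum: "is_ring_hom h \<Longrightarrow> h (sum f A) = (\<Sum>x\<in>A. h (f x))"
  by (induction A rule: infinite_finite_induct) (simp_all add: hom_zero hom_add)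

lemma hom_prod: "is_ring_hom h \<Longrightarrow> h (prod f A) = (\<Prod>x\<in>A. h (f x))"
  by (induction A rule: infinite_finite_induct) (simp_all add: hom_one hom_mult)

lemma hom_power: "is_ring_hom h \<Longrightarrow> h (a ^ n) = h a ^ n"
  by (induction n) (simp_all add: hom_one hom_mult)

lemma hom_of_nat: "is_ring_hom h \<Longrightarrow> h (of_nat n) = of_nat n"
  by (induction n) (simp_all add: hom_one hom_zero hom_add)

lemmas hom_simps = hom_one hom_zero hom_add hom_mult hom_uminus hom_diff hom_sum hom_prod
  hom_power hom_of_nat

lemma is_ring_hom_comp:
  "is_ring_hom g \<Longrightarrow> is_ring_hom h \<Longrightarrow> is_ring_hom (\<lambda>x. g (h x))"
  by (simp add: is_ring_hom_def)

lemma is_ring_hom_id: "is_ring_hom (\<lambda>x. x)"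
  by (simp add: is_ring_hom_def)

lemma is_ring_hom_scal: "is_ring_hom scal"
  by (rule is_ring_homI) (simp_all add: scal_def single_add mult_single)

lemma is_ring_hom_const_poly: "is_ring_hom (\<lambda>c. [:c:])"
  by (rule is_ring_homI) simp_all

lemma is_ring_hom_fps_const: "is_ring_hom fps_const"
  by (rule is_ring_homI) simp_all

lemma is_ring_hom_to_frac: "is_ring_hom to_frac"
  by (rule is_ring_homI) (simp_all add: One_fract_def)

lemmas scal_simps = hom_simps[OF is_ring_hom_scal, symmetric]

section \<open>Evaluation of polynomials in indeterminates\<close>

definition mon_val :: "('v \<Rightarrow> 'a::comm_monoid_mult) \<Rightarrow> ('v \<Rightarrow>\<^sub>0 nat) \<Rightarrow> 'a" where
  "mon_val X m = (\<Prod>k\<in>Poly_Mapping.keys m. X k ^ Poly_Mapping.lookup m k)"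

lemma mon_val_superset:
  "finite K \<Longrightarrow> Poly_Mapping.keys m \<subseteq> K \<Longrightarrow>
    mon_val X m = (\<Prod>k\<in>K. X k ^ Poly_Mapping.lookup m k)"
  unfolding mon_val_def by (rule prod.mono_neutral_left) (auto simp: in_keys_iff)

lemma mon_val_add: "mon_val X (m + n) = mon_val X m * mon_val X n"
proof -
  let ?K = "Poly_Mapping.keys m \<union> Poly_Mapping.keys n"
  have "mon_val X (m + n) = (\<Prod>k\<in>?K. X k ^ Poly_Mapping.lookup (m + n) k)"
    using keys_add[of m n] by (intro mon_val_superset) auto
  also have "\<dots> = (\<Prod>k\<in>?K. X k ^ Poly_Mapping.lookup m k) * (\<Prod>k\<in>?K. X k ^ Poly_Mapping.lookup n k)"
    by (simp add: lookup_add power_add prod.distrib)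
  also have "\<dots> = mon_val X m * mon_val X n"
    by (subst (1 2) mon_val_superset[where K = ?K]) auto
  finally show ?thesis .
qed

lemma mon_val_zero [simp]: "mon_val X 0 = 1"
  by (simp add: mon_val_def)

lemma mon_val_single [simp]: "mon_val X (Poly_Mapping.single k n) = X k ^ n"
  by (simp add: mon_val_def)

lemma mon_val_mult: "mon_val (\<lambda>k. X k * Y k) m = mon_val X m * mon_val Y m"
  by (simp add: mon_val_def power_mult_distrib prod.distrib)

lemma mon_val_one [simp]: "mon_val (\<lambda>k. 1) m = 1"
  by (simp add: mon_val_def)

lemma hom_mon_val: "is_ring_hom h \<Longrightarrow> h (mon_val X m) = mon_val (\<lambda>k. h (X k)) m"
  by (simp add: mon_val_def hom_simps)

definition peval ::
    "(rat fps \<Rightarrow> 'a::comm_ring_1) \<Rightarrow> ('v \<Rightarrow> 'a) \<Rightarrow> (('v \<Rightarrow>\<^sub>0 nat) \<Rightarrow>\<^sub>0 rat fps) \<Rightarrow> 'a" where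
  "peval \<phi> X f = (\<Sum>m\<in>Poly_Mapping.keys f. \<phi> (Poly_Mapping.lookup f m) * mon_val X m)"

lemma eval_with_eq_peval: "eval_with \<phi> f X = peval \<phi> (\<lambda>k. X (Suc k)) f"
  by (simp add: eval_with_def peval_def mon_val_def)

lemma poly_mapping_sum_single:
  "f = (\<Sum>m\<in>Poly_Mapping.keys f. Poly_Mapping.single m (Poly_Mapping.lookup f m))"
  by (rule poly_mapping_eqI)
    (auto simp: lookup_sum lookup_single when_def in_keys_iff sum.delta)

lemma peval_superset:
  assumes "is_ring_hom \<phi>" "finite K" "Poly_Mapping.keys f \<subseteq> K"
  shows "peval \<phi> X f = (\<Sum>m\<in>K. \<phi> (Poly_Mapping.lookup f m) * mon_val X m)"
  unfolding peval_def using assms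
  by (intro sum.mono_neutral_left) (auto simp: in_keys_iff hom_simps)

lemma peval_single:
  "is_ring_hom \<phi> \<Longrightarrow> peval \<phi> X (Poly_Mapping.single m c) = \<phi> c * mon_val X m"
  by (simp add: peval_def hom_simps)

lemma peval_add:
  assumes "is_ring_hom \<phi>"
  shows "peval \<phi> X (f + g) = peval \<phi> X f + peval \<phi> X g"
proof -
  let ?K = "Poly_Mapping.keys f \<union> Poly_Mapping.keys g"
  have "peval \<phi> X (f + g) = (\<Sum>m\<in>?K. \<phi> (Poly_Mapping.lookup (f + g) m) * mon_val X m)"
    using keys_add[of f g] assms by (intro peval_superset) auto
  also have "\<dots> = (\<Sum>m\<in>?K. \<phi> (Poly_Mapping.lookup f m) * mon_val X m)
      + (\<Sum>m\<in>?K. \<phi> (Poly_Mapping.lookup g m) * mon_val X m)"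
    by (simp add: lookup_add hom_add[OF assms] distrib_right sum.distrib)
  also have "\<dots> = peval \<phi> X f + peval \<phi> X g"
    by (subst (1 2) peval_superset[where K = ?K]) (auto simp: assms)
  finally show ?thesis .
qed

lemma peval_sum:
  assumes "is_ring_hom \<phi>"
  shows "peval \<phi> X (sum f A) = (\<Sum>i\<in>A. peval \<phi> X (f i))"
proof -
  have "peval \<phi> X 0 = 0" by (simp add: peval_def)
  then show ?thesis
    by (induction A rule: infinite_finite_induct) (simp_all add: peval_add[OF assms])
qed

lemma is_ring_hom_peval:
  assumes "is_ring_hom \<phi>"
  shows "is_ring_hom (peval \<phi> X)"
proof (rule is_ring_homI)
  show "peval \<phi> X 1 = 1"
    using peval_single[OF assms, of X 0 1] by (simp add: hom_simps[OF assms])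
next
  fix f g :: "('b \<Rightarrow>\<^sub>0 nat) \<Rightarrow>\<^sub>0 rat fps"
  show "peval \<phi> X (f + g) = peval \<phi> X f + peval \<phi> X g"
    by (rule peval_add[OF assms])
  let ?f = "Poly_Mapping.lookup f" and ?g = "Poly_Mapping.lookup g"
  have "f * g = (\<Sum>m\<in>Poly_Mapping.keys f. \<Sum>n\<in>Poly_Mapping.keys g.
      Poly_Mapping.single (m + n) (?f m * ?g n))"
    using arg_cong2[OF poly_mapping_sum_single[of f] poly_mapping_sum_single[of g], of "(*)"]
    by (simp only: sum_product mult_single)
  then have "peval \<phi> X (f * g) = (\<Sum>m\<in>Poly_Mapping.keys f. \<Sum>n\<in>Poly_Mapping.keys g.
      \<phi> (?f m * ?g n) * mon_val X (m + n))"
    by (simp add: peval_sum[OF assms] peval_single[OF assms])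
  also have "\<dots> = peval \<phi> X f * peval \<phi> X g"
    by (simp add: peval_def sum_product hom_mult[OF assms] mon_val_add mult_ac)
  finally show "peval \<phi> X (f * g) = peval \<phi> X f * peval \<phi> X g" .
qed

lemma peval_indet: "is_ring_hom \<phi> \<Longrightarrow> peval \<phi> X (indet k) = X k"
  unfolding indet_def by (simp add: peval_single hom_simps)

lemma peval_scal: "is_ring_hom \<phi> \<Longrightarrow> peval \<phi> X (scal c) = \<phi> c"
  unfolding scal_def by (simp add: peval_single)

lemma hom_peval:
  "is_ring_hom h \<Longrightarrow> h (peval \<phi> X f) = peval (\<lambda>c. h (\<phi> c)) (\<lambda>k. h (X k)) f"
  by (simp add: peval_def hom_simps hom_mon_val)

lemma mon_val_indet: "mon_val indet m = Poly_Mapping.single m 1"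
proof -
  have pow: "indet k ^ n = Poly_Mapping.single (Poly_Mapping.single k n) 1" for k :: 'a and n
    by (induction n) (simp_all add: indet_def mult_single single_add[symmetric])
  have "(\<Prod>k\<in>K. Poly_Mapping.single (s k) 1) = Poly_Mapping.single (\<Sum>k\<in>K. s k) (1::rat fps)"
    for K :: "'a set" and s :: "'a \<Rightarrow> 'a \<Rightarrow>\<^sub>0 nat"
    by (induction K rule: infinite_finite_induct) (simp_all add: mult_single)
  then show ?thesis
    unfolding mon_val_def pow using poly_mapping_sum_single[of m] by simp
qed

lemma single_eq_scal_mon_val: "Poly_Mapping.single m c = scal c * mon_val indet m"
  by (simp add: mon_val_indet scal_def mult_single)

lemma peval_scal_indet: "peval scal indet f = f"
  by (subst (2) poly_mapping_sum_single) (simp add: peval_def single_eq_scal_mon_val)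

lemma poly_induct [case_names scal indet add mult]:
  fixes f :: "('v \<Rightarrow>\<^sub>0 nat) \<Rightarrow>\<^sub>0 rat fps"
  assumes scal: "\<And>c. P (scal c)" and indet: "\<And>k. P (indet k)"
    and add: "\<And>f g. P f \<Longrightarrow> P g \<Longrightarrow> P (f + g)" and mult: "\<And>f g. P f \<Longrightarrow> P g \<Longrightarrow> P (f * g)"
  shows "P f"
proof -
  have 0: "P 0" "P 1" using scal[of 0] scal[of 1] by (simp_all add: hom_simps[OF is_ring_hom_scal])
  have pow: "P (indet k ^ n)" for k n
    by (induction n) (auto intro: 0 indet mult)
  have "P (\<Prod>k\<in>K. indet k ^ e k)" for K e
    by (induction K rule: infinite_finite_induct) (auto intro: 0 pow mult)
  then have "P (scal c * mon_val indet m)" for c m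
    by (auto simp: mon_val_def intro: scal mult)
  then have "P (\<Sum>m\<in>K. scal (c m) * mon_val indet m)" for K c
    by (induction K rule: infinite_finite_induct) (auto intro: 0 add)
  then show ?thesis
    by (subst peval_scal_indet[symmetric]) (simp add: peval_def)
qed

lemma indet_eq_psum: "indet k = psum (Suc k)"
  by (simp add: psum_def)

lemma is_ring_hom_eval_with: "is_ring_hom \<phi> \<Longrightarrow> is_ring_hom (\<lambda>f. eval_with \<phi> f X)"
  unfolding eval_with_eq_peval by (rule is_ring_hom_peval)

lemma is_ring_hom_eval_at: "is_ring_hom (\<lambda>f. eval_at f X)"
  unfolding eval_at_def by (rule is_ring_hom_eval_with[OF is_ring_hom_scal])

lemma eval_with_psum: "is_ring_hom \<phi> \<Longrightarrow> k \<ge> 1 \<Longrightarrow> eval_with \<phi> (psum k) X = X k"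
  unfolding eval_with_eq_peval psum_def by (simp add: peval_indet)

lemma eval_at_psum: "k \<ge> 1 \<Longrightarrow> eval_at (psum k) X = X k"
  unfolding eval_at_def by (rule eval_with_psum[OF is_ring_hom_scal])

lemma eval_with_scal: "is_ring_hom \<phi> \<Longrightarrow> eval_with \<phi> (scal c) X = \<phi> c"
  unfolding eval_with_eq_peval by (simp add: peval_scal)

lemma eval_at_scal: "eval_at (scal c) X = scal c"
  unfolding eval_at_def by (rule eval_with_scal[OF is_ring_hom_scal])

lemmas eval_at_simps = hom_simps[OF is_ring_hom_eval_at] eval_at_psum eval_at_scal

lemma hom_eval_with:
  "is_ring_hom h \<Longrightarrow> h (eval_with \<phi> f X) = eval_with (\<lambda>c. h (\<phi> c)) f (\<lambda>k. h (X k))"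
  unfolding eval_with_eq_peval by (rule hom_peval)

lemma eval_with_cong:
  "(\<And>k. k \<ge> 1 \<Longrightarrow> X k = Y k) \<Longrightarrow> eval_with \<phi> f X = eval_with \<phi> f Y"
  unfolding eval_with_eq_peval by simp

lemma eval_at_cong:
  "(\<And>k. k \<ge> 1 \<Longrightarrow> X k = Y k) \<Longrightarrow> eval_at f X = eval_at f Y"
  unfolding eval_at_def by (rule eval_with_cong)

lemma eval_with_eval_at:
  "is_ring_hom \<phi> \<Longrightarrow> eval_with \<phi> (eval_at f Y) X = eval_with \<phi> f (\<lambda>k. eval_with \<phi> (Y k) X)"
  unfolding eval_at_def
  by (subst hom_eval_with[OF is_ring_hom_eval_with]) (simp_all add: eval_with_scal)

lemma eval_at_eval_at: "eval_at (eval_at f Y) X = eval_at f (\<lambda>k. eval_at (Y k) X)"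
  using eval_with_eval_at[OF is_ring_hom_scal, of f Y X] by (simp add: eval_at_def)

lemma eval_at_psum_id: "eval_at f psum = f"
  unfolding eval_at_def eval_with_eq_peval psum_def by (simp add: peval_scal_indet)

definition newton :: "'a::comm_ring_1 fps \<Rightarrow> (nat \<Rightarrow> 'a) \<Rightarrow> bool" where
  "newton a P \<longleftrightarrow> fps_nth a 0 = 1 \<and> fps_deriv a = Abs_fps (\<lambda>n. P (Suc n)) * a"

lemma newton_mult:
  assumes "newton a P" "newton b Q"
  shows "newton (a * b) (\<lambda>k. P k + Q k)"
proof -
  have "Abs_fps (\<lambda>n. P (Suc n) + Q (Suc n)) = Abs_fps (\<lambda>n. P (Suc n)) + Abs_fps (\<lambda>n. Q (Suc n))"
    by (rule fps_ext) simp
  then show ?thesis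
    using assms by (simp add: newton_def algebra_simps)
qed

lemma newton_one: "newton 1 (\<lambda>k. 0)"
  by (auto simp: newton_def fps_eq_iff)

lemma newton_prod:
  assumes "\<And>i. i \<in> S \<Longrightarrow> newton (a i) (P i)"
  shows "newton (\<Prod>i\<in>S. a i) (\<lambda>k. \<Sum>i\<in>S. P i k)"
  using assms
  by (induction S rule: infinite_finite_induct) (auto simp: newton_one intro: newton_mult)

lemma geom_series_inverse:
  fixes c :: "'a::comm_ring_1"
  shows "(1 - fps_const c * fps_X) * Abs_fps (\<lambda>n. c ^ n) = 1"
proof (rule fps_ext)
  fix n
  show "fps_nth ((1 - fps_const c * fps_X) * Abs_fps (\<lambda>n. c ^ n)) n = fps_nth 1 n"
    by (cases n) (simp_all add: algebra_simps mult.assoc)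
qed

text \<open>The negative of the alphabet with the single letter \<open>c\<close>: its series is the
  inverse of the geometric series of \<open>c\<close>.\<close>

lemma newton_linear:
  fixes c :: "'a::comm_ring_1"
  shows "newton (1 - fps_const c * fps_X) (\<lambda>k. - (c ^ k))"
proof -
  have "Abs_fps (\<lambda>n. - (c ^ Suc n)) = - fps_const c * Abs_fps (\<lambda>n. c ^ n)"
    by (rule fps_ext) simp
  then have "Abs_fps (\<lambda>n. - (c ^ Suc n)) * (1 - fps_const c * fps_X)
      = - fps_const c * ((1 - fps_const c * fps_X) * Abs_fps (\<lambda>n. c ^ n))"
    by (simp only: mult_ac)
  then show ?thesis
    unfolding geom_series_inverse newton_def by simp
qed

lemma newton_geom:
  fixes c :: "'a::comm_ring_1"
  shows "newton (Abs_fps (\<lambda>n. c ^ n)) (\<lambda>k. c ^ k)"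
proof -
  let ?g = "Abs_fps (\<lambda>n. c ^ n)"
  have "fps_deriv ((1 - fps_const c * fps_X) * ?g) = 0"
    unfolding geom_series_inverse by simp
  then have "(1 - fps_const c * fps_X) * fps_deriv ?g = fps_const c * ?g"
    by (simp add: algebra_simps)
  then have "((1 - fps_const c * fps_X) * ?g) * fps_deriv ?g = fps_const c * ?g * ?g"
    by (simp only: mult_ac)
  moreover have "Abs_fps (\<lambda>n. c ^ Suc n) = fps_const c * ?g"
    by (rule fps_ext) simp
  ultimately show ?thesis
    unfolding geom_series_inverse newton_def by simp
qed

text \<open>The complete homogeneous functions, by Newton's recursion.\<close>

fun hsym :: "nat \<Rightarrow> sym" where
  "hsym 0 = 1"
| "hsym (Suc n) = scal (fps_const (1 / of_nat (Suc n))) * (\<Sum>k\<le>n. psum (Suc k) * hsym (n - k))"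

declare hsym.simps(2) [simp del]

text \<open>The differential equation determines the coefficients one after the other, since
  \<open>\<phi>\<close> supplies inverses of the positive integers. Complete functions are evaluated
  below by exhibiting an explicit solution \<open>a\<close> for the alphabet in question.\<close>

lemma eval_with_hsym:
  assumes "is_ring_hom \<phi>" "newton a P"
  shows "eval_with \<phi> (hsym n) P = fps_nth a n"
proof (induction n rule: less_induct)
  case (less n)
  note E = hom_simps[OF is_ring_hom_eval_with[OF assms(1)]]
  show ?case
  proof (cases n)
    case 0
    then show ?thesis using assms(2) by (simp add: E newton_def)
  next
    case (Suc m)
    let ?c = "\<phi> (fps_const (1 / of_nat (Suc m)))"
    have "eval_with \<phi> (hsym n) P = ?c * (\<Sum>k\<le>m. P (Suc k) * fps_nth a (m - k))"
      unfolding Suc hsym.simps(2)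
      by (simp add: E eval_with_scal eval_with_psum assms(1) less.IH Suc)
    also have "(\<Sum>k\<le>m. P (Suc k) * fps_nth a (m - k)) = fps_nth (fps_deriv a) m"
      using assms(2) by (simp add: newton_def fps_mult_nth atLeast0AtMost)
    also have "\<dots> = \<phi> (of_nat (Suc m)) * fps_nth a (Suc m)"
      by (subst hom_of_nat[OF assms(1)]) simp
    also have "?c * \<dots> = \<phi> (fps_const (1 / of_nat (Suc m)) * of_nat (Suc m)) * fps_nth a n"
      by (simp only: hom_mult[OF assms(1)] mult.assoc Suc)
    also have "fps_const (1 / of_nat (Suc m)) * of_nat (Suc m) = (1 :: rat fps)"
      unfolding fps_of_nat[symmetric] fps_const_mult by (simp del: of_nat_Suc)
    finally show ?thesis by (simp add: hom_one[OF assms(1)])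
  qed
qed

lemma newton_hsym: "newton (Abs_fps hsym) psum"
proof -
  have "of_nat (Suc n) * hsym (Suc n) = (\<Sum>k\<le>n. psum (Suc k) * hsym (n - k))" for n
  proof -
    have "of_nat (Suc n) = (scal (of_nat (Suc n)) :: sym)"
      by (rule hom_of_nat[OF is_ring_hom_scal, symmetric])
    moreover have "of_nat (Suc n) * fps_const (1 / of_nat (Suc n)) = (1 :: rat fps)"
      unfolding fps_of_nat[symmetric] fps_const_mult by (simp del: of_nat_Suc)
    ultimately show ?thesis
      by (simp only: hsym.simps(2) mult.assoc[symmetric] hom_mult[OF is_ring_hom_scal, symmetric]
          hom_one[OF is_ring_hom_scal] mult_1)
  qed
  then show ?thesis
    by (auto simp: newton_def fps_eq_iff fps_mult_nth atLeast0AtMost simp del: of_nat_Suc)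
qed

lemma newton_hom:
  assumes "is_ring_hom h" "newton a P"
  shows "newton (Abs_fps (\<lambda>n. h (fps_nth a n))) (\<lambda>k. h (P k))"
proof -
  have "fps_nth (fps_deriv a) n = fps_nth (Abs_fps (\<lambda>n. P (Suc n)) * a) n" for n
    using assms(2) by (simp add: newton_def)
  from arg_cong[OF this, of h] show ?thesis
    using assms(2)
    by (simp add: newton_def fps_eq_iff fps_mult_nth hom_simps[OF assms(1)])
qed

section \<open>The Jing operators\<close>

text \<open>In \<open>\<lambda>\<close>-ring notation, \<open>shift_poly f\<close> is \<open>f[X - (1 - t) z]\<close> with \<open>z\<close> the polynomial variable,
  and below \<open>sub_var s f\<close> is \<open>f[X - s]\<close> for a variable \<open>s\<close> (so \<open>p\<^sub>k\<close> becomes \<open>p\<^sub>k - s\<^sup>k\<close>).\<close>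

definition shift_poly :: "sym \<Rightarrow> sym poly" where
  "shift_poly f = eval_with (\<lambda>c. [:scal c:]) f (\<lambda>i. [:psum i:] - monom (scal (1 - t ^ i)) i)"

definition shift_coeff :: "nat \<Rightarrow> sym \<Rightarrow> sym" where
  "shift_coeff k f = coeff (shift_poly f) k"

lemma is_ring_hom_const_scal: "is_ring_hom (\<lambda>c. [:scal c:])"
  by (rule is_ring_hom_comp[OF is_ring_hom_const_poly is_ring_hom_scal])

lemma is_ring_hom_shift_poly: "is_ring_hom shift_poly"
  unfolding shift_poly_def by (rule is_ring_hom_eval_with[OF is_ring_hom_const_scal])

lemma shift_poly_scal: "shift_poly (scal c) = [:scal c:]"
  by (simp add: shift_poly_def eval_with_scal is_ring_hom_const_scal)

lemma shift_poly_psum: "k \<ge> 1 \<Longrightarrow> shift_poly (psum k) = [:psum k:] - monom (scal (1 - t ^ k)) k"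
  by (simp add: shift_poly_def eval_with_psum is_ring_hom_const_scal)

lemma shift_coeff_add: "shift_coeff k (f + g) = shift_coeff k f + shift_coeff k g"
  by (simp add: shift_coeff_def hom_add[OF is_ring_hom_shift_poly])

lemma shift_coeff_zero [simp]: "shift_coeff k 0 = 0"
  by (simp add: shift_coeff_def hom_zero[OF is_ring_hom_shift_poly])

lemma shift_coeff_sum: "shift_coeff k (sum f A) = (\<Sum>x\<in>A. shift_coeff k (f x))"
  by (induction A rule: infinite_finite_induct) (simp_all add: shift_coeff_add)

lemma shift_coeff_mult: "shift_coeff k (f * g) = (\<Sum>i\<le>k. shift_coeff i f * shift_coeff (k - i) g)"
  by (simp add: shift_coeff_def hom_mult[OF is_ring_hom_shift_poly] coeff_mult)

lemma shift_coeff_scal: "shift_coeff k (scal c) = (if k = 0 then scal c else 0)"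
  by (simp add: shift_coeff_def shift_poly_scal coeff_pCons split: nat.split)

lemma shift_coeff_psum:
  "n \<ge> 1 \<Longrightarrow> shift_coeff k (psum n) = (if k = 0 then psum n else if k = n then - scal (1 - t ^ n) else 0)"
  by (auto simp: shift_coeff_def shift_poly_psum coeff_pCons split: nat.split)

text \<open>A single \<open>shift_coeff k\<close> is not multiplicative, but all of them together
  satisfy a convolution rule. The claim therefore passes to products when it is assumed for all
  \<open>k\<close> and \<open>l\<close> at once.\<close>

lemma shift_coeff_commute: "shift_coeff k (shift_coeff l f) = shift_coeff l (shift_coeff k f)"
proof (induction f arbitrary: k l rule: poly_induct)
  case (scal c)
  then show ?case by (simp add: shift_coeff_scal)
next
  case (indet n)
  then show ?case
    by (simp add: indet_eq_psum shift_coeff_psum scal_simps shift_coeff_scal)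
next
  case (add f g)
  then show ?case by (simp add: shift_coeff_add)
next
  case (mult f g)
  have *: "shift_coeff k (shift_coeff l (f * g)) = (\<Sum>i\<le>l. \<Sum>j\<le>k. shift_coeff j (shift_coeff i f) * shift_coeff (k - j) (shift_coeff (l - i) g))" for k l
    by (simp add: shift_coeff_mult shift_coeff_sum)
  then show ?case
    by (subst (1 2) *, subst sum.swap) (simp add: mult)
qed

text \<open>The coefficient of \<open>x ^ i\<close> in (1 - x) / (1 - t x), which is the series of
  complete functions of the alphabet -(1 - t).\<close>

definition shift_hsym_coeff :: "nat \<Rightarrow> rat fps" where
  "shift_hsym_coeff i = (if i = 0 then 1 else t ^ i - t ^ (i - 1))"

text \<open>The alphabet X - (1 - t) z is the sum of X, -z and t z, whose series are
  \<open>?H\<close>, \<open>?a\<close> and \<open>?b\<close>.\<close>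

lemma shift_poly_hsym: "shift_poly (hsym n) = (\<Sum>i\<le>n. monom (scal (shift_hsym_coeff i) * hsym (n - i)) i)"
proof -
  let ?z = "monom 1 1 :: sym poly"
  let ?H = "Abs_fps (\<lambda>n. [:hsym n:])"
  let ?a = "1 - fps_const ?z * fps_X" and ?b = "Abs_fps (\<lambda>n. ([:scal t:] * ?z) ^ n)"
  have zk: "([:scal c:] * ?z) ^ k = monom (scal (c ^ k)) k" for c k
    by (simp add: power_mult_distrib monom_power smult_monom hom_simps[OF is_ring_hom_scal]
        hom_power[OF is_ring_hom_const_poly, symmetric])
  have zk1: "?z ^ k = monom 1 k" for k
    by (simp add: monom_power)
  have "newton (?H * (?a * ?b)) (\<lambda>k. [:psum k:] + (- (?z ^ k) + ([:scal t:] * ?z) ^ k))"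
    using newton_hom[OF is_ring_hom_const_poly newton_hsym]
    by (intro newton_mult newton_linear newton_geom) simp
  also have "(\<lambda>k. [:psum k:] + (- (?z ^ k) + ([:scal t:] * ?z) ^ k)) =
      (\<lambda>k. [:psum k:] - monom (scal (1 - t ^ k)) k)"
    unfolding zk zk1 hom_diff[OF is_ring_hom_scal] diff_monom[symmetric] hom_one[OF is_ring_hom_scal]
    by (simp add: algebra_simps)
  finally have "shift_poly (hsym n) = fps_nth (?H * (?a * ?b)) n"
    unfolding shift_poly_def by (rule eval_with_hsym[OF is_ring_hom_const_scal])
  also have "?a * ?b = Abs_fps (\<lambda>i. monom (scal (shift_hsym_coeff i)) i)"
  proof (rule fps_ext)
    fix i
    show "fps_nth (?a * ?b) i = fps_nth (Abs_fps (\<lambda>i. monom (scal (shift_hsym_coeff i)) i)) i"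
      unfolding left_diff_distrib zk mult_1 mult.assoc
      by (cases i) (simp_all add: shift_hsym_coeff_def hom_simps[OF is_ring_hom_scal] mult_monom
          diff_monom one_pCons monom_0)
  qed
  also have "fps_nth (?H * Abs_fps (\<lambda>i. monom (scal (shift_hsym_coeff i)) i)) n
      = (\<Sum>i\<le>n. monom (scal (shift_hsym_coeff i) * hsym (n - i)) i)"
    unfolding mult.commute[of ?H] fps_mult_nth atLeast0AtMost
    by (simp add: mult.commute[of _ "[:_:]"] smult_monom mult.commute)
  finally show ?thesis .
qed

text \<open>With the polynomial variable in the place of 1/u, this extracts the coefficient of
  \<open>u ^ m\<close> in \<open>P(1/u)\<close> times the series of the
  \<open>hsym n * u ^ n\<close>: the power \<open>k\<close> of 1/u meets
  \<open>hsym (m + k)\<close>.\<close>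

definition hsym_functional :: "nat \<Rightarrow> sym poly \<Rightarrow> sym" where
  "hsym_functional m P = (\<Sum>k\<le>degree P. hsym (m + k) * coeff P k)"

lemma hsym_functional_bound: "degree P \<le> N \<Longrightarrow> hsym_functional m P = (\<Sum>k\<le>N. hsym (m + k) * coeff P k)"
  unfolding hsym_functional_def by (rule sum.mono_neutral_left) (auto simp: coeff_eq_0)

lemma hsym_functional_add: "hsym_functional m (P + Q) = hsym_functional m P + hsym_functional m Q"
  using degree_add_le_max[of P Q]
  by (subst (1 2 3) hsym_functional_bound[where N = "max (degree P) (degree Q)"])
    (auto simp: sum.distrib distrib_left)

lemma hsym_functional_zero [simp]: "hsym_functional m 0 = 0"
  by (simp add: hsym_functional_def)

lemma hsym_functional_sum: "hsym_functional m (sum P A) = (\<Sum>x\<in>A. hsym_functional m (P x))"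
  by (induction A rule: infinite_finite_induct) (simp_all add: hsym_functional_add)

lemma hsym_functional_monom_mult: "hsym_functional m (monom a i * P) = a * hsym_functional (m + i) P"
proof -
  have "degree (monom a i * P) \<le> degree P + i"
    using degree_mult_le[of "monom a i" P] degree_monom_le[of a i] by linarith
  then have "hsym_functional m (monom a i * P) = (\<Sum>k\<le>degree P + i. hsym (m + k) * coeff (monom a i * P) k)"
    by (rule hsym_functional_bound)
  also have "\<dots> = (\<Sum>k\<in>{i..degree P + i}. hsym (m + k) * (a * coeff P (k - i)))"
    by (intro sum.mono_neutral_cong_right) (auto simp: coeff_monom_mult)
  also have "\<dots> = (\<Sum>k\<in>{0..degree P}. hsym (m + (k + i)) * (a * coeff P k))"
    using sum.shift_bounds_cl_nat_ivl[of "\<lambda>k. hsym (m + k) * (a * coeff P (k - i))" 0 i "degree P"]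
    by simp
  also have "\<dots> = a * hsym_functional (m + i) P"
    by (simp add: hsym_functional_def sum_distrib_left atLeast0AtMost mult_ac add_ac)
  finally show ?thesis .
qed

lemma hsym_functional_smult: "hsym_functional m (smult a P) = a * hsym_functional m P"
  using hsym_functional_monom_mult[of m a 0 P] by (simp add: monom_0)

text \<open>The operator \<open>B_m\<close> of the overview. Natural indices suffice because the
  relations below pair \<open>m\<close> with \<open>Suc m\<close>.\<close>

definition jing :: "nat \<Rightarrow> sym \<Rightarrow> sym" where
  "jing m f = hsym_functional m (shift_poly f)"

lemma jing_bound: "(\<And>k. k > N \<Longrightarrow> shift_coeff k f = 0) \<Longrightarrow> jing m f = (\<Sum>k\<le>N. hsym (m + k) * shift_coeff k f)"
  unfolding jing_def shift_coeff_def by (rule hsym_functional_bound) (auto intro: degree_le)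

lemma jing_add: "jing m (f + g) = jing m f + jing m g"
  by (simp add: jing_def hom_add[OF is_ring_hom_shift_poly] hsym_functional_add)

lemma jing_zero [simp]: "jing m 0 = 0"
  by (simp add: jing_def hom_zero[OF is_ring_hom_shift_poly])

lemma jing_sum: "jing m (sum f A) = (\<Sum>x\<in>A. jing m (f x))"
  by (induction A rule: infinite_finite_induct) (simp_all add: jing_add)

lemma jing_scal_mult: "jing m (scal c * f) = scal c * jing m f"
  by (simp add: jing_def hom_mult[OF is_ring_hom_shift_poly] shift_poly_scal hsym_functional_smult)

lemma jing_hh_mult: "jing a (hsym n * f) = (\<Sum>i\<le>n. scal (shift_hsym_coeff i) * hsym (n - i) * jing (a + i) f)"
  by (simp add: jing_def hom_mult[OF is_ring_hom_shift_poly] shift_poly_hsym sum_distrib_right hsym_functional_sum hsym_functional_monom_mult)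

text \<open>A row that has become empty disappears. This is what happens to rows of length 1 when
  they lose a box.\<close>

lemma jing_0_one: "jing 0 1 = 1"
  using shift_poly_scal[of 1] by (simp add: jing_def hsym_functional_def hom_one[OF is_ring_hom_scal])

lemma shift_coeff_eventually_zero: "\<exists>N. \<forall>k>N. shift_coeff k f = 0"
  unfolding shift_coeff_def by (meson coeff_eq_0)

text \<open>One cutoff for both levels, uniform in \<open>l\<close>, so that the double sums in
  \<open>jing_commute\<close> run over a square and can be transposed.\<close>

lemma shift_coeff_shift_coeff_eventually_zero: "\<exists>N. (\<forall>k>N. shift_coeff k f = 0) \<and> (\<forall>l k. k > N \<longrightarrow> shift_coeff k (shift_coeff l f) = 0)"
proof -
  obtain N where N: "\<forall>k>N. shift_coeff k f = 0" using shift_coeff_eventually_zero by blast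
  have "\<forall>l. \<exists>M. \<forall>k>M. shift_coeff k (shift_coeff l f) = 0" using shift_coeff_eventually_zero by blast
  then obtain M where M: "\<And>l k. k > M l \<Longrightarrow> shift_coeff k (shift_coeff l f) = 0" by metis
  let ?K = "Max (insert N (M ` {..N}))"
  have "shift_coeff k (shift_coeff l f) = 0" if "k > ?K" for l k
  proof (cases "l \<le> N")
    case True
    then have "M l \<le> ?K" by (intro Max_ge) auto
    then show ?thesis using that by (intro M) linarith
  next
    case False
    then show ?thesis using N by simp
  qed
  moreover have "N \<le> ?K" by (intro Max_ge) auto
  ultimately show ?thesis using N by (intro exI[of _ ?K]) auto
qed

lemma jing_jing_eq:
  assumes "\<And>k. k > N \<Longrightarrow> shift_coeff k f = 0"
  shows "jing a (jing b f) = (\<Sum>l\<le>N. \<Sum>i\<le>b + l. scal (shift_hsym_coeff i) * hsym (b + l - i) * jing (a + i) (shift_coeff l f))"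
  using assms by (subst (2) jing_bound[where N = N]) (auto simp: jing_sum jing_hh_mult)

text \<open>The coefficients satisfy
  \<open>shift_hsym_coeff (Suc i) = t * shift_hsym_coeff i\<close> except at \<open>i = 0\<close>,
  where the difference is -1. Hence nearly everything cancels in the difference of the two sides.
  What remains is a double sum that is antisymmetric in \<open>k\<close> and \<open>l\<close>,
  because the two extractions of coefficients commute.\<close>

lemma jing_commute: "jing m (jing (Suc m) f) = scal t * jing (Suc m) (jing m f)"
proof -
  obtain N where N1: "\<And>k. k > N \<Longrightarrow> shift_coeff k f = 0" and N2: "\<And>l k. k > N \<Longrightarrow> shift_coeff k (shift_coeff l f) = 0"
    using shift_coeff_shift_coeff_eventually_zero by blast
  have tele: "(\<Sum>i\<le>Suc n. scal (shift_hsym_coeff i) * hsym (Suc n - i) * b i)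
      - scal t * (\<Sum>i\<le>n. scal (shift_hsym_coeff i) * hsym (n - i) * b (Suc i))
      = hsym (Suc n) * b 0 - hsym n * b 1" for n and b :: "nat \<Rightarrow> sym"
  proof -
    have "(\<Sum>i\<le>Suc n. scal (shift_hsym_coeff i) * hsym (Suc n - i) * b i)
      - scal t * (\<Sum>i\<le>n. scal (shift_hsym_coeff i) * hsym (n - i) * b (Suc i))
      = hsym (Suc n) * b 0 + (\<Sum>i\<le>n. scal (shift_hsym_coeff (Suc i) - t * shift_hsym_coeff i) * (hsym (n - i) * b (Suc i)))"
      unfolding sum.atMost_Suc_shift
      by (simp add: shift_hsym_coeff_def[of 0] hom_simps[OF is_ring_hom_scal] sum_distrib_left
          left_diff_distrib sum_subtractf mult.assoc)
    also have "(\<Sum>i\<le>n. scal (shift_hsym_coeff (Suc i) - t * shift_hsym_coeff i) * (hsym (n - i) * b (Suc i)))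
      = (\<Sum>i\<le>n. if i = 0 then - (hsym n * b 1) else 0)"
    proof (rule sum.cong)
      fix i
      have "shift_hsym_coeff (Suc i) - t * shift_hsym_coeff i = (if i = 0 then -1 else 0)"
        by (cases i) (simp_all add: shift_hsym_coeff_def algebra_simps)
      then show "scal (shift_hsym_coeff (Suc i) - t * shift_hsym_coeff i) * (hsym (n - i) * b (Suc i))
          = (if i = 0 then - (hsym n * b 1) else 0)"
        by (simp add: hom_simps[OF is_ring_hom_scal])
    qed simp
    finally show ?thesis by simp
  qed
  have "jing m (jing (Suc m) f) - scal t * jing (Suc m) (jing m f)
    = (\<Sum>l\<le>N. (\<Sum>i\<le>Suc (m + l). scal (shift_hsym_coeff i) * hsym (Suc (m + l) - i) * jing (m + i) (shift_coeff l f))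
      - scal t * (\<Sum>i\<le>m + l. scal (shift_hsym_coeff i) * hsym (m + l - i) * jing (m + Suc i) (shift_coeff l f)))"
    by (subst (1 2) jing_jing_eq[OF N1]) (simp_all add: sum_subtractf sum_distrib_left)
  also have "\<dots> = (\<Sum>l\<le>N. hsym (Suc (m + l)) * jing m (shift_coeff l f) - hsym (m + l) * jing (Suc m) (shift_coeff l f))"
    by (intro sum.cong refl, subst tele) simp
  also have "\<dots> = (\<Sum>l\<le>N. \<Sum>k\<le>N. hsym (Suc (m + l)) * (hsym (m + k) * shift_coeff k (shift_coeff l f)))
      - (\<Sum>l\<le>N. \<Sum>k\<le>N. hsym (m + l) * (hsym (Suc (m + k)) * shift_coeff k (shift_coeff l f)))"
    using N2 by (simp add: jing_bound[where N = N] sum_subtractf sum_distrib_left)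
  also have "(\<Sum>l\<le>N. \<Sum>k\<le>N. hsym (m + l) * (hsym (Suc (m + k)) * shift_coeff k (shift_coeff l f)))
     = (\<Sum>l\<le>N. \<Sum>k\<le>N. hsym (Suc (m + l)) * (hsym (m + k) * shift_coeff k (shift_coeff l f)))"
    by (subst sum.swap) (intro sum.cong refl, subst shift_coeff_commute, simp add: mult_ac)
  finally show ?thesis by simp
qed

section \<open>Subtraction of one letter from the alphabet\<close>

definition sub_var :: "rat fps \<Rightarrow> sym \<Rightarrow> sym" where
  "sub_var s f = eval_at f (\<lambda>k. psum k - scal (s ^ k))"

lemma is_ring_hom_sub_var: "is_ring_hom (sub_var s)"
  unfolding sub_var_def by (rule is_ring_hom_eval_at)

lemma sub_var_scal: "sub_var s (scal c) = scal c"
  by (simp add: sub_var_def eval_at_scal)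

lemma sub_var_psum: "k \<ge> 1 \<Longrightarrow> sub_var s (psum k) = psum k - scal (s ^ k)"
  by (simp add: sub_var_def eval_at_psum)

lemma shift_coeff_sub_var: "shift_coeff k (sub_var s f) = sub_var s (shift_coeff k f)"
proof (induction f arbitrary: k rule: poly_induct)
  case (scal c)
  then show ?case by (simp add: shift_coeff_scal sub_var_scal hom_simps[OF is_ring_hom_sub_var])
next
  case (indet n)
  have "shift_coeff k (psum (Suc n) - scal (s ^ Suc n)) = shift_coeff k (psum (Suc n)) - shift_coeff k (scal (s ^ Suc n))"
    by (simp add: shift_coeff_def hom_diff[OF is_ring_hom_shift_poly])
  then show ?case
    by (auto simp: indet_eq_psum sub_var_psum shift_coeff_psum shift_coeff_scal sub_var_scal hom_simps[OF is_ring_hom_sub_var])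
next
  case (add f g)
  then show ?case by (simp add: shift_coeff_add hom_simps[OF is_ring_hom_sub_var])
next
  case (mult f g)
  then show ?case by (simp add: shift_coeff_mult hom_simps[OF is_ring_hom_sub_var])
qed

lemma sub_var_hh_Suc: "sub_var s (hsym (Suc n)) = hsym (Suc n) - scal s * hsym n"
proof -
  have "newton (Abs_fps hsym * (1 - fps_const (scal s) * fps_X)) (\<lambda>k. psum k + - (scal s ^ k))"
    by (intro newton_mult newton_hsym newton_linear)
  from eval_with_hsym[OF is_ring_hom_scal this, of "Suc n"]
  show ?thesis
    by (simp add: sub_var_def eval_at_def hom_power[OF is_ring_hom_scal] algebra_simps)
qed

lemma sub_var_B: "sub_var s (jing (Suc m) f) = jing (Suc m) (sub_var s f) - scal s * jing m (sub_var s f)"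
proof -
  obtain N where N: "\<And>k. k > N \<Longrightarrow> shift_coeff k f = 0"
    using shift_coeff_eventually_zero by blast
  then have N': "shift_coeff k (sub_var s f) = 0" if "k > N" for k
    using that by (simp add: shift_coeff_sub_var hom_zero[OF is_ring_hom_sub_var])
  have "sub_var s (jing (Suc m) f) = (\<Sum>k\<le>N. (hsym (Suc (m + k)) - scal s * hsym (m + k)) * shift_coeff k (sub_var s f))"
    by (subst jing_bound[where N = N]) (simp_all add: N hom_simps[OF is_ring_hom_sub_var] sub_var_hh_Suc shift_coeff_sub_var)
  also have "\<dots> = jing (Suc m) (sub_var s f) - scal s * jing m (sub_var s f)"
    using N' by (simp add: jing_bound[where N = N] sum_subtractf sum_distrib_left algebra_simps)
  finally show ?thesis .
qed

definition jing_prod :: "nat list \<Rightarrow> sym" where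
  "jing_prod \<kappa> = foldr jing \<kappa> 1"

lemma jing_prod_Nil [simp]: "jing_prod [] = 1"
  by (simp add: jing_prod_def)

lemma jing_prod_Cons: "jing_prod (r # \<kappa>) = jing r (jing_prod \<kappa>)"
  by (simp add: jing_prod_def)

section \<open>Density of power sums\<close>

text \<open>Only rational scalars act, because the values of the characters, by whose differences
  one has to divide, are rational. The subspace zero will give uniqueness statements, the span of
  the products of Jing operators an existence statement.\<close>

definition rat_subspace :: "(rat \<Rightarrow> 'a::comm_ring_1) \<Rightarrow> 'a set \<Rightarrow> bool" where
  "rat_subspace \<psi> M \<longleftrightarrow> 0 \<in> M \<and> (\<forall>a\<in>M. \<forall>b\<in>M. a + b \<in> M) \<and> (\<forall>q. \<forall>a\<in>M. \<psi> q * a \<in> M)"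

lemma rat_subspace_sum:
  assumes "rat_subspace \<psi> M" "\<And>i. i \<in> S \<Longrightarrow> g i \<in> M"
  shows "sum g S \<in> M"
  using assms by (induction S rule: infinite_finite_induct) (auto simp: rat_subspace_def)

lemma rat_subspace_diff:
  assumes "is_ring_hom \<psi>" "rat_subspace \<psi> M" "a \<in> M" "b \<in> M"
  shows "a - b \<in> M"
proof -
  have "\<psi> (- 1) * b \<in> M" using assms by (simp add: rat_subspace_def)
  then have "a + - b \<in> M"
    using assms unfolding rat_subspace_def
    by (simp add: hom_simps[OF assms(1)] del: add_uminus_conv_diff)
  then show ?thesis by simp
qed

text \<open>Dedekind's argument for the linear independence of distinct multiplicative characters,
  relative to a subspace.\<close>

lemma characters_independent:
  fixes g :: "'i \<Rightarrow> 'a::comm_ring_1" and \<chi> :: "'i \<Rightarrow> 'x \<Rightarrow> rat"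
  assumes hom: "is_ring_hom \<psi>" and sub: "rat_subspace \<psi> M" and "finite S"
    and mult: "\<And>i x y. \<chi> i (op x y) = \<chi> i x * \<chi> i y" and unit: "\<And>i. \<chi> i e = 1"
    and sep: "\<And>i j. i \<noteq> j \<Longrightarrow> \<exists>x. \<chi> i x \<noteq> \<chi> j x"
    and "\<And>x. (\<Sum>i\<in>S. \<psi> (\<chi> i x) * g i) \<in> M"
  shows "\<forall>i\<in>S. g i \<in> M"
  using \<open>finite S\<close> assms(7)
proof (induction S arbitrary: g rule: finite_induct)
  case empty
  then show ?case by simp
next
  case (insert i0 S)
  have S: "g j \<in> M" if j: "j \<in> S" for j
  proof -
    obtain b where b: "\<chi> j b \<noteq> \<chi> i0 b"
      using sep[of j i0] \<open>i0 \<notin> S\<close> j by blast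
    \<comment> \<open>The hypothesis at \<open>op x b\<close> minus \<open>\<chi> i0 b\<close> times
      the hypothesis at \<open>x\<close>: the term of \<open>i0\<close> cancels, and the term of
      \<open>j\<close> keeps a factor that is invertible by the choice of \<open>b\<close>.\<close>
    have "(\<Sum>i\<in>S. \<psi> (\<chi> i x) * (\<psi> (\<chi> i b - \<chi> i0 b) * g i)) \<in> M" for x
    proof -
      have "(\<Sum>i\<in>insert i0 S. \<psi> (\<chi> i (op x b)) * g i)
          - \<psi> (\<chi> i0 b) * (\<Sum>i\<in>insert i0 S. \<psi> (\<chi> i x) * g i) \<in> M"
        using insert.prems sub
        by (intro rat_subspace_diff[OF hom sub]) (auto simp: rat_subspace_def)
      also have "(\<Sum>i\<in>insert i0 S. \<psi> (\<chi> i (op x b)) * g i)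
          - \<psi> (\<chi> i0 b) * (\<Sum>i\<in>insert i0 S. \<psi> (\<chi> i x) * g i)
          = (\<Sum>i\<in>insert i0 S. \<psi> (\<chi> i x) * (\<psi> (\<chi> i b - \<chi> i0 b) * g i))"
        unfolding sum_distrib_left sum_subtractf[symmetric]
        by (rule sum.cong) (simp_all add: mult hom_simps[OF hom] algebra_simps)
      also have "\<dots> = (\<Sum>i\<in>S. \<psi> (\<chi> i x) * (\<psi> (\<chi> i b - \<chi> i0 b) * g i))"
        using insert.hyps by (simp add: hom_zero[OF hom])
      finally show ?thesis .
    qed
    from insert.IH[OF this] have "\<psi> (\<chi> j b - \<chi> i0 b) * g j \<in> M"
      using j by simp
    then have "\<psi> (1 / (\<chi> j b - \<chi> i0 b)) * (\<psi> (\<chi> j b - \<chi> i0 b) * g j) \<in> M"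
      using sub by (simp add: rat_subspace_def)
    also have "\<psi> (1 / (\<chi> j b - \<chi> i0 b)) * (\<psi> (\<chi> j b - \<chi> i0 b) * g j) = g j"
      using b by (simp add: mult.assoc[symmetric] hom_mult[OF hom, symmetric] hom_one[OF hom])
    finally show ?thesis .
  qed
  \<comment> \<open>At the unit every character is 1, so \<open>g i0\<close> is a member of
    \<open>M\<close> minus terms already known to lie in \<open>M\<close>.\<close>
  have "(\<Sum>i\<in>insert i0 S. \<psi> (\<chi> i e) * g i) - sum g S \<in> M"
    using S by (intro rat_subspace_diff[OF hom sub] insert.prems rat_subspace_sum[OF sub])
  then have "g i0 \<in> M"
    using insert.hyps by (simp add: unit hom_one[OF hom])
  then show ?case using S by simp
qed

section \<open>Power sums of finite rational alphabets\<close>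

definition psum_list :: "nat \<Rightarrow> rat list \<Rightarrow> rat" where
  "psum_list k rs = (\<Sum>r\<leftarrow>rs. r ^ k)"

text \<open>The product of two alphabets: power sums are multiplicative for it.\<close>

fun outer :: "rat list \<Rightarrow> rat list \<Rightarrow> rat list" where
  "outer [] ss = []"
| "outer (r # rs) ss = map ((*) r) ss @ outer rs ss"

lemma psum_list_outer: "psum_list k (outer rs ss) = psum_list k rs * psum_list k ss"
  by (induction rs)
    (simp_all add: psum_list_def o_def power_mult_distrib sum_list_const_mult distrib_right)

text \<open>Substituting linear polynomials with distinct roots turns a monomial into a polynomial
  in one variable from which each exponent is recovered as the multiplicity of a root.\<close>

lemma order_mon_val_linear:
  fixes m :: "nat \<Rightarrow>\<^sub>0 nat"
  assumes "inj c"
  shows "order (- c k) (mon_val (\<lambda>j. [:c j, 1 :: rat:]) m) = Poly_Mapping.lookup m k"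
proof -
  have ord: "order (- c k) ([:c j, 1:] ^ n) = (if j = k then n else 0)" for j n
  proof (cases "j = k")
    case True
    then show ?thesis using order_power_n_n[of "- c k" n] by simp
  next
    case False
    then have "c j \<noteq> c k" using assms by (auto dest: injD)
    then have "poly ([:c j, 1:] ^ n) (- c k) \<noteq> 0" by (simp add: poly_power)
    then show ?thesis using False by (simp add: order_0I)
  qed
  have "order (- c k) (\<Prod>j\<in>K. [:c j, 1:] ^ Poly_Mapping.lookup m j)
      = (\<Sum>j\<in>K. if j = k then Poly_Mapping.lookup m j else 0)" if "finite K" for K
    using that
  proof (induction K rule: finite_induct)
    case (insert j K)
    have "(\<Prod>j\<in>K. [:c j, 1:] ^ Poly_Mapping.lookup m j) \<noteq> 0"
      using insert.hyps(1) by (simp add: prod_zero_iff)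
    then show ?case
      using insert by (auto simp: order_mult ord)
  qed simp
  then show ?thesis
    by (auto simp: mon_val_def in_keys_iff)
qed

text \<open>The alphabet made of 2 and of \<open>c\<close> copies of 1 has power sums
  \<open>2 ^ k + c\<close>. Two monomials that agree on it for all \<open>c\<close> agree as
  polynomials in \<open>c\<close>, and the roots \<open>- (2 ^ k)\<close> are pairwise
  distinct.\<close>

lemma power_sums_separate:
  fixes m n :: "nat \<Rightarrow>\<^sub>0 nat"
  assumes "m \<noteq> n"
  shows "\<exists>rs. mon_val (\<lambda>k. psum_list (Suc k) rs) m \<noteq> mon_val (\<lambda>k. psum_list (Suc k) rs) n"
proof (rule ccontr)
  assume "\<not> ?thesis"
  then have eq: "mon_val (\<lambda>k. psum_list (Suc k) rs) m = mon_val (\<lambda>k. psum_list (Suc k) rs) n" for rs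
    by blast
  define P where "P m = mon_val (\<lambda>k. [:2 ^ Suc k, 1 :: rat:]) m" for m :: "nat \<Rightarrow>\<^sub>0 nat"
  have "poly (P m) (of_nat c) = mon_val (\<lambda>k. psum_list (Suc k) (2 # replicate c 1)) m" for m c
    by (simp add: P_def mon_val_def poly_prod psum_list_def sum_list_replicate)
  then have "range of_nat \<subseteq> {x. poly (P m - P n) x = 0}"
    using eq by auto
  moreover have "infinite (range (of_nat :: nat \<Rightarrow> rat))"
    by (simp add: inj_on_def finite_image_iff)
  ultimately have "P m = P n"
    using poly_roots_finite[of "P m - P n"] finite_subset by auto
  moreover have "inj (\<lambda>k. 2 ^ Suc k :: rat)"
    by (auto intro!: injI simp del: power_Suc)
  ultimately have "Poly_Mapping.lookup m k = Poly_Mapping.lookup n k" for k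
    using order_mon_val_linear[of "\<lambda>k. 2 ^ Suc k"] by (metis P_def)
  then show False
    using assms by (simp add: poly_mapping_eqI)
qed

lemma power_sums_dense:
  fixes g :: "(nat \<Rightarrow>\<^sub>0 nat) \<Rightarrow> 'a::comm_ring_1"
  assumes "is_ring_hom \<psi>" "rat_subspace \<psi> M" "finite S"
    and "\<And>rs. (\<Sum>m\<in>S. \<psi> (mon_val (\<lambda>k. psum_list (Suc k) rs) m) * g m) \<in> M"
    and "m \<in> S"
  shows "g m \<in> M"
proof -
  have "\<forall>m\<in>S. g m \<in> M"
  proof (rule characters_independent[where \<chi> = "\<lambda>m rs. mon_val (\<lambda>k. psum_list (Suc k) rs) m"
        and op = outer and e = "[1]", OF assms(1-3)])
    show "mon_val (\<lambda>k. psum_list (Suc k) (outer x y)) i =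
      mon_val (\<lambda>k. psum_list (Suc k) x) i * mon_val (\<lambda>k. psum_list (Suc k) y) i" for i x y
      by (simp add: psum_list_outer mon_val_mult)
    show "mon_val (\<lambda>k. psum_list (Suc k) [1]) i = 1" for i
      by (simp add: psum_list_def)
  qed (use power_sums_separate assms(4) in auto)
  then show ?thesis using assms(5) by blast
qed

text \<open>Rational alphabets suffice although the coefficients are power series in
  \<open>t\<close>: density with the subspace zero is applied to the coefficients of
  \<open>f - g\<close>.\<close>

lemma sym_eqI:
  assumes "\<And>rs. eval_with (\<lambda>c. c) f (\<lambda>k. fps_const (psum_list k rs)) =
    eval_with (\<lambda>c. c) g (\<lambda>k. fps_const (psum_list k rs))"
  shows "f = g"
proof -
  define d where "d = f - g"
  have "(\<Sum>m\<in>Poly_Mapping.keys d. fps_const (mon_val (\<lambda>k. psum_list (Suc k) rs) m) *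
      Poly_Mapping.lookup d m) \<in> {0}" for rs
  proof -
    have "eval_with (\<lambda>c. c) d (\<lambda>k. fps_const (psum_list k rs)) = 0"
      using assms[of rs] by (simp add: d_def hom_diff[OF is_ring_hom_eval_with[OF is_ring_hom_id]])
    then show ?thesis
      by (simp add: eval_with_eq_peval peval_def hom_mon_val[OF is_ring_hom_fps_const] mult.commute)
  qed
  from power_sums_dense[OF is_ring_hom_fps_const _ finite_keys this]
  have "Poly_Mapping.lookup d m = 0" for m
    by (cases "m \<in> Poly_Mapping.keys d") (auto simp: rat_subspace_def in_keys_iff)
  then have "d = 0" by (simp add: poly_mapping_eqI)
  then show ?thesis by (simp add: d_def)
qed

section \<open>Hall--Littlewood functions as products of Jing operators\<close>

text \<open>Two roles meet in this product. It is the contribution of index \<open>i\<close> to the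
  Hall-Littlewood symmetrization when \<open>i\<close> comes before all other members of
  \<open>S\<close>, and up to the factor \<open>1 - \<tau>\<close> it is a coefficient of the
  partial fraction expansion of the product of the (1 - \<open>\<tau>\<close> x u) / (1 - x u) over
  the letters x.\<close>

definition gfac :: "('i \<Rightarrow> 'k::field) \<Rightarrow> 'k \<Rightarrow> 'i set \<Rightarrow> 'i \<Rightarrow> 'k" where
  "gfac x \<tau> S i = (\<Prod>j\<in>S - {i}. (x i - \<tau> * x j) / (x i - x j))"

lemma gfac_insert:
  assumes "finite S" "b \<notin> S" "i \<in> S"
  shows "gfac x \<tau> (insert b S) i = gfac x \<tau> S i * ((x i - \<tau> * x b) / (x i - x b))"
proof -
  have "insert b S - {i} = insert b (S - {i})" using assms by auto
  then show ?thesis using assms by (simp add: gfac_def)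
qed

lemma gfac_insert_self: "b \<notin> S \<Longrightarrow> gfac x \<tau> (insert b S) b = (\<Prod>j\<in>S. (x b - \<tau> * x j) / (x b - x j))"
  by (simp add: gfac_def)

text \<open>Auxiliary to the power series version below, where the left side at
  \<open>a = x b\<close> is the coefficient belonging to a new letter \<open>b\<close>. The point
  \<open>a\<close> is arbitrary because the induction step uses the hypothesis both at
  \<open>a\<close> and at the new letter.\<close>

lemma partial_fraction:
  fixes x :: "'i \<Rightarrow> 'k::field"
  assumes "finite S" "inj_on x S" "a \<notin> x ` S"
  shows "(\<Prod>j\<in>S. (a - \<tau> * x j) / (a - x j)) =
    \<tau> ^ card S + (\<Sum>i\<in>S. (1 - \<tau>) * gfac x \<tau> S i * (a / (a - x i)))"
  using assms
proof (induction S arbitrary: a rule: finite_induct)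
  case empty
  then show ?case by simp
next
  case (insert b S)
  define y where "y = x b"
  have y: "y \<notin> x ` S" "a \<noteq> y" and inj: "inj_on x S" and a: "a \<notin> x ` S"
    using insert.prems insert.hyps by (auto simp: y_def inj_on_def)
  have step: "(1 - \<tau>) * (g * ((u - \<tau> * y) / (u - y))) * (a / (a - u))
      + (1 - \<tau>) * ((1 - \<tau>) * g * (y / (y - u))) * (a / (a - y))
      = (a - \<tau> * y) / (a - y) * ((1 - \<tau>) * g * (a / (a - u)))"
    if "u \<noteq> y" "u \<noteq> a" for u g
  proof -
    have "(u - \<tau> * y) / (u - y) * (a / (a - u)) + (1 - \<tau>) * (y / (y - u)) * (a / (a - y))
       = (a - \<tau> * y) / (a - y) * (a / (a - u))"
    proof -
      have nz: "u - y \<noteq> 0" "a - u \<noteq> 0" "a - y \<noteq> 0" using that y by auto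
      have "y / (y - u) = - (y / (u - y))"
        by (metis minus_diff_eq minus_divide_right)
      moreover have "(u - \<tau> * y) / (u - y) * (a / (a - u)) + (1 - \<tau>) * - (y / (u - y)) * (a / (a - y))
          = (a - \<tau> * y) / (a - y) * (a / (a - u))"
        using nz by (simp add: divide_simps) (simp add: algebra_simps)
      ultimately show ?thesis by simp
    qed
    then have "(1 - \<tau>) * g * ((u - \<tau> * y) / (u - y) * (a / (a - u)) + (1 - \<tau>) * (y / (y - u)) * (a / (a - y)))
       = (1 - \<tau>) * g * ((a - \<tau> * y) / (a - y) * (a / (a - u)))"
      by simp
    then show ?thesis by (simp only: distrib_left mult_ac)
  qed
  have "\<tau> ^ card (insert b S) + (\<Sum>i\<in>insert b S. (1 - \<tau>) * gfac x \<tau> (insert b S) i * (a / (a - x i)))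
    = \<tau> ^ Suc (card S) + (1 - \<tau>) * (\<Prod>j\<in>S. (y - \<tau> * x j) / (y - x j)) * (a / (a - y))
      + (\<Sum>i\<in>S. (1 - \<tau>) * (gfac x \<tau> S i * ((x i - \<tau> * y) / (x i - y))) * (a / (a - x i)))"
    using insert.hyps by (simp add: gfac_insert gfac_insert_self y_def)
  also have "\<dots> = (\<tau> ^ Suc (card S) + (1 - \<tau>) * \<tau> ^ card S * (a / (a - y))) +
      (\<Sum>i\<in>S. (1 - \<tau>) * (gfac x \<tau> S i * ((x i - \<tau> * y) / (x i - y))) * (a / (a - x i))
        + (1 - \<tau>) * ((1 - \<tau>) * gfac x \<tau> S i * (y / (y - x i))) * (a / (a - y)))"
    by (subst insert.IH[OF inj y(1)])
      (simp only: sum.distrib distrib_left distrib_right sum_distrib_left sum_distrib_right add_ac)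
  also have "\<tau> ^ Suc (card S) + (1 - \<tau>) * \<tau> ^ card S * (a / (a - y)) =
      (a - \<tau> * y) / (a - y) * \<tau> ^ card S"
    using y(2) by (simp add: field_simps)
  also have "(\<Sum>i\<in>S. (1 - \<tau>) * (gfac x \<tau> S i * ((x i - \<tau> * y) / (x i - y))) * (a / (a - x i))
        + (1 - \<tau>) * ((1 - \<tau>) * gfac x \<tau> S i * (y / (y - x i))) * (a / (a - y)))
      = (\<Sum>i\<in>S. (a - \<tau> * y) / (a - y) * ((1 - \<tau>) * gfac x \<tau> S i * (a / (a - x i))))"
    using y(1) a by (intro sum.cong refl step) auto
  also have "(a - \<tau> * y) / (a - y) * \<tau> ^ card S + \<dots> = (a - \<tau> * y) / (a - y) *
      (\<Prod>j\<in>S. (a - \<tau> * x j) / (a - x j))"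
    by (subst insert.IH[OF inj a]) (simp add: distrib_left sum_distrib_left)
  also have "\<dots> = (\<Prod>j\<in>insert b S. (a - \<tau> * x j) / (a - x j))"
    using insert.hyps by (simp add: y_def)
  finally show ?case by simp
qed

abbreviation geom :: "'a::comm_ring_1 \<Rightarrow> 'a fps" where
  "geom c \<equiv> Abs_fps (\<lambda>n. c ^ n)"

lemma geom_mult:
  fixes b c :: "'k::field"
  assumes "b \<noteq> c"
  shows "geom c * geom b = fps_const (b / (b - c)) * geom b - fps_const (c / (b - c)) * geom c"
proof -
  have "fps_const b * geom b - fps_const c * geom c
    = fps_const b * geom b * ((1 - fps_const c * fps_X) * geom c)
      - fps_const c * geom c * ((1 - fps_const b * fps_X) * geom b)"
    by (simp add: geom_series_inverse)
  also have "\<dots> = (fps_const b - fps_const c) * (geom b * geom c)"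
    by (simp add: algebra_simps del: fps_const_sub)
  finally have "fps_const (1 / (b - c)) * (fps_const b * geom b - fps_const c * geom c)
    = (fps_const (1 / (b - c)) * fps_const (b - c)) * (geom c * geom b)"
    by (simp only: mult_ac fps_const_sub)
  also have "fps_const (1 / (b - c)) * fps_const (b - c) = 1"
    using assms by (simp add: fps_const_mult)
  finally show ?thesis
    by (simp add: right_diff_distrib mult.assoc[symmetric])
qed

text \<open>The constant \<open>\<tau> ^ card S\<close> is the value at infinity of the rational
  function, since every factor tends to \<open>\<tau>\<close>. Multiplying by one more factor splits
  each product of two geometric series, and the parts that fall on the new letter add up by
  \<open>partial_fraction\<close>.\<close>

lemma partial_fraction_fps:
  fixes x :: "'i \<Rightarrow> 'k::field"
  assumes "finite S" "inj_on x S"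
  shows "(\<Prod>i\<in>S. (1 - fps_const (\<tau> * x i) * fps_X) * geom (x i)) =
    fps_const (\<tau> ^ card S) + (\<Sum>i\<in>S. fps_const ((1 - \<tau>) * gfac x \<tau> S i) * geom (x i))"
  using assms
proof (induction S rule: finite_induct)
  case empty
  then show ?case by simp
next
  case (insert b S)
  define y where "y = x b"
  have y: "y \<notin> x ` S" and inj: "inj_on x S"
    using insert.prems insert.hyps by (auto simp: y_def inj_on_def)
  have lin: "(1 - fps_const (\<tau> * y) * fps_X) * geom y = fps_const \<tau> + fps_const (1 - \<tau>) * geom y"
  proof -
    have "1 - fps_const (\<tau> * y) * fps_X
        = fps_const \<tau> * (1 - fps_const y * fps_X) + fps_const (1 - \<tau>)"
      by (simp add: algebra_simps flip: fps_const_mult fps_const_sub)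
    then have "(1 - fps_const (\<tau> * y) * fps_X) * geom y
        = fps_const \<tau> * ((1 - fps_const y * fps_X) * geom y) + fps_const (1 - \<tau>) * geom y"
      by (simp only: distrib_right mult.assoc)
    then show ?thesis by (simp add: geom_series_inverse)
  qed
  have step: "(fps_const \<tau> + fps_const (1 - \<tau>) * geom y) * (fps_const ((1 - \<tau>) * g) * geom u)
      = fps_const ((1 - \<tau>) * (g * ((u - \<tau> * y) / (u - y)))) * geom u
        + fps_const ((1 - \<tau>) * ((1 - \<tau>) * g * (y / (y - u)))) * geom y"
    if "u \<noteq> y" for u g
  proof -
    have c: "\<tau> - (1 - \<tau>) * (u / (y - u)) = (u - \<tau> * y) / (u - y)"
    proof -
      have "y - u \<noteq> 0" using that by simp
      then have "\<tau> - (1 - \<tau>) * (u / (y - u)) = (\<tau> * y - u) / (y - u)"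
        by (simp add: field_simps)
      also have "\<dots> = (u - \<tau> * y) / (u - y)"
        by (metis minus_diff_eq minus_divide_divide)
      finally show ?thesis .
    qed
    have "(fps_const \<tau> + fps_const (1 - \<tau>) * geom y) * (fps_const ((1 - \<tau>) * g) * geom u)
      = fps_const (\<tau> * ((1 - \<tau>) * g)) * geom u
        + fps_const ((1 - \<tau>) * ((1 - \<tau>) * g)) * (geom u * geom y)"
      unfolding fps_const_mult[symmetric] by (simp only: distrib_right distrib_left mult_ac)
    also have "\<dots> = fps_const ((1 - \<tau>) * g * (\<tau> - (1 - \<tau>) * (u / (y - u)))) * geom u
        + fps_const ((1 - \<tau>) * ((1 - \<tau>) * g) * (y / (y - u))) * geom y"
    proof -
      have ring: "(p * c) * v + (d * c) * (q * w - r * v) = (c * p - c * (d * r)) * v + (d * c * q) * w"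
        for p c v d q w r :: "'k fps"
        by (simp add: algebra_simps)
      show ?thesis
        using ring[of "fps_const \<tau>" "fps_const ((1 - \<tau>) * g)" "geom u" "fps_const (1 - \<tau>)"
            "fps_const (y / (y - u))" "geom y" "fps_const (u / (y - u))"]
        unfolding geom_mult[OF that[symmetric]]
        by (simp only: fps_const_mult fps_const_sub right_diff_distrib[of "(1 - \<tau>) * g"])
    qed
    finally show ?thesis unfolding c by (simp only: mult_ac)
  qed
  have "(\<Prod>i\<in>insert b S. (1 - fps_const (\<tau> * x i) * fps_X) * geom (x i))
    = (fps_const \<tau> + fps_const (1 - \<tau>) * geom y) *
      (fps_const (\<tau> ^ card S) + (\<Sum>i\<in>S. fps_const ((1 - \<tau>) * gfac x \<tau> S i) * geom (x i)))"
    using insert.hyps insert.IH[OF inj] by (simp add: y_def[symmetric] lin)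
  also have "\<dots> = fps_const (\<tau> ^ Suc (card S)) + fps_const ((1 - \<tau>) * \<tau> ^ card S) * geom y +
      (\<Sum>i\<in>S. (fps_const \<tau> + fps_const (1 - \<tau>) * geom y) *
        (fps_const ((1 - \<tau>) * gfac x \<tau> S i) * geom (x i)))"
    by (simp add: distrib_left sum_distrib_left distrib_right mult_ac flip: fps_const_mult)
  also have "(\<Sum>i\<in>S. (fps_const \<tau> + fps_const (1 - \<tau>) * geom y) *
        (fps_const ((1 - \<tau>) * gfac x \<tau> S i) * geom (x i)))
      = (\<Sum>i\<in>S. fps_const ((1 - \<tau>) * (gfac x \<tau> S i * ((x i - \<tau> * y) / (x i - y)))) * geom (x i)
        + fps_const ((1 - \<tau>) * ((1 - \<tau>) * gfac x \<tau> S i * (y / (y - x i)))) * geom y)"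
    using y by (intro sum.cong refl step) auto
  also have "\<dots> = (\<Sum>i\<in>S. fps_const ((1 - \<tau>) * (gfac x \<tau> S i * ((x i - \<tau> * y) / (x i - y)))) * geom (x i))
      + fps_const (\<Sum>i\<in>S. (1 - \<tau>) * ((1 - \<tau>) * gfac x \<tau> S i * (y / (y - x i)))) * geom y"
    by (simp add: sum.distrib hom_sum[OF is_ring_hom_fps_const] sum_distrib_right)
  also have "fps_const (\<tau> ^ Suc (card S)) + fps_const ((1 - \<tau>) * \<tau> ^ card S) * geom y + \<dots>
    = fps_const (\<tau> ^ Suc (card S))
      + (\<Sum>i\<in>S. fps_const ((1 - \<tau>) * (gfac x \<tau> S i * ((x i - \<tau> * y) / (x i - y)))) * geom (x i))
      + fps_const ((1 - \<tau>) * (\<tau> ^ card S + (\<Sum>i\<in>S. (1 - \<tau>) * gfac x \<tau> S i * (y / (y - x i))))) * geom y"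
    by (simp add: distrib_left distrib_right sum_distrib_left flip: fps_const_add)
  also have "\<dots> = fps_const (\<tau> ^ card (insert b S))
      + (\<Sum>i\<in>insert b S. fps_const ((1 - \<tau>) * gfac x \<tau> (insert b S) i) * geom (x i))"
    unfolding partial_fraction[OF insert.hyps(1) inj y, symmetric]
    using insert.hyps by (simp add: gfac_insert gfac_insert_self y_def)
  finally show ?case .
qed

text \<open>The constant coefficient of the expansion above. It produces the normalizing factor in
  \<open>hl_sum_Nil\<close>.\<close>

lemma gfac_sum:
  assumes "finite S" "inj_on x S"
  shows "(1 - \<tau>) * (\<Sum>i\<in>S. gfac x \<tau> S i) = 1 - \<tau> ^ card S"
proof -
  have "fps_nth (\<Prod>i\<in>S. (1 - fps_const (\<tau> * x i) * fps_X) * geom (x i)) 0 = 1"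
    using newton_prod[of S "\<lambda>i. (1 - fps_const (\<tau> * x i) * fps_X) * geom (x i)"]
      newton_mult[OF newton_linear newton_geom] by (fastforce simp: newton_def)
  then show ?thesis
    unfolding partial_fraction_fps[OF assms]
    by (simp add: fps_sum_nth sum_distrib_left eq_diff_eq add.commute)
qed

text \<open>For the alphabet (1 - t) S the series of complete functions is the product just
  expanded. For \<open>m \<ge> 1\<close> its term \<open>\<tau> ^ card S\<close> does not
  contribute; this is where it matters that the parts are nonzero.\<close>

lemma eval_hsym_alphabet:
  fixes x :: "'i \<Rightarrow> 'k::field"
  assumes "is_ring_hom \<phi>" "finite S" "inj_on x S" "m \<ge> 1"
  shows "eval_with \<phi> (hsym m) (\<lambda>k. (1 - \<phi> t ^ k) * (\<Sum>i\<in>S. x i ^ k)) =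
    (1 - \<phi> t) * (\<Sum>i\<in>S. gfac x (\<phi> t) S i * x i ^ m)"
proof -
  have "newton (\<Prod>i\<in>S. (1 - fps_const (\<phi> t * x i) * fps_X) * geom (x i))
      (\<lambda>k. \<Sum>i\<in>S. - ((\<phi> t * x i) ^ k) + x i ^ k)"
    by (intro newton_prod newton_mult newton_linear newton_geom)
  also have "(\<lambda>k. \<Sum>i\<in>S. - ((\<phi> t * x i) ^ k) + x i ^ k) =
      (\<lambda>k. (1 - \<phi> t ^ k) * (\<Sum>i\<in>S. x i ^ k))"
    by (simp add: sum_distrib_left power_mult_distrib algebra_simps)
  finally have "eval_with \<phi> (hsym m) (\<lambda>k. (1 - \<phi> t ^ k) * (\<Sum>i\<in>S. x i ^ k)) =
     fps_nth (\<Prod>i\<in>S. (1 - fps_const (\<phi> t * x i) * fps_X) * geom (x i)) m"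
    by (rule eval_with_hsym[OF assms(1)])
  then show ?thesis
    unfolding partial_fraction_fps[OF assms(2,3)] using \<open>m \<ge> 1\<close>
    by (simp add: fps_sum_nth sum_distrib_left mult.assoc)
qed

section \<open>Jing operators evaluated at a finite alphabet\<close>

lemma is_ring_hom_poly_map:
  assumes "is_ring_hom h"
  shows "is_ring_hom (\<lambda>p. poly (map_poly h p) z)"
proof -
  note h = hom_simps[OF assms]
  have pc: "poly (map_poly h (pCons a p)) z = h a + z * poly (map_poly h p) z" for a p
    by (simp add: map_poly_pCons h)
  have add: "poly (map_poly h (p + q)) z = poly (map_poly h p) z + poly (map_poly h q) z" for p q
    by (induction p q rule: poly_induct2) (simp_all add: pc h algebra_simps)
  have sm: "poly (map_poly h (smult a p)) z = h a * poly (map_poly h p) z" for a p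
    by (induction p) (simp_all add: pc h algebra_simps)
  have "poly (map_poly h (p * q)) z = poly (map_poly h p) z * poly (map_poly h q) z" for p q
    by (induction p) (simp_all add: pc add sm h algebra_simps)
  then show ?thesis
    by (intro is_ring_homI add) (simp_all add: h)
qed

text \<open>Used with the power sums of (1 - t) S for \<open>P\<close> and with a letter of
  \<open>S\<close> for \<open>z\<close>. The right side is then \<open>f\<close> at (1 - t) times
  \<open>S\<close> without that letter.\<close>

lemma eval_shift_coeff_sum:
  fixes z :: "'a::comm_ring_1"
  assumes "is_ring_hom \<phi>" "\<And>k. k > N \<Longrightarrow> shift_coeff k f = 0"
  shows "(\<Sum>k\<le>N. eval_with \<phi> (shift_coeff k f) P * z ^ k) =
    eval_with \<phi> f (\<lambda>k. P k - (1 - \<phi> t ^ k) * z ^ k)"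
proof -
  let ?h = "\<lambda>f. eval_with \<phi> f P"
  note h = is_ring_hom_eval_with[OF assms(1), of P]
  have "degree (map_poly ?h (shift_poly f)) \<le> N"
    using assms(2) by (intro degree_le) (simp add: coeff_map_poly hom_zero[OF h] shift_coeff_def)
  then have "poly (map_poly ?h (shift_poly f)) z = (\<Sum>k\<le>N. coeff (map_poly ?h (shift_poly f)) k * z ^ k)"
    unfolding poly_altdef by (intro sum.mono_neutral_left) (auto simp: coeff_eq_0)
  also have "\<dots> = (\<Sum>k\<le>N. eval_with \<phi> (shift_coeff k f) P * z ^ k)"
    by (simp add: coeff_map_poly hom_zero[OF h] shift_coeff_def)
  also have "poly (map_poly ?h (shift_poly f)) z = eval_with \<phi> f (\<lambda>k. P k - (1 - \<phi> t ^ k) * z ^ k)"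
    unfolding shift_poly_def hom_eval_with[OF is_ring_hom_poly_map[OF h]]
  proof -
    have "poly (map_poly ?h [:scal c:]) z = \<phi> c" for c
      by (simp add: map_poly_pCons hom_zero[OF h] eval_with_scal assms(1))
    moreover have "poly (map_poly ?h ([:psum k:] - monom (scal (1 - t ^ k)) k)) z
        = P k - (1 - \<phi> t ^ k) * z ^ k" if "k \<ge> 1" for k
      using that
      by (subst hom_diff[OF is_ring_hom_poly_map[OF h]])
        (simp add: map_poly_pCons map_poly_monom hom_zero[OF h] eval_with_scal eval_with_psum
          assms(1) poly_monom hom_simps[OF assms(1)])
    ultimately show "eval_with (\<lambda>c. poly (map_poly ?h [:scal c:]) z) f
        (\<lambda>k. poly (map_poly ?h ([:psum k:] - monom (scal (1 - t ^ k)) k)) z) =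
        eval_with \<phi> f (\<lambda>k. P k - (1 - \<phi> t ^ k) * z ^ k)"
      by (simp only: eval_with_cong[of
            "\<lambda>k. poly (map_poly ?h ([:psum k:] - monom (scal (1 - t ^ k)) k)) z"
            "\<lambda>k. P k - (1 - \<phi> t ^ k) * z ^ k"])
  qed
  finally show ?thesis by simp
qed

definition jing_prod_at :: "(rat fps \<Rightarrow> 'k::field) \<Rightarrow> ('i \<Rightarrow> 'k) \<Rightarrow> nat list \<Rightarrow> 'i set \<Rightarrow> 'k" where
  "jing_prod_at \<phi> x \<kappa> S = eval_with \<phi> (jing_prod \<kappa>) (\<lambda>k. (1 - \<phi> t ^ k) * (\<Sum>i\<in>S. x i ^ k))"

text \<open>The complete functions contribute the partial fraction coefficients and the shift
  removes the letter. Up to one factor \<open>1 - \<phi> t\<close> this is the recursion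
  \<open>hl_sum_rec\<close>.\<close>

lemma jing_prod_at_Cons:
  assumes "is_ring_hom \<phi>" "finite S" "inj_on x S" "r \<ge> 1"
  shows "jing_prod_at \<phi> x (r # \<kappa>) S =
    (\<Sum>i\<in>S. (1 - \<phi> t) * gfac x (\<phi> t) S i * x i ^ r * jing_prod_at \<phi> x \<kappa> (S - {i}))"
proof -
  let ?P = "\<lambda>S k. (1 - \<phi> t ^ k) * (\<Sum>i\<in>S. x i ^ k)"
  let ?h = "\<lambda>f. eval_with \<phi> f (?P S)"
  note h = is_ring_hom_eval_with[OF assms(1), of "?P S"]
  obtain N where N: "\<And>k. k > N \<Longrightarrow> shift_coeff k (jing_prod \<kappa>) = 0"
    using shift_coeff_eventually_zero by blast
  have "jing_prod_at \<phi> x (r # \<kappa>) S = (\<Sum>k\<le>N. ?h (hsym (r + k)) * ?h (shift_coeff k (jing_prod \<kappa>)))"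
    unfolding jing_prod_at_def jing_prod_Cons by (subst jing_bound[OF N]) (simp_all add: hom_simps[OF h])
  also have "\<dots> = (\<Sum>k\<le>N. ((1 - \<phi> t) * (\<Sum>i\<in>S. gfac x (\<phi> t) S i * x i ^ (r + k))) * ?h (shift_coeff k (jing_prod \<kappa>)))"
    using assms by (simp add: eval_hsym_alphabet)
  also have "\<dots> = (\<Sum>i\<in>S. \<Sum>k\<le>N. (1 - \<phi> t) * gfac x (\<phi> t) S i * x i ^ r * (?h (shift_coeff k (jing_prod \<kappa>)) * x i ^ k))"
    unfolding sum_distrib_left sum_distrib_right
    by (subst sum.swap) (simp add: power_add mult_ac)
  also have "\<dots> = (\<Sum>i\<in>S. (1 - \<phi> t) * gfac x (\<phi> t) S i * x i ^ r * jing_prod_at \<phi> x \<kappa> (S - {i}))"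
  proof (rule sum.cong[OF refl])
    fix i assume i: "i \<in> S"
    have "?P S k - (1 - \<phi> t ^ k) * x i ^ k = ?P (S - {i}) k" for k
      using i \<open>finite S\<close> by (simp add: sum_diff1 right_diff_distrib)
    then have "(\<Sum>k\<le>N. ?h (shift_coeff k (jing_prod \<kappa>)) * x i ^ k) = jing_prod_at \<phi> x \<kappa> (S - {i})"
      unfolding jing_prod_at_def by (subst eval_shift_coeff_sum[OF assms(1) N]) simp_all
    then show "(\<Sum>k\<le>N. (1 - \<phi> t) * gfac x (\<phi> t) S i * x i ^ r * (?h (shift_coeff k (jing_prod \<kappa>)) * x i ^ k))
        = (1 - \<phi> t) * gfac x (\<phi> t) S i * x i ^ r * jing_prod_at \<phi> x \<kappa> (S - {i})"
      by (simp add: sum_distrib_left[symmetric])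
  qed
  finally show ?thesis .
qed

text \<open>One term of the symmetrization, for an ordering of the letters. The ordering is a list
  and not a permutation of an index set, so that deleting the first letter leaves an object of the
  same kind.\<close>

definition hl_term :: "('i \<Rightarrow> 'k::field) \<Rightarrow> 'k \<Rightarrow> nat list \<Rightarrow> 'i list \<Rightarrow> 'k" where
  "hl_term x \<tau> \<kappa> xs = (\<Prod>i<length xs. x (xs ! i) ^ part \<kappa> i) *
     (\<Prod>j<length xs. \<Prod>i<j. (x (xs ! i) - \<tau> * x (xs ! j)) / (x (xs ! i) - x (xs ! j)))"

definition hl_sum :: "('i \<Rightarrow> 'k::field) \<Rightarrow> 'k \<Rightarrow> nat list \<Rightarrow> 'i set \<Rightarrow> 'k" where
  "hl_sum x \<tau> \<kappa> S = (\<Sum>xs\<in>permutations_of_set S. hl_term x \<tau> \<kappa> xs)"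

lemma hl_term_Cons:
  assumes "distinct (a # xs)"
  shows "hl_term x \<tau> \<kappa> (a # xs) =
    x a ^ part \<kappa> 0 * gfac x \<tau> (set (a # xs)) a * hl_term x \<tau> (tl \<kappa>) xs"
proof -
  define F where "F a b = (x a - \<tau> * x b) / (x a - x b)" for a b
  have part: "part \<kappa> (Suc i) = part (tl \<kappa>) i" for i
    by (cases \<kappa>) (simp_all add: part_def)
  have "(\<Prod>j<length xs. F a (xs ! j)) = (\<Prod>b\<in>set xs. F a b)"
    using assms by (intro prod.reindex_bij_betw bij_betw_nth) auto
  then have "gfac x \<tau> (set (a # xs)) a = (\<Prod>j<length xs. F a (xs ! j))"
    using assms by (simp add: gfac_insert_self F_def)
  then show ?thesis
    unfolding hl_term_def F_def[symmetric]
    by (simp add: prod.lessThan_Suc_shift part prod.distrib mult_ac del: prod.lessThan_Suc)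
qed

lemma hl_sum_rec:
  assumes "finite S" "S \<noteq> {}"
  shows "hl_sum x \<tau> \<kappa> S =
    (\<Sum>a\<in>S. x a ^ part \<kappa> 0 * gfac x \<tau> S a * hl_sum x \<tau> (tl \<kappa>) (S - {a}))"
proof -
  have "hl_sum x \<tau> \<kappa> S = (\<Sum>a\<in>S. \<Sum>xs\<in>(#) a ` permutations_of_set (S - {a}). hl_term x \<tau> \<kappa> xs)"
    unfolding hl_sum_def permutations_of_set_nonempty[OF assms(2)]
    using assms(1) by (intro sum.UNION_disjoint) auto
  also have "\<dots> = (\<Sum>a\<in>S. \<Sum>xs\<in>permutations_of_set (S - {a}). hl_term x \<tau> \<kappa> (a # xs))"
    by (rule sum.cong[OF refl], subst sum.reindex) (auto simp: inj_on_def)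
  also have "\<dots> = (\<Sum>a\<in>S. \<Sum>xs\<in>permutations_of_set (S - {a}).
      x a ^ part \<kappa> 0 * gfac x \<tau> S a * hl_term x \<tau> (tl \<kappa>) xs)"
  proof (intro sum.cong refl)
    fix a xs assume "a \<in> S" "xs \<in> permutations_of_set (S - {a})"
    then have "distinct (a # xs)" "set (a # xs) = S"
      by (auto dest: permutations_of_setD)
    then show "hl_term x \<tau> \<kappa> (a # xs) = x a ^ part \<kappa> 0 * gfac x \<tau> S a * hl_term x \<tau> (tl \<kappa>) xs"
      using hl_term_Cons[of a xs x \<tau> \<kappa>] by simp
  qed
  finally show ?thesis
    by (simp add: hl_sum_def sum_distrib_left)
qed

text \<open>Macdonald's identity for the symmetrization without a monomial, with denominators
  cleared. It accounts for the zero parts.\<close>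

lemma hl_sum_Nil:
  assumes "finite S" "inj_on x S"
  shows "(1 - \<tau>) ^ card S * hl_sum x \<tau> [] S = (\<Prod>j=1..card S. 1 - \<tau> ^ j)"
  using assms
proof (induction "card S" arbitrary: S)
  case 0
  then show ?case by (simp add: hl_sum_def hl_term_def)
next
  case (Suc n)
  then have "S \<noteq> {}" by auto
  have "(1 - \<tau>) ^ card S * hl_sum x \<tau> [] S =
     (\<Sum>a\<in>S. (1 - \<tau>) * gfac x \<tau> S a * ((1 - \<tau>) ^ card (S - {a}) * hl_sum x \<tau> [] (S - {a})))"
    unfolding hl_sum_rec[OF Suc.prems(1) \<open>S \<noteq> {}\<close>] sum_distrib_left
    using Suc.hyps(2) Suc.prems(1)
    by (intro sum.cong refl) (simp add: part_def flip: Suc.hyps(2))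
  also have "\<dots> = (\<Sum>a\<in>S. (1 - \<tau>) * gfac x \<tau> S a * (\<Prod>j=1..n. 1 - \<tau> ^ j))"
  proof (intro sum.cong refl)
    fix a assume a: "a \<in> S"
    then have "n = card (S - {a})" using Suc by simp
    from Suc.hyps(1)[OF this] show "(1 - \<tau>) * gfac x \<tau> S a *
        ((1 - \<tau>) ^ card (S - {a}) * hl_sum x \<tau> [] (S - {a})) =
        (1 - \<tau>) * gfac x \<tau> S a * (\<Prod>j=1..n. 1 - \<tau> ^ j)"
      using Suc.prems \<open>n = card (S - {a})\<close> by (simp add: inj_on_diff)
  qed
  also have "\<dots> = (1 - \<tau> ^ card S) * (\<Prod>j=1..n. 1 - \<tau> ^ j)"
    unfolding gfac_sum[OF Suc.prems, symmetric] by (simp add: sum_distrib_left sum_distrib_right)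
  finally show ?case by (simp add: mult.commute flip: Suc.hyps(2))
qed

text \<open>Both sides satisfy the recursion over the first letter. It ends when the nonzero parts
  are used up, and the letters left over contribute \<open>hl_sum_Nil\<close>.\<close>

lemma hl_sum_eq_jing_prod_at:
  assumes "is_ring_hom \<phi>" "finite S" "inj_on x S" "0 \<notin> set \<kappa>" "length \<kappa> \<le> card S"
  shows "(1 - \<phi> t) ^ card S * hl_sum x (\<phi> t) \<kappa> S =
    (\<Prod>j=1..card S - length \<kappa>. 1 - \<phi> t ^ j) * jing_prod_at \<phi> x \<kappa> S"
  using assms(2-5)
proof (induction \<kappa> arbitrary: S)
  case Nil
  then show ?case
    by (simp add: hl_sum_Nil jing_prod_at_def hom_one[OF is_ring_hom_eval_with[OF assms(1)]])
next
  case (Cons r \<kappa>)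
  then have "S \<noteq> {}" "r \<ge> 1" by auto
  have card: "card S = Suc (card (S - {a}))" if "a \<in> S" for a
    using that Cons.prems(1) by (simp add: card_Suc_Diff1 del: card_Diff_insert)
  have "(1 - \<phi> t) ^ card S * hl_sum x (\<phi> t) (r # \<kappa>) S = (\<Sum>a\<in>S. (1 - \<phi> t) * gfac x (\<phi> t) S a *
      x a ^ r * ((1 - \<phi> t) ^ card (S - {a}) * hl_sum x (\<phi> t) \<kappa> (S - {a})))"
    unfolding hl_sum_rec[OF Cons.prems(1) \<open>S \<noteq> {}\<close>] sum_distrib_left
    by (intro sum.cong refl, subst card, assumption) (simp add: part_def)
  also have "\<dots> = (\<Sum>a\<in>S. (1 - \<phi> t) * gfac x (\<phi> t) S a * x a ^ r *
      ((\<Prod>j=1..card S - length (r # \<kappa>). 1 - \<phi> t ^ j) * jing_prod_at \<phi> x \<kappa> (S - {a})))"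
  proof (intro sum.cong refl)
    fix a assume a: "a \<in> S"
    have "(1 - \<phi> t) ^ card (S - {a}) * hl_sum x (\<phi> t) \<kappa> (S - {a}) =
      (\<Prod>j=1..card (S - {a}) - length \<kappa>. 1 - \<phi> t ^ j) * jing_prod_at \<phi> x \<kappa> (S - {a})"
      using Cons.prems card[OF a] by (intro Cons.IH) (auto simp: inj_on_diff)
    moreover have "card (S - {a}) - length \<kappa> = card S - length (r # \<kappa>)"
      using card[OF a] by simp
    ultimately show "(1 - \<phi> t) * gfac x (\<phi> t) S a * x a ^ r *
        ((1 - \<phi> t) ^ card (S - {a}) * hl_sum x (\<phi> t) \<kappa> (S - {a})) =
        (1 - \<phi> t) * gfac x (\<phi> t) S a * x a ^ r *
        ((\<Prod>j=1..card S - length (r # \<kappa>). 1 - \<phi> t ^ j) * jing_prod_at \<phi> x \<kappa> (S - {a}))"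
      by simp
  qed
  also have "\<dots> = (\<Prod>j=1..card S - length (r # \<kappa>). 1 - \<phi> t ^ j) * jing_prod_at \<phi> x (r # \<kappa>) S"
    unfolding jing_prod_at_Cons[OF assms(1) Cons.prems(1,2) \<open>r \<ge> 1\<close>] sum_distrib_left
    by (intro sum.cong refl) (simp only: mult_ac)
  finally show ?case .
qed

section \<open>Comparison with the definitions of P, Q and Q'\<close>

lemma sum_permutes_eq_permutations_of_set:
  fixes F :: "nat list \<Rightarrow> 'a::comm_monoid_add"
  shows "(\<Sum>w | w permutes {..<n}. F (map w [0..<n])) = (\<Sum>xs\<in>permutations_of_set {..<n}. F xs)"
proof (rule sum.reindex_bij_betw)
  show "bij_betw (\<lambda>w. map w [0..<n]) {w. w permutes {..<n}} (permutations_of_set {..<n})"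
    unfolding bij_betw_def
  proof
    show "inj_on (\<lambda>w. map w [0..<n]) {w. w permutes {..<n}}"
    proof (rule inj_onI, rule ext)
      fix v w :: "nat \<Rightarrow> nat" and i
      assume "v \<in> {w. w permutes {..<n}}" "w \<in> {w. w permutes {..<n}}"
        "map v [0..<n] = map w [0..<n]"
      then show "v i = w i"
        by (cases "i < n") (auto simp: permutes_not_in map_eq_conv)
    qed
    show "(\<lambda>w. map w [0..<n]) ` {w. w permutes {..<n}} = permutations_of_set {..<n}"
    proof (intro set_eqI iffI)
      fix xs assume "xs \<in> (\<lambda>w. map w [0..<n]) ` {w. w permutes {..<n}}"
      then show "xs \<in> permutations_of_set {..<n}"
        by (auto simp: distinct_map permutes_inj_on atLeast0LessThan permutes_image
            intro!: permutations_of_setI)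
    next
      fix xs assume "xs \<in> permutations_of_set {..<n}"
      then have xs: "set xs = {..<n}" "distinct xs" "length xs = n"
        using length_finite_permutations_of_set[of xs "{..<n}"]
        by (auto dest: permutations_of_setD)
      define w where "w i = (if i < n then xs ! i else i)" for i
      have "bij_betw ((!) xs) {..<n} {..<n}"
        by (rule bij_betw_nth) (simp_all only: xs)
      then have "bij_betw w {..<n} {..<n}"
        by (rule bij_betw_cong[THEN iffD1, rotated]) (simp add: w_def)
      then have "w permutes {..<n}"
        by (rule bij_imp_permutes) (simp add: w_def)
      moreover have "map w [0..<n] = xs"
        by (rule nth_equalityI) (simp_all add: xs w_def)
      ultimately show "xs \<in> (\<lambda>w. map w [0..<n]) ` {w. w permutes {..<n}}"
        by (metis (mono_tags, lifting) image_eqI mem_Collect_eq)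
    qed
  qed
qed

lemma HL_poly_eq_hl_sum:
  "HL_poly n \<kappa> = to_frac (scal (inverse (v_poly n \<kappa>))) *
    hl_sum (\<lambda>i. to_frac (indet i)) (to_frac (scal t)) \<kappa> {..<n}"
proof -
  define \<iota> :: "sym \<Rightarrow> sym fract" where "\<iota> a = to_frac a" for a
  have \<iota>: "is_ring_hom \<iota>"
    unfolding \<iota>_def by (rule is_ring_hom_to_frac)
  have "(\<Prod>i<n. \<iota> (indet (w i)) ^ part \<kappa> i) * (\<Prod>j<n. \<Prod>i<j.
      \<iota> (indet (w i) - scal t * indet (w j)) / \<iota> (indet (w i) - indet (w j)))
      = hl_term (\<lambda>i. \<iota> (indet i)) (\<iota> (scal t)) \<kappa> (map w [0..<n])" for w
    unfolding hl_term_def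
    by (intro arg_cong2[of _ _ _ _ "(*)"] prod.cong) (simp_all add: hom_simps[OF \<iota>])
  then show ?thesis
    unfolding HL_poly_def hl_sum_def sum_permutes_eq_permutations_of_set[symmetric] \<iota>_def[symmetric]
    by simp
qed

text \<open>\<open>v_poly\<close> counts the zero parts and \<open>b_poly\<close> does not. The
  discrepancy is exactly the product in \<open>hl_sum_eq_jing_prod_at\<close>, which is why Q, and
  not P, is the product of operators.\<close>

lemma v_poly_b_poly:
  assumes "length \<kappa> \<le> n"
  shows "v_poly n \<kappa> * (1 - t) ^ n = (\<Prod>j=1..n - length \<kappa>. 1 - t ^ j) * b_poly \<kappa>"
proof -
  have unit: "fps_nth (1 - t) 0 \<noteq> (0 :: rat)" by simp
  have vf: "v_fact m * (1 - t) ^ m = (\<Prod>j=1..m. 1 - t ^ j)" for m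
  proof -
    have "v_fact m * (1 - t) ^ m = (\<Prod>j=1..m. (1 - t ^ j) / (1 - t) * (1 - t))"
      by (simp add: v_fact_def prod.distrib)
    also have "\<dots> = (\<Prod>j=1..m. 1 - t ^ j)"
      using unit by (intro prod.cong refl) (simp add: fps_divide_unit mult.assoc inverse_mult_eq_1)
    finally show ?thesis .
  qed
  have "n = (n - length \<kappa>) + (\<Sum>i\<in>set \<kappa>. count_list \<kappa> i)"
    using assms by (simp add: sum_count_set)
  then have "(1 - t :: rat fps) ^ n = (1 - t) ^ (n - length \<kappa>) * (\<Prod>i\<in>set \<kappa>. (1 - t) ^ count_list \<kappa> i)"
    by (metis power_add power_sum)
  then have "v_poly n \<kappa> * (1 - t) ^ n = (v_fact (n - length \<kappa>) * (1 - t) ^ (n - length \<kappa>)) *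
      (\<Prod>i\<in>set \<kappa>. v_fact (count_list \<kappa> i) * (1 - t) ^ count_list \<kappa> i)"
    by (simp add: v_poly_def prod.distrib mult_ac)
  then show ?thesis
    by (simp add: vf b_poly_def)
qed

lemma prod_nth_0: "fps_nth (prod f A) 0 = (\<Prod>x\<in>A. fps_nth (f x) 0)"
  by (induction A rule: infinite_finite_induct) simp_all

lemma b_poly_nth_0: "fps_nth (b_poly \<kappa>) 0 = 1"
  by (simp add: b_poly_def prod_nth_0)

lemma HL_poly_eq_jing_prod:
  assumes "length \<kappa> \<le> n" "0 \<notin> set \<kappa>"
  shows "to_frac (scal (b_poly \<kappa>)) * HL_poly n \<kappa> =
    to_frac (eval_at (jing_prod \<kappa>) (\<lambda>k. scal (1 - t ^ k) * (\<Sum>i<n. indet i ^ k)))"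
proof -
  define \<phi> :: "rat fps \<Rightarrow> sym fract" where "\<phi> c = to_frac (scal c)" for c
  let ?x = "\<lambda>i. to_frac (indet i :: sym)"
  have \<phi>: "is_ring_hom \<phi>"
    unfolding \<phi>_def by (rule is_ring_hom_comp[OF is_ring_hom_to_frac is_ring_hom_scal])
  have inj: "inj_on ?x {..<n}"
  proof (rule inj_onI)
    fix i j assume "?x i = ?x j"
    then have "indet i = (indet j :: sym)" by (simp add: eq_fract)
    then have "Poly_Mapping.lookup (indet i :: sym) (Poly_Mapping.single j 1) = 1"
      by (simp add: indet_def)
    then show "i = j"
      by (auto simp: indet_def lookup_single when_def split: if_splits
          dest: arg_cong[of _ _ Poly_Mapping.keys])
  qed
  let ?R = "\<Prod>j=1..n - length \<kappa>. 1 - t ^ j"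
  have main: "\<phi> ((1 - t) ^ n) * hl_sum ?x (\<phi> t) \<kappa> {..<n} = \<phi> ?R * jing_prod_at \<phi> ?x \<kappa> {..<n}"
    using hl_sum_eq_jing_prod_at[OF \<phi> _ inj assms(2)] assms(1) by (simp add: hom_simps[OF \<phi>])
  \<comment> \<open>The \<open>inverse\<close> of a power series is a true inverse only if its
    constant term is nonzero.\<close>
  have v: "fps_nth (v_poly n \<kappa>) 0 \<noteq> 0"
  proof -
    have "fps_nth (v_poly n \<kappa> * (1 - t) ^ n) 0 = 1"
      unfolding v_poly_b_poly[OF assms(1)] by (simp add: prod_nth_0 b_poly_nth_0)
    then show ?thesis by auto
  qed
  have unit: "\<phi> ((1 - t) ^ n) \<noteq> 0"
  proof -
    have "(1 - t) ^ n * inverse ((1 - t) ^ n) = (1 :: rat fps)"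
      by (rule inverse_mult_eq_1') simp
    then have "\<phi> ((1 - t) ^ n) * \<phi> (inverse ((1 - t) ^ n)) = 1"
      by (simp only: hom_mult[OF \<phi>, symmetric] hom_one[OF \<phi>])
    then show ?thesis by auto
  qed
  have "\<phi> ((1 - t) ^ n) * (\<phi> (b_poly \<kappa>) * (\<phi> (inverse (v_poly n \<kappa>)) * hl_sum ?x (\<phi> t) \<kappa> {..<n}))
    = \<phi> (b_poly \<kappa> * inverse (v_poly n \<kappa>)) * (\<phi> ((1 - t) ^ n) * hl_sum ?x (\<phi> t) \<kappa> {..<n})"
    by (simp only: hom_mult[OF \<phi>] mult_ac)
  also have "\<dots> = \<phi> (inverse (v_poly n \<kappa>) * (?R * b_poly \<kappa>)) * jing_prod_at \<phi> ?x \<kappa> {..<n}"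
    unfolding main by (simp only: hom_mult[OF \<phi>] mult_ac)
  also have "inverse (v_poly n \<kappa>) * (?R * b_poly \<kappa>) = (1 - t) ^ n"
    unfolding v_poly_b_poly[OF assms(1), symmetric] mult.assoc[symmetric]
    using v by (simp add: inverse_mult_eq_1)
  finally have "\<phi> (b_poly \<kappa>) * (\<phi> (inverse (v_poly n \<kappa>)) * hl_sum ?x (\<phi> t) \<kappa> {..<n}) = jing_prod_at \<phi> ?x \<kappa> {..<n}"
    using unit by simp
  also have "jing_prod_at \<phi> ?x \<kappa> {..<n} =
      to_frac (eval_at (jing_prod \<kappa>) (\<lambda>k. scal (1 - t ^ k) * (\<Sum>i<n. indet i ^ k)))"
    unfolding eval_at_def hom_eval_with[OF is_ring_hom_to_frac] jing_prod_at_def \<phi>_def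
    by (simp only: hom_simps[OF is_ring_hom_to_frac] hom_simps[OF is_ring_hom_scal])
  finally show ?thesis
    by (simp add: HL_poly_eq_hl_sum \<phi>_def)
qed

text \<open>Gives the uniqueness in the description \<open>HL_P\<close>: for large \<open>n\<close>
  the variables can be specialized to the letters of any given rational alphabet.\<close>

lemma eval_at_variables_inject:
  assumes "\<And>n. n \<ge> l \<Longrightarrow> eval_at f (\<lambda>k. \<Sum>i<n. indet i ^ k) =
    (eval_at g (\<lambda>k. \<Sum>i<n. indet i ^ k) :: sym)"
  shows "f = g"
proof (rule sym_eqI)
  fix rs :: "rat list"
  \<comment> \<open>The surplus variables become 0. They contribute nothing to the power sums, all
    of which have exponent at least 1.\<close>
  define y where "y i = fps_const (if i < length rs then rs ! i else 0)" for i
  define n where "n = max l (length rs)"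
  have "peval (\<lambda>c. c) y (eval_at f (\<lambda>k. \<Sum>i<n. indet i ^ k)) =
      eval_with (\<lambda>c. c) f (\<lambda>k. fps_const (psum_list k rs))" for f
  proof -
    have "peval (\<lambda>c. c) y (eval_at f (\<lambda>k. \<Sum>i<n. indet i ^ k))
        = eval_with (\<lambda>c. c) f (\<lambda>k. \<Sum>i<n. y i ^ k)"
      unfolding eval_at_def hom_eval_with[OF is_ring_hom_peval[OF is_ring_hom_id]]
      by (simp add: peval_scal is_ring_hom_id hom_simps[OF is_ring_hom_peval[OF is_ring_hom_id]]
          peval_indet)
    also have "\<dots> = eval_with (\<lambda>c. c) f (\<lambda>k. fps_const (psum_list k rs))"
    proof (rule eval_with_cong)
      fix k :: nat assume "k \<ge> 1"
      then have "(\<Sum>i<n. y i ^ k) = (\<Sum>i<length rs. y i ^ k)"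
        by (intro sum.mono_neutral_right) (auto simp: n_def y_def)
      also have "\<dots> = fps_const (psum_list k rs)"
        by (simp add: y_def psum_list_def hom_sum[OF is_ring_hom_fps_const] sum_list_sum_nth
            atLeast0LessThan fps_const_power)
      finally show "(\<Sum>i<n. y i ^ k) = fps_const (psum_list k rs)" .
    qed
    finally show ?thesis .
  qed
  then show "eval_with (\<lambda>c. c) f (\<lambda>k. fps_const (psum_list k rs)) =
      eval_with (\<lambda>c. c) g (\<lambda>k. fps_const (psum_list k rs))"
    using assms[of n] by (metis max.cobounded1 n_def)
qed

lemma HL_Q_eq_jing_prod:
  assumes "0 \<notin> set \<kappa>"
  shows "HL_Q \<kappa> = eval_at (jing_prod \<kappa>) (\<lambda>k. scal (1 - t ^ k) * psum k)"
proof -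
  define Q where "Q = eval_at (jing_prod \<kappa>) (\<lambda>k. scal (1 - t ^ k) * psum k)"
  have b: "inverse (b_poly \<kappa>) * b_poly \<kappa> = 1" "b_poly \<kappa> * inverse (b_poly \<kappa>) = 1"
    by (simp_all add: inverse_mult_eq_1 inverse_mult_eq_1' b_poly_nth_0)
  have P: "to_frac (eval_at (scal (inverse (b_poly \<kappa>)) * Q) (\<lambda>k. \<Sum>i<n. indet i ^ k)) = HL_poly n \<kappa>"
    if n: "length \<kappa> \<le> n" for n
  proof -
    have "to_frac (eval_at (scal (inverse (b_poly \<kappa>)) * Q) (\<lambda>k. \<Sum>i<n. indet i ^ k))
      = to_frac (scal (inverse (b_poly \<kappa>))) *
        to_frac (eval_at (jing_prod \<kappa>) (\<lambda>k. scal (1 - t ^ k) * (\<Sum>i<n. indet i ^ k)))"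
      unfolding Q_def
      by (simp only: eval_at_simps eval_at_eval_at hom_mult[OF is_ring_hom_to_frac])
        (simp add: eval_at_simps cong: eval_at_cong)
    also have "\<dots> = to_frac (scal (inverse (b_poly \<kappa>) * b_poly \<kappa>)) * HL_poly n \<kappa>"
      unfolding HL_poly_eq_jing_prod[OF n assms, symmetric]
      by (simp only: hom_mult[OF is_ring_hom_to_frac] hom_mult[OF is_ring_hom_scal] mult.assoc)
    finally show ?thesis
      unfolding b by (simp add: hom_one[OF is_ring_hom_scal] hom_one[OF is_ring_hom_to_frac])
  qed
  have "HL_P \<kappa> = scal (inverse (b_poly \<kappa>)) * Q"
    unfolding HL_P_def
  proof (rule the_equality)
    fix f assume f: "\<forall>n\<ge>length \<kappa>. to_frac (eval_at f (\<lambda>k. \<Sum>i<n. indet i ^ k)) = HL_poly n \<kappa>"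
    show "f = scal (inverse (b_poly \<kappa>)) * Q"
    proof (rule eval_at_variables_inject[where l = "length \<kappa>"])
      fix n assume "length \<kappa> \<le> n"
      then have "to_frac (eval_at f (\<lambda>k. \<Sum>i<n. indet i ^ k)) =
          to_frac (eval_at (scal (inverse (b_poly \<kappa>)) * Q) (\<lambda>k. \<Sum>i<n. indet i ^ k))"
        using f P by simp
      then show "eval_at f (\<lambda>k. \<Sum>i<n. indet i ^ k) =
          (eval_at (scal (inverse (b_poly \<kappa>)) * Q) (\<lambda>k. \<Sum>i<n. indet i ^ k) :: sym)"
        by (simp add: eq_fract)
    qed
  qed (use P in blast)
  then have "HL_Q \<kappa> = scal (b_poly \<kappa> * inverse (b_poly \<kappa>)) * Q"
    by (simp only: HL_Q_def hom_mult[OF is_ring_hom_scal] mult.assoc)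
  then show ?thesis
    by (simp only: b hom_one[OF is_ring_hom_scal] mult_1 Q_def)
qed

lemma HL_Q'_eq_jing_prod:
  assumes "0 \<notin> set \<kappa>"
  shows "HL_Q' \<kappa> = jing_prod \<kappa>"
proof -
  have "HL_Q' \<kappa> = eval_at (jing_prod \<kappa>) (\<lambda>k. eval_at (scal (1 - t ^ k) * psum k)
      (\<lambda>i. scal (inverse (1 - t ^ i)) * psum i))"
    unfolding HL_Q'_def HL_Q_eq_jing_prod[OF assms] by (rule eval_at_eval_at)
  also have "\<dots> = eval_at (jing_prod \<kappa>) psum"
  proof (rule eval_at_cong)
    fix k :: nat assume "k \<ge> 1"
    then have "(1 - t ^ k) * inverse (1 - t ^ k) = (1 :: rat fps)"
      by (intro inverse_mult_eq_1') (simp add: fps_X_power_nth)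
    then have "scal (1 - t ^ k) * (scal (inverse (1 - t ^ k)) * psum k) = psum k"
      by (simp only: mult.assoc[symmetric] hom_mult[OF is_ring_hom_scal, symmetric]
          hom_one[OF is_ring_hom_scal] mult_1)
    then show "eval_at (scal (1 - t ^ k) * psum k) (\<lambda>i. scal (inverse (1 - t ^ i)) * psum i) = psum k"
      by (simp only: hom_mult[OF is_ring_hom_eval_at] eval_at_scal eval_at_psum[OF \<open>k \<ge> 1\<close>])
  qed
  finally show ?thesis by (simp add: eval_at_psum_id)
qed

section \<open>Subtracting a variable and inverting the expansion\<close>

definition qfact :: "nat \<Rightarrow> rat fps" where
  "qfact n = (\<Prod>j=1..n. 1 - t ^ j)"

definition qbin :: "nat \<Rightarrow> nat \<Rightarrow> rat fps" where
  "qbin n k = (if k \<le> n then qfact n * inverse (qfact k * qfact (n - k)) else 0)"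

lemma qfact_0 [simp]: "qfact 0 = 1"
  by (simp add: qfact_def)

lemma qfact_Suc: "qfact (Suc n) = qfact n * (1 - t ^ Suc n)"
  by (simp add: qfact_def del: power_Suc)

lemma qfact_nth_0: "fps_nth (qfact n) 0 = 1"
  by (simp add: qfact_def prod_nth_0 fps_X_power_nth)

lemma qfact_nonzero [simp]: "qfact n \<noteq> 0"
  using qfact_nth_0[of n] by auto

lemma qbin_mult_qfact: "k \<le> n \<Longrightarrow> qbin n k * (qfact k * qfact (n - k)) = qfact n"
  unfolding qbin_def by (simp only: if_True mult.assoc)
    (simp add: inverse_mult_eq_1 qfact_nth_0)

lemma qbin_eqI: "k \<le> n \<Longrightarrow> q * (qfact k * qfact (n - k)) = qfact n \<Longrightarrow> qbin n k = q"
  using qbin_mult_qfact[of k n]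
  by (metis mult_right_cancel no_zero_divisors qfact_nonzero)

lemma qbin_0 [simp]: "qbin n 0 = 1"
  by (rule qbin_eqI) simp_all

lemma qbin_self [simp]: "qbin n n = 1"
  by (rule qbin_eqI) simp_all

lemma qbin_eq_0 [simp]: "k > n \<Longrightarrow> qbin n k = 0"
  by (simp add: qbin_def)

lemma qbin_symmetric: "k \<le> n \<Longrightarrow> qbin n (n - k) = qbin n k"
  using qbin_mult_qfact[of k n] by (intro qbin_eqI) (simp_all add: mult_ac)

lemma qbin_Suc_Suc: "qbin (Suc n) (Suc k) = qbin n k + t ^ Suc k * qbin n (Suc k)"
proof -
  consider "k > n" | "k = n" | "k < n" by linarith
  then show ?thesis
  proof cases
    case 3
    then obtain d where n: "n = k + Suc d" using less_iff_Suc_add by auto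
    have 1: "qbin n k * (qfact k * qfact (Suc d)) = qfact n"
      using qbin_mult_qfact[of k n] n by simp
    have 2: "qbin n (Suc k) * (qfact (Suc k) * qfact d) = qfact n"
      using qbin_mult_qfact[of "Suc k" n] n by simp
    show ?thesis
    proof (rule qbin_eqI)
      have "(qbin n k + t ^ Suc k * qbin n (Suc k)) * (qfact (Suc k) * qfact (Suc n - Suc k))
        = (1 - t ^ Suc k) * (qbin n k * (qfact k * qfact (Suc d)))
          + t ^ Suc k * (1 - t ^ Suc d) * (qbin n (Suc k) * (qfact (Suc k) * qfact d))"
        using n by (simp add: qfact_Suc algebra_simps)
      also have "\<dots> = qfact (Suc n)"
        unfolding 1 2 qfact_Suc[of n] using n by (simp add: algebra_simps power_add)
      finally show "(qbin n k + t ^ Suc k * qbin n (Suc k)) * (qfact (Suc k) * qfact (Suc n - Suc k))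
        = qfact (Suc n)" .
    qed (use 3 in simp)
  qed simp_all
qed

text \<open>The Pascal rule with the power of \<open>t\<close> on the other term. It fits
  \<open>jing_diff_funpow\<close>, where an operator with index \<open>m\<close> has to pass the
  \<open>n - k\<close> operators with index \<open>Suc m\<close> standing before it.\<close>

lemma qbin_Suc_Suc': "k \<le> n \<Longrightarrow> qbin (Suc n) (Suc k) = t ^ (n - k) * qbin n k + qbin n (Suc k)"
proof -
  assume "k \<le> n"
  then consider "k = n" | "k < n" by linarith
  then show ?thesis
  proof cases
    case 2
    then obtain d where n: "n = k + Suc d" using less_iff_Suc_add by auto
    have 1: "qbin n k * (qfact k * qfact (Suc d)) = qfact n"
      using qbin_mult_qfact[of k n] n by simp
    have 2: "qbin n (Suc k) * (qfact (Suc k) * qfact d) = qfact n"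
      using qbin_mult_qfact[of "Suc k" n] n by simp
    show ?thesis
    proof (rule qbin_eqI)
      have "(t ^ (n - k) * qbin n k + qbin n (Suc k)) * (qfact (Suc k) * qfact (Suc n - Suc k))
        = t ^ Suc d * (1 - t ^ Suc k) * (qbin n k * (qfact k * qfact (Suc d)))
          + (1 - t ^ Suc d) * (qbin n (Suc k) * (qfact (Suc k) * qfact d))"
        using n by (simp add: qfact_Suc algebra_simps)
      also have "\<dots> = qfact (Suc n)"
        unfolding 1 2 qfact_Suc[of n] using n by (simp add: algebra_simps power_add)
      finally show "(t ^ (n - k) * qbin n k + qbin n (Suc k)) * (qfact (Suc k) * qfact (Suc n - Suc k))
        = qfact (Suc n)" .
    qed (use \<open>k \<le> n\<close> in simp)
  qed simp_all
qed

text \<open>Both sides are the q-multinomial coefficient of \<open>c\<close>, \<open>b - c\<close>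
  and \<open>a - b\<close>.\<close>

lemma qbin_trinomial:
  assumes "c \<le> b" "b \<le> a"
  shows "qbin a b * qbin b (b - c) = qbin a c * qbin (a - c) (b - c)"
proof -
  let ?z = "qfact c * qfact (b - c) * qfact (a - b) * (qfact b * qfact (a - c))"
  have 1: "qbin a b * (qfact b * qfact (a - b)) = qfact a"
    and 2: "qbin b c * (qfact c * qfact (b - c)) = qfact b"
    and 3: "qbin a c * (qfact c * qfact (a - c)) = qfact a"
    and 4: "qbin (a - c) (b - c) * (qfact (b - c) * qfact (a - b)) = qfact (a - c)"
    using qbin_mult_qfact[of b a] qbin_mult_qfact[of c b] qbin_mult_qfact[of c a]
      qbin_mult_qfact[of "b - c" "a - c"] assms by (simp_all add: Suc_diff_le)
  have "(qbin a b * qbin b c) * ?z = (qbin a b * (qfact b * qfact (a - b))) *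
      (qbin b c * (qfact c * qfact (b - c))) * qfact (a - c)"
    by (simp only: mult_ac)
  also have "\<dots> = (qbin a c * (qfact c * qfact (a - c))) *
      (qbin (a - c) (b - c) * (qfact (b - c) * qfact (a - b))) * qfact b"
    unfolding 1 2 3 4 by (simp only: mult_ac)
  also have "\<dots> = (qbin a c * qbin (a - c) (b - c)) * ?z"
    by (simp only: mult_ac)
  finally show ?thesis
    using assms by (simp add: qbin_symmetric)
qed

text \<open>By the q-binomial theorem the sum is the product of the \<open>1 - t ^ i\<close> for
  \<open>i < n\<close>, whose first factor vanishes. The direct proof telescopes: the Pascal rule
  turns the term of \<open>Suc k\<close> into \<open>?f (Suc k) - ?f k\<close>.\<close>

lemma qbin_alternating_sum:
  assumes "n \<ge> 1"
  shows "(\<Sum>k\<le>n. (- 1) ^ k * t ^ (k choose 2) * qbin n k) = 0"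
proof -
  obtain m where m: "n = Suc m" using assms by (cases n) auto
  let ?f = "\<lambda>k. (- 1) ^ k * t ^ ((k choose 2) + k) * qbin m k"
  have "(\<Sum>k\<le>n. (- 1) ^ k * t ^ (k choose 2) * qbin n k) =
      1 + (\<Sum>k\<le>m. (- 1) ^ Suc k * t ^ (Suc k choose 2) * qbin (Suc m) (Suc k))"
    unfolding m sum.atMost_Suc_shift by (simp add: numeral_2_eq_2)
  also have "\<dots> = 1 + (\<Sum>k\<le>m. ?f (Suc k) - ?f k)"
  proof -
    have "Suc k choose 2 = k + (k choose 2)" for k by (simp add: numeral_2_eq_2)
    then show ?thesis
      by (intro arg_cong2[of _ _ _ _ "(+)"] sum.cong refl)
        (simp add: qbin_Suc_Suc power_add algebra_simps)
  qed
  also have "(\<Sum>k\<le>m. ?f (Suc k) - ?f k) = ?f (Suc m) - ?f 0"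
  proof -
    have "(\<Sum>k\<le>m. g (Suc k) - g k) = g (Suc m) - g 0" for g :: "nat \<Rightarrow> rat fps" and m
      by (induction m) simp_all
    then show ?thesis .
  qed
  finally show ?thesis by (simp add: numeral_2_eq_2)
qed

section \<open>Expansion of the translated product over vertical strips\<close>

lemma jing_funpow_commute:
  "jing m ((jing (Suc m) ^^ k) f) = scal (t ^ k) * (jing (Suc m) ^^ k) (jing m f)"
proof (induction k)
  case 0
  then show ?case by (simp add: hom_one[OF is_ring_hom_scal])
next
  case (Suc k)
  then show ?case
    by (simp add: jing_commute jing_scal_mult hom_mult[OF is_ring_hom_scal] mult.assoc)
qed

lemma jing_funpow_sum: "(jing m ^^ k) (sum f A) = (\<Sum>x\<in>A. (jing m ^^ k) (f x))"
  by (induction k) (simp_all add: jing_sum)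

lemma jing_funpow_scal_mult: "(jing m ^^ k) (scal c * f) = scal c * (jing m ^^ k) f"
  by (induction k) (simp_all add: jing_scal_mult)

text \<open>The \<open>q\<close>-binomial theorem, as \<open>jing m\<close> and \<open>jing (Suc m)\<close> commute up to the factor \<open>t\<close>.\<close>

lemma jing_diff_funpow:
  "((\<lambda>f. jing (Suc m) f - scal s * jing m f) ^^ n) f =
    (\<Sum>j\<le>n. scal ((- s) ^ j * qbin n j) * (jing (Suc m) ^^ (n - j)) ((jing m ^^ j) f))"
proof (induction n)
  case 0
  then show ?case by (simp add: hom_one[OF is_ring_hom_scal])
next
  case (Suc n)
  let ?A = "\<lambda>f. jing (Suc m) f - scal s * jing m f"
  let ?b = "\<lambda>n j. (jing (Suc m) ^^ (n - j)) ((jing m ^^ j) f)"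
  \<comment> \<open>The two contributions of one more factor to the term of \<open>j\<close>. In
    \<open>v\<close> the operator \<open>jing m\<close> has passed \<open>n - j\<close> operators
    \<open>jing (Suc m)\<close>, each at the cost of a factor \<open>t\<close>.\<close>
  define u where "u j = scal ((- s) ^ j * qbin n j) * ?b (Suc n) j" for j
  define v where "v j = scal ((- s) ^ Suc j * t ^ (n - j) * qbin n j) * ?b (Suc n) (Suc j)" for j
  have step: "?A (scal ((- s) ^ j * qbin n j) * ?b n j) = u j + v j" if "j \<le> n" for j
  proof -
    have "jing (Suc m) (?b n j) = ?b (Suc n) j"
      using that by (simp add: Suc_diff_le)
    moreover have "jing m (?b n j) = scal (t ^ (n - j)) * ?b (Suc n) (Suc j)"
      using that by (simp add: jing_funpow_commute)
    ultimately show ?thesis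
      unfolding u_def v_def jing_scal_mult
      by (simp add: hom_simps[OF is_ring_hom_scal] mult_ac)
  qed
  have "(?A ^^ Suc n) f = (\<Sum>j\<le>n. ?A (scal ((- s) ^ j * qbin n j) * ?b n j))"
    unfolding funpow.simps comp_apply Suc.IH
    by (simp add: jing_sum sum_subtractf sum_distrib_left)
  also have "\<dots> = (\<Sum>j\<le>n. u j) + (\<Sum>j\<le>n. v j)"
    by (simp add: step sum.distrib)
  also have "(\<Sum>j\<le>n. u j) = (\<Sum>j\<le>Suc n. u j)"
    by (simp add: u_def hom_zero[OF is_ring_hom_scal])
  also have "\<dots> = ?b (Suc n) 0 + (\<Sum>j\<le>n. u (Suc j))"
    unfolding sum.atMost_Suc_shift by (simp add: u_def hom_one[OF is_ring_hom_scal])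
  also have "?b (Suc n) 0 + (\<Sum>j\<le>n. u (Suc j)) + (\<Sum>j\<le>n. v j) =
      ?b (Suc n) 0 + (\<Sum>j\<le>n. u (Suc j) + v j)"
    by (simp add: sum.distrib)
  also have "(\<Sum>j\<le>n. u (Suc j) + v j) =
      (\<Sum>j\<le>n. scal ((- s) ^ Suc j * qbin (Suc n) (Suc j)) * ?b (Suc n) (Suc j))"
  proof (intro sum.cong refl)
    fix j assume "j \<in> {..n}"
    then have "(- s) ^ Suc j * qbin (Suc n) (Suc j) =
        (- s) ^ Suc j * qbin n (Suc j) + (- s) ^ Suc j * t ^ (n - j) * qbin n j"
      by (subst qbin_Suc_Suc') (simp_all only: algebra_simps atMost_iff)
    then show "u (Suc j) + v j = scal ((- s) ^ Suc j * qbin (Suc n) (Suc j)) * ?b (Suc n) (Suc j)"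
      unfolding u_def v_def by (simp only: hom_add[OF is_ring_hom_scal] distrib_right)
  qed
  also have "?b (Suc n) 0 + \<dots> = (\<Sum>j\<le>Suc n. scal ((- s) ^ j * qbin (Suc n) j) * ?b (Suc n) j)"
    unfolding sum.atMost_Suc_shift by (simp add: hom_one[OF is_ring_hom_scal])
  finally show ?case .
qed

lemma jing_prod_replicate_append: "jing_prod (replicate n r @ \<kappa>) = (jing r ^^ n) (jing_prod \<kappa>)"
  by (induction n) (simp_all add: jing_prod_Cons)

lemma sub_var_jing_prod_replicate_append:
  "sub_var s (jing_prod (replicate n (Suc m) @ \<kappa>)) =
    (\<Sum>j\<le>n. scal ((- s) ^ j * qbin n j) * (jing (Suc m) ^^ (n - j)) ((jing m ^^ j) (sub_var s (jing_prod \<kappa>))))"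
proof -
  have "sub_var s ((jing (Suc m) ^^ n) f) = ((\<lambda>f. jing (Suc m) f - scal s * jing m f) ^^ n) (sub_var s f)" for f
    by (induction n) (simp_all add: sub_var_B)
  then show ?thesis by (simp add: jing_prod_replicate_append jing_diff_funpow)
qed

text \<open>Partitions with parts at most \<open>m\<close> are described by the lengths \<open>c 1 \<ge> \<dots> \<ge> c m\<close> of their columns;
  \<open>rows m c\<close> is the list of rows when \<open>c (Suc m) = 0\<close>.\<close>

fun rows :: "nat \<Rightarrow> (nat \<Rightarrow> nat) \<Rightarrow> nat list" where
  "rows 0 c = []"
| "rows (Suc m) c = replicate (c (Suc m) - c (Suc (Suc m))) (Suc m) @ rows m c"

lemma rows_cong: "(\<And>i. 1 \<le> i \<Longrightarrow> i \<le> Suc m \<Longrightarrow> c i = d i) \<Longrightarrow> rows m c = rows m d"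
  by (induction m) auto

text \<open>The value 0 outside \<open>1..m\<close> makes each tuple a single function, and it
  supplies the length 0 of the column after the last one.\<close>

definition box :: "nat \<Rightarrow> (nat \<Rightarrow> nat set) \<Rightarrow> (nat \<Rightarrow> nat) set" where
  "box m A = {f. (\<forall>i\<in>{1..m}. f i \<in> A i) \<and> (\<forall>i. i \<notin> {1..m} \<longrightarrow> f i = 0)}"

lemma box_0: "box 0 A = {\<lambda>i. 0}"
  by (auto simp: box_def)

lemma sum_box_Suc:
  "(\<Sum>f\<in>box (Suc m) A. F f) = (\<Sum>f\<in>box m A. \<Sum>u\<in>A (Suc m). F (f(Suc m := u)))"
proof -
  have "(\<Sum>f\<in>box (Suc m) A. F f) = (\<Sum>(f, u)\<in>box m A \<times> A (Suc m). F (f(Suc m := u)))"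
    by (rule sum.reindex_bij_witness[where i = "\<lambda>(f, u). f(Suc m := u)"
          and j = "\<lambda>f. (f(Suc m := 0), f (Suc m))"])
      (auto simp: box_def fun_eq_iff)
  then show ?thesis by (simp add: sum.cartesian_product)
qed

lemma finite_box: "(\<And>i. finite (A i)) \<Longrightarrow> finite (box m A)"
proof (induction m)
  case 0
  then show ?case by (simp add: box_0)
next
  case (Suc m)
  have "box (Suc m) A \<subseteq> (\<lambda>(f, u). f(Suc m := u)) ` (box m A \<times> A (Suc m))"
  proof
    fix f assume "f \<in> box (Suc m) A"
    then have "f = (\<lambda>(f, u). f(Suc m := u)) (f(Suc m := 0), f (Suc m))"
      "(f(Suc m := 0), f (Suc m)) \<in> box m A \<times> A (Suc m)"
      by (auto simp: box_def)
    then show "f \<in> (\<lambda>(f, u). f(Suc m := u)) ` (box m A \<times> A (Suc m))" by (rule image_eqI)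
  qed
  moreover have "finite (box m A \<times> A (Suc m))" using Suc by blast
  ultimately show ?case by (meson finite_imageI finite_subset)
qed

lemma sum_box_prod:
  fixes h :: "nat \<Rightarrow> nat \<Rightarrow> 'a::comm_semiring_1"
  shows "(\<Sum>f\<in>box m A. \<Prod>i=1..m. h i (f i)) = (\<Prod>i=1..m. \<Sum>u\<in>A i. h i u)"
proof (induction m)
  case 0
  then show ?case by (simp add: box_0)
next
  case (Suc m)
  have "(\<Prod>i=1..m. h i ((f(Suc m := u)) i)) = (\<Prod>i=1..m. h i (f i))" for f u
    by (intro prod.cong) auto
  then show ?case
    by (simp add: sum_box_Suc sum_distrib_left[symmetric] sum_distrib_right[symmetric]
        Suc[unfolded One_nat_def])
qed

text \<open>There are \<open>c i - c (Suc i)\<close> rows of length \<open>i\<close>, and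
  \<open>c i - d i\<close> of them lose their last box. The factor is the one given by
  \<open>jing_diff_funpow\<close> for this block.\<close>

definition strip_weight :: "rat fps \<Rightarrow> nat \<Rightarrow> (nat \<Rightarrow> nat) \<Rightarrow> (nat \<Rightarrow> nat) \<Rightarrow> rat fps" where
  "strip_weight s m c d = (\<Prod>i=1..m. (- s) ^ (c i - d i) * qbin (c i - c (Suc i)) (c i - d i))"

text \<open>Induction on the longest row length. The updated value at \<open>Suc m\<close> makes
  \<open>rows m\<close> begin below the \<open>c (Suc m)\<close> rows of \<open>c\<close> that are
  longer than \<open>m\<close>.\<close>

lemma sub_var_jing_prod_rows:
  assumes "\<And>i. 1 \<le> i \<Longrightarrow> i \<le> m \<Longrightarrow> c (Suc i) \<le> c i"
  shows "sub_var s (jing_prod (rows m c)) = (\<Sum>d\<in>box m (\<lambda>i. {c (Suc i)..c i}).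
    scal (strip_weight s m c d) * jing_prod (rows m (d(Suc m := c (Suc m)))))"
  using assms
proof (induction m)
  case 0
  then show ?case
    by (simp add: box_0 strip_weight_def hom_one[OF is_ring_hom_scal] hom_one[OF is_ring_hom_sub_var])
next
  case (Suc m)
  let ?a = "c (Suc m)" and ?b = "c (Suc (Suc m))"
  let ?X = "box m (\<lambda>i. {c (Suc i)..c i})"
  have ab: "?b \<le> ?a" using Suc.prems[of "Suc m"] by simp
  have IH: "sub_var s (jing_prod (rows m c)) = (\<Sum>d\<in>?X. scal (strip_weight s m c d) * jing_prod (rows m (d(Suc m := ?a))))"
    by (rule Suc.IH) (simp add: Suc.prems)
  \<comment> \<open>The \<open>j\<close> rows shortened from \<open>Suc m\<close> to
    \<open>m\<close> join the block of rows of length \<open>m\<close>. For \<open>m = 0\<close>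
    they vanish, as \<open>jing 0\<close> fixes 1.\<close>
  have move: "(jing m ^^ j) (jing_prod (rows m (d(Suc m := ?a)))) = jing_prod (rows m (d(Suc m := ?a - j)))"
    if "d \<in> ?X" "j \<le> ?a - ?b" for d j
  proof (cases m)
    case 0
    have "(jing 0 ^^ j) 1 = 1" by (induction j) (simp_all add: jing_0_one)
    then show ?thesis using 0 by simp
  next
    case (Suc n)
    have "?a \<le> d m" using that Suc by (auto simp: box_def)
    then have "d m - (?a - j) = j + (d m - ?a)" using that by simp
    moreover have "rows n (d(Suc m := ?a)) = rows n (d(Suc m := ?a - j))"
      using Suc by (intro rows_cong) auto
    ultimately show ?thesis
      using Suc by (simp add: jing_prod_replicate_append funpow_add)
  qed
  have add: "(jing (Suc m) ^^ (?a - ?b - j)) (jing_prod (rows m (d(Suc m := ?a - j)))) =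
      jing_prod (rows (Suc m) (d(Suc m := ?a - j, Suc (Suc m) := ?b)))" if "j \<le> ?a - ?b" for d j
  proof -
    have "rows m (d(Suc m := ?a - j, Suc (Suc m) := ?b)) = rows m (d(Suc m := ?a - j))"
      by (intro rows_cong) auto
    moreover have "?a - j - ?b = ?a - ?b - j" by simp
    ultimately show ?thesis by (simp add: jing_prod_replicate_append)
  qed
  have weight: "strip_weight s (Suc m) c (d(Suc m := u)) =
      strip_weight s m c d * ((- s) ^ (?a - u) * qbin (?a - ?b) (?a - u))" for d u
  proof -
    have "strip_weight s m c (d(Suc m := u)) = strip_weight s m c d"
      unfolding strip_weight_def by (intro prod.cong) auto
    then show ?thesis by (simp add: strip_weight_def)
  qed
  have "sub_var s (jing_prod (rows (Suc m) c)) = (\<Sum>j\<le>?a - ?b. scal ((- s) ^ j * qbin (?a - ?b) j) *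
      (jing (Suc m) ^^ (?a - ?b - j)) ((jing m ^^ j) (sub_var s (jing_prod (rows m c)))))"
    by (simp add: sub_var_jing_prod_replicate_append)
  also have "\<dots> = (\<Sum>j\<le>?a - ?b. \<Sum>d\<in>?X. scal ((- s) ^ j * qbin (?a - ?b) j) *
      (scal (strip_weight s m c d) *
        jing_prod (rows (Suc m) (d(Suc m := ?a - j, Suc (Suc m) := ?b)))))"
    unfolding IH jing_funpow_sum jing_funpow_scal_mult sum_distrib_left
    by (intro sum.cong refl) (simp only: move add atMost_iff)
  also have "\<dots> = (\<Sum>d\<in>?X. \<Sum>j\<le>?a - ?b. scal (strip_weight s (Suc m) c (d(Suc m := ?a - j))) *
        jing_prod (rows (Suc m) (d(Suc m := ?a - j, Suc (Suc m) := ?b))))"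
    using ab by (subst sum.swap, intro sum.cong refl)
      (simp add: weight hom_mult[OF is_ring_hom_scal] mult_ac del: rows.simps)
  also have "\<dots> = (\<Sum>d\<in>?X. \<Sum>u\<in>{?b..?a}. scal (strip_weight s (Suc m) c (d(Suc m := u))) *
        jing_prod (rows (Suc m) (d(Suc m := u, Suc (Suc m) := ?b))))"
    using ab by (intro sum.cong refl sum.reindex_bij_witness[where i = "\<lambda>u. ?a - u" and j = "\<lambda>j. ?a - j"])
      auto
  finally show ?case
    by (simp only: sum_box_Suc)
qed

text \<open>\<open>aleph\<close> as a product over columns, as \<open>aleph_eq_aleph_cols\<close>
  will show. The factor of column \<open>i\<close> involves \<open>c\<close> at \<open>i\<close> and
  \<open>Suc i\<close> only.\<close>

definition aleph_cols :: "nat \<Rightarrow> (nat \<Rightarrow> nat) \<Rightarrow> (nat \<Rightarrow> nat) \<Rightarrow> rat fps" where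
  "aleph_cols M l c = (\<Prod>i=1..M. t ^ ((l i - c i) choose 2) *
     qbin (l i - c (Suc i)) (c i - c (Suc i)))"

definition cols_below :: "nat \<Rightarrow> (nat \<Rightarrow> nat) \<Rightarrow> (nat \<Rightarrow> nat) set" where
  "cols_below M l = {c \<in> box M (\<lambda>i. {0..l i}). \<forall>i\<in>{1..M}. c (Suc i) \<le> c i}"

lemma finite_cols_below: "finite (cols_below M l)"
  unfolding cols_below_def by (simp add: finite_box)

lemma prod_shift_index:
  fixes f :: "nat \<Rightarrow> nat \<Rightarrow> 'a::comm_monoid_mult"
  assumes "\<And>u. f 0 u = 1"
  shows "(\<Prod>i=1..M. f i (c (Suc i))) = (\<Prod>i=1..M. f (i - 1) (c i)) * f M (c (Suc M))"
  by (induction M) (simp_all add: assms)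

text \<open>Orthogonality of the two matrices. \<open>qbin_trinomial\<close> replaces the coupling
  of \<open>c i\<close> and \<open>c (Suc i)\<close> by a factor in \<open>c (Suc i)\<close> and
  data that do not depend on \<open>c\<close>. Reassigning that factor to the next column separates
  the variables, and the sum over the box becomes a product of sums over one column each.\<close>

lemma inverse_sum:
  fixes l n :: "nat \<Rightarrow> nat"
  assumes l: "\<And>i. 1 \<le> i \<Longrightarrow> i \<le> M \<Longrightarrow> l (Suc i) \<le> l i"
    and n: "n \<in> cols_below M l"
  defines "X \<equiv> box M (\<lambda>i. {n i..(if i = 1 then l i else min (l i) (n (i - 1)))})"
  shows "(\<Sum>c\<in>X. aleph_cols M l c * s ^ (\<Sum>i=1..M. l i - c i) * strip_weight s M c n) =
    (if \<forall>i\<in>{1..M}. n i = l i then 1 else 0)"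
proof -
  \<comment> \<open>The factor that column \<open>i\<close> hands over to column
    \<open>Suc i\<close>. Column 1 has no left neighbour, hence the value 1 at
    \<open>i = 0\<close>.\<close>
  define f where "f i u = (if i = 0 then 1 else qbin (l i - u) (n i - u))" for i u
  define h where "h i u = t ^ ((l i - u) choose 2) * s ^ (l i - u) * (- s) ^ (u - n i) *
    qbin (l i - n i) (u - n i) * f (i - 1) u" for i u
  have nl: "n i \<le> l i" if "i \<in> {1..M}" for i
    using n that by (auto simp: cols_below_def box_def)
  have factor: "aleph_cols M l c * s ^ (\<Sum>i=1..M. l i - c i) * strip_weight s M c n =
      (\<Prod>i=1..M. h i (c i)) * f M 0" if "c \<in> X" for c
  proof -
    have cX: "c i \<in> {n i..(if i = 1 then l i else min (l i) (n (i - 1)))}" if "i \<in> {1..M}" for i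
      using \<open>c \<in> X\<close> that unfolding X_def box_def by blast
    have cn: "n i \<le> c i" "c i \<le> l i" if "i \<in> {1..M}" for i
      using cX[OF that] by (auto split: if_splits)
    have cSuc: "c (Suc i) \<le> n i" if "i \<in> {1..M}" for i
    proof (cases "i = M")
      case True
      then show ?thesis using \<open>c \<in> X\<close> by (auto simp: X_def box_def)
    next
      case False
      then have "Suc i \<in> {1..M}" using that by auto
      from cX[OF this] show ?thesis using that by auto
    qed
    have tri: "qbin (l i - c (Suc i)) (c i - c (Suc i)) * qbin (c i - c (Suc i)) (c i - n i) =
        f i (c (Suc i)) * qbin (l i - n i) (c i - n i)" if "i \<in> {1..M}" for i
      using qbin_trinomial[of "n i - c (Suc i)" "c i - c (Suc i)" "l i - c (Suc i)"]
        cn[OF that] cSuc[OF that] that by (simp add: f_def diff_le_mono)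
    have "aleph_cols M l c * s ^ (\<Sum>i=1..M. l i - c i) * strip_weight s M c n =
      (\<Prod>i=1..M. t ^ ((l i - c i) choose 2) * s ^ (l i - c i) * (- s) ^ (c i - n i) *
        (qbin (l i - c (Suc i)) (c i - c (Suc i)) * qbin (c i - c (Suc i)) (c i - n i)))"
      unfolding aleph_cols_def strip_weight_def power_sum prod.distrib[symmetric]
      by (intro prod.cong refl) (simp only: mult_ac)
    also have "\<dots> = (\<Prod>i=1..M. t ^ ((l i - c i) choose 2) * s ^ (l i - c i) * (- s) ^ (c i - n i) *
        qbin (l i - n i) (c i - n i)) * (\<Prod>i=1..M. f i (c (Suc i)))"
      unfolding prod.distrib[symmetric] by (intro prod.cong refl, subst tri) (simp_all only: mult_ac)
    also have "(\<Prod>i=1..M. f i (c (Suc i))) = (\<Prod>i=1..M. f (i - 1) (c i)) * f M (c (Suc M))"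
      by (rule prod_shift_index) (simp add: f_def)
    also have "c (Suc M) = 0"
      using \<open>c \<in> X\<close> by (auto simp: X_def box_def)
    finally show ?thesis
      by (simp add: h_def prod.distrib mult_ac)
  qed
  have "(\<Sum>c\<in>X. aleph_cols M l c * s ^ (\<Sum>i=1..M. l i - c i) * strip_weight s M c n) =
      (\<Sum>c\<in>X. \<Prod>i=1..M. h i (c i)) * f M 0"
    unfolding sum_distrib_right by (intro sum.cong refl factor)
  also have "\<dots> = (\<Prod>i=1..M. \<Sum>u\<in>{n i..(if i = 1 then l i else min (l i) (n (i - 1)))}. h i u) * f M 0"
    unfolding X_def sum_box_prod ..
  also have "\<dots> = (if \<forall>i\<in>{1..M}. n i = l i then 1 else 0)"
  proof (cases "\<forall>i\<in>{1..M}. n i = l i")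
    case True
    have "(\<Sum>u\<in>{n i..(if i = 1 then l i else min (l i) (n (i - 1)))}. h i u) = 1" if i: "i \<in> {1..M}" for i
    proof -
      have "i = 1 \<or> n (i - 1) = l (i - 1) \<and> l i \<le> l (i - 1)"
      proof (cases "i = 1")
        case False
        then obtain j where "i = Suc j" "j \<in> {1..M}" using i by (cases i) auto
        then show ?thesis using True l[of j] by auto
      qed simp
      then have "{n i..(if i = 1 then l i else min (l i) (n (i - 1)))} = {l i}"
        "f (i - 1) (l i) = 1"
        using True i by (auto simp: f_def)
      then show ?thesis using True i by (simp add: h_def numeral_2_eq_2)
    qed
    moreover have "f M 0 = 1" using True by (auto simp: f_def)
    ultimately show ?thesis using True by simp
  next
    case False
    \<comment> \<open>The first difference is chosen because there the left neighbour still agrees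
      with \<open>l\<close>: the bound \<open>n (i - 1)\<close> does not cut the range, the factor
      handed over is 1, and a complete alternating sum remains.\<close>
    define i where "i = (LEAST i. i \<in> {1..M} \<and> n i \<noteq> l i)"
    have ex: "\<exists>i. i \<in> {1..M} \<and> n i \<noteq> l i" using False by blast
    note i = conjunct1[OF LeastI_ex[OF ex, folded i_def]] conjunct2[OF LeastI_ex[OF ex, folded i_def]]
    have least: "n j = l j" if "j \<in> {1..M}" "j < i" for j
      using not_less_Least[of j "\<lambda>i. i \<in> {1..M} \<and> n i \<noteq> l i", folded i_def] that by blast
    have prev: "i = 1 \<or> n (i - 1) = l (i - 1) \<and> l i \<le> l (i - 1)"
    proof (cases "i = 1")
      case False
      then obtain j where "i = Suc j" "j \<in> {1..M}" using i by (cases i) auto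
      then show ?thesis using least[of j] l[of j] by auto
    qed simp
    then have range: "{n i..(if i = 1 then l i else min (l i) (n (i - 1)))} = {n i..l i}"
      and f1: "f (i - 1) u = 1" for u
      by (auto simp: f_def)
    define N where "N = l i - n i"
    have N: "N \<ge> 1" using i nl[of i] by (auto simp: N_def)
    have "(\<Sum>u\<in>{n i..l i}. h i u) =
        (\<Sum>k\<le>N. (s ^ N * (- 1) ^ N) * ((- 1) ^ k * t ^ (k choose 2) * qbin N k))"
    proof (rule sum.reindex_bij_witness[where i = "\<lambda>k. l i - k" and j = "\<lambda>u. l i - u"])
      fix u assume u: "u \<in> {n i..l i}"
      define k where "k = l i - u"
      have k: "k \<le> N" "u - n i = N - k" using u by (auto simp: k_def N_def)
      have "(- s) ^ (N - k) = (- 1) ^ (N - k) * s ^ (N - k)"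
        by (rule power_minus)
      moreover have "(- 1 :: rat fps) ^ (N - k) = (- 1) ^ N * (- 1) ^ k"
        using k(1) by (metis even_diff_nat even_add neg_one_even_power neg_one_odd_power
            mult_minus1 mult_minus1_right minus_one_mult_self uminus_power_if mult_1 mult.right_neutral
            linorder_not_le)
      moreover have "s ^ k * s ^ (N - k) = s ^ N"
        using k(1) by (simp flip: power_add)
      ultimately have "s ^ k * (- s) ^ (N - k) = s ^ N * ((- 1) ^ N * (- 1) ^ k)"
        by (simp add: mult_ac)
      then show "s ^ N * (- 1) ^ N * ((- 1) ^ (l i - u) * t ^ ((l i - u) choose 2) * qbin N (l i - u)) = h i u"
        unfolding h_def f1 k_def[symmetric] k(2) N_def[symmetric] qbin_symmetric[OF k(1)]
        by (simp add: mult_ac)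
    qed (use nl[OF i(1)] in \<open>auto simp: N_def\<close>)
    also have "\<dots> = 0"
      unfolding sum_distrib_left[symmetric] qbin_alternating_sum[OF N] by simp
    finally have "(\<Prod>i=1..M. \<Sum>u\<in>{n i..(if i = 1 then l i else min (l i) (n (i - 1)))}. h i u) = 0"
      using i(1) by (intro prod_zero bexI[of _ i]) (simp_all only: range finite_atLeastAtMost)
    then show ?thesis by (simp only: False if_False mult_zero_left)
  qed
  finally show ?thesis .
qed

text \<open>The proposed expansion of the function at \<open>X + s\<close> is tested by subtracting
  \<open>s\<close> again. Exchanging the two sums reduces the test to
  \<open>inverse_sum\<close>.\<close>

lemma sub_var_aleph_sum:
  assumes l: "\<And>i. 1 \<le> i \<Longrightarrow> i \<le> M \<Longrightarrow> l (Suc i) \<le> l i" and l0: "l (Suc M) = 0"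
  shows "sub_var s (\<Sum>c\<in>cols_below M l. scal (aleph_cols M l c * s ^ (\<Sum>i=1..M. l i - c i)) * jing_prod (rows M c)) =
    jing_prod (rows M l)"
proof -
  let ?Y = "cols_below M l"
  let ?a = "\<lambda>c. aleph_cols M l c * s ^ (\<Sum>i=1..M. l i - c i)"
  let ?S = "\<lambda>c. box M (\<lambda>i. {c (Suc i)..c i})"
  let ?X = "\<lambda>n. box M (\<lambda>i. {n i..(if i = 1 then l i else min (l i) (n (i - 1)))})"
  \<comment> \<open>The interlacing conditions \<open>c (Suc i) \<le> n i \<le> c i\<close>, solved
    for \<open>c\<close> when \<open>n\<close> is fixed, read
    \<open>n i \<le> c i \<le> n (i - 1)\<close>.\<close>
  have pairs: "c \<in> ?Y \<and> n \<in> ?S c \<longleftrightarrow> n \<in> ?Y \<and> c \<in> ?X n" for c n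
  proof
    assume A: "c \<in> ?Y \<and> n \<in> ?S c"
    then have c: "\<And>i. i \<in> {1..M} \<Longrightarrow> c i \<le> l i" "\<And>i. i \<in> {1..M} \<Longrightarrow> c (Suc i) \<le> n i"
      "\<And>i. i \<in> {1..M} \<Longrightarrow> n i \<le> c i" "\<And>i. i \<notin> {1..M} \<Longrightarrow> c i = 0" "\<And>i. i \<notin> {1..M} \<Longrightarrow> n i = 0"
      unfolding cols_below_def box_def by auto
    have "n (Suc i) \<le> n i" if "i \<in> {1..M}" for i
      using c(2)[OF that] c(3)[of "Suc i"] c(5)[of "Suc i"] by (cases "Suc i \<in> {1..M}") auto
    moreover have "c i \<le> n (i - 1)" if "i \<in> {1..M}" "i \<noteq> 1" for i
    proof -
      obtain j where "i = Suc j" "j \<in> {1..M}" using \<open>i \<in> {1..M}\<close> \<open>i \<noteq> 1\<close> by (cases i) auto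
      then show ?thesis using c(2)[of j] by simp
    qed
    moreover have "n i \<le> l i" if "i \<in> {1..M}" for i
      using c(1,3)[OF that] by linarith
    ultimately show "n \<in> ?Y \<and> c \<in> ?X n"
      using c unfolding cols_below_def box_def by auto
  next
    assume A: "n \<in> ?Y \<and> c \<in> ?X n"
    have cX: "c i \<in> {n i..(if i = 1 then l i else min (l i) (n (i - 1)))}" if "i \<in> {1..M}" for i
      using A that unfolding box_def by blast
    have c: "n i \<le> c i" "c i \<le> l i" "i \<noteq> 1 \<Longrightarrow> c i \<le> n (i - 1)" if "i \<in> {1..M}" for i
      using cX[OF that] by (auto split: if_splits)
    have c0: "\<And>i. i \<notin> {1..M} \<Longrightarrow> c i = 0" "\<And>i. i \<notin> {1..M} \<Longrightarrow> n i = 0"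
      using A unfolding cols_below_def box_def by auto
    have "c (Suc i) \<le> n i" if "i \<in> {1..M}" for i
      using c(3)[of "Suc i"] c0(1)[of "Suc i"] that by (cases "Suc i \<in> {1..M}") auto
    moreover from this have "c (Suc i) \<le> c i" if "i \<in> {1..M}" for i
      using c(1)[OF that] that le_trans by blast
    ultimately show "c \<in> ?Y \<and> n \<in> ?S c"
      using c(1,2) c0 unfolding cols_below_def box_def by auto
  qed
  have "sub_var s (\<Sum>c\<in>?Y. scal (?a c) * jing_prod (rows M c)) =
      (\<Sum>c\<in>?Y. \<Sum>n\<in>?S c. scal (?a c * strip_weight s M c n) * jing_prod (rows M n))"
  proof -
    have "sub_var s (scal (?a c) * jing_prod (rows M c)) =
        (\<Sum>n\<in>?S c. scal (?a c * strip_weight s M c n) * jing_prod (rows M n))" if c: "c \<in> ?Y" for c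
    proof -
      have "c (Suc M) = 0" using c by (auto simp: cols_below_def box_def)
      moreover have "n(Suc M := 0) = n" if "n \<in> ?S c" for n
        using that by (auto simp: box_def)
      moreover have "c (Suc i) \<le> c i" if "1 \<le> i" "i \<le> M" for i
        using c that by (auto simp: cols_below_def)
      ultimately show ?thesis
        by (simp add: hom_mult[OF is_ring_hom_sub_var] sub_var_scal sub_var_jing_prod_rows sum_distrib_left
            hom_mult[OF is_ring_hom_scal] mult.assoc)
    qed
    then show ?thesis by (simp add: hom_sum[OF is_ring_hom_sub_var])
  qed
  also have "\<dots> = (\<Sum>n\<in>?Y. \<Sum>c\<in>?X n. scal (?a c * strip_weight s M c n) * jing_prod (rows M n))"
  proof -
    have sw: "x \<in> Sigma ?Y ?S \<longleftrightarrow> prod.swap x \<in> Sigma ?Y ?X" for x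
      using pairs[of "fst x" "snd x"]
      by (cases x) (simp only: mem_Sigma_iff swap_simp fst_conv snd_conv)
    have "(\<Sum>(c, n)\<in>Sigma ?Y ?S. scal (?a c * strip_weight s M c n) * jing_prod (rows M n)) =
        (\<Sum>(n, c)\<in>Sigma ?Y ?X. scal (?a c * strip_weight s M c n) * jing_prod (rows M n))"
      by (rule sum.reindex_bij_witness[where i = prod.swap and j = prod.swap])
        (simp_all only: sw swap_swap case_prod_beta fst_swap snd_swap)
    then show ?thesis
      by (subst (1 2) sum.Sigma) (simp_all add: finite_cols_below finite_box)
  qed
  also have "\<dots> = (\<Sum>n\<in>?Y. scal (\<Sum>c\<in>?X n. ?a c * strip_weight s M c n) * jing_prod (rows M n))"
    by (simp only: hom_sum[OF is_ring_hom_scal] sum_distrib_right)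
  also have "\<dots> = (\<Sum>n\<in>?Y. scal (if \<forall>i\<in>{1..M}. n i = l i then 1 else 0) * jing_prod (rows M n))"
    using l by (intro sum.cong refl) (simp only: inverse_sum)
  \<comment> \<open>\<open>l\<close> itself may fail to lie in the box, because its value at 0 can
    be nonzero; its restriction to \<open>1..M\<close> does lie there.\<close>
  also have "\<dots> = (\<Sum>n\<in>{\<lambda>i. if i \<in> {1..M} then l i else 0}.
      scal (if \<forall>i\<in>{1..M}. n i = l i then 1 else 0) * jing_prod (rows M n))"
  proof (rule sum.mono_neutral_right)
    show "{\<lambda>i. if i \<in> {1..M} then l i else 0} \<subseteq> ?Y"
      using l by (auto simp: cols_below_def box_def)
    show "\<forall>n\<in>?Y - {\<lambda>i. if i \<in> {1..M} then l i else 0}.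
        scal (if \<forall>i\<in>{1..M}. n i = l i then 1 else 0) * jing_prod (rows M n) = 0"
      by (auto simp: cols_below_def box_def hom_zero[OF is_ring_hom_scal] fun_eq_iff split: if_splits)
  qed (rule finite_cols_below)
  also have "\<dots> = jing_prod (rows M (\<lambda>i. if i \<in> {1..M} then l i else 0))"
    by (simp add: hom_one[OF is_ring_hom_scal])
  also have "rows M (\<lambda>i. if i \<in> {1..M} then l i else 0) = rows M l"
    using l0 by (intro rows_cong) (auto simp: le_Suc_eq)
  finally show ?thesis .
qed

section \<open>Columns of partitions\<close>

lemma conj_part_eq_length: "conj_part \<kappa> j = length (filter (\<lambda>x. j \<le> x) \<kappa>)"
  by (simp add: conj_part_def length_filter_conv_card)

lemma conj_part_Nil [simp]: "conj_part [] j = 0"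
  and conj_part_Cons: "conj_part (x # \<kappa>) j = (if j \<le> x then Suc (conj_part \<kappa> j) else conj_part \<kappa> j)"
  and conj_part_append: "conj_part (xs @ ys) j = conj_part xs j + conj_part ys j"
  and conj_part_replicate: "conj_part (replicate n x) j = (if j \<le> x then n else 0)"
  by (simp_all add: conj_part_eq_length filter_replicate)

lemma conj_part_Suc: "conj_part \<kappa> j = conj_part \<kappa> (Suc j) + count_list \<kappa> j"
  by (induction \<kappa>) (auto simp: conj_part_Cons)

lemma conj_part_antimono: "i \<le> j \<Longrightarrow> conj_part \<kappa> j \<le> conj_part \<kappa> i"
  by (induction \<kappa>) (auto simp: conj_part_Cons)

lemma is_partition_Cons:
  "is_partition (x # \<kappa>) \<longleftrightarrow> x > 0 \<and> (\<forall>y\<in>set \<kappa>. y \<le> x) \<and> is_partition \<kappa>"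
  by (auto simp: is_partition_def)

lemma conj_part_eq_0: "(\<And>x. x \<in> set \<kappa> \<Longrightarrow> x < j) \<Longrightarrow> conj_part \<kappa> j = 0"
  by (auto simp: conj_part_eq_length filter_empty_conv not_le)

lemma less_conj_part_iff:
  "is_partition \<kappa> \<Longrightarrow> j \<ge> 1 \<Longrightarrow> i < conj_part \<kappa> j \<longleftrightarrow> j \<le> part \<kappa> i"
proof (induction \<kappa> arbitrary: i)
  case Nil
  then show ?case by (simp add: part_def)
next
  case (Cons x \<kappa>)
  show ?case
  proof (cases "j \<le> x")
    case True
    then show ?thesis
      using Cons by (cases i) (auto simp: is_partition_Cons conj_part_Cons part_def)
  next
    case False
    then have "conj_part (x # \<kappa>) j = 0"
      using Cons.prems by (intro conj_part_eq_0) (force simp: is_partition_Cons)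
    moreover have "part (x # \<kappa>) i < j"
    proof (cases "i < length (x # \<kappa>)")
      case True
      then have "(x # \<kappa>) ! i \<in> set (x # \<kappa>)" by (rule nth_mem)
      then show ?thesis
        using Cons.prems False True by (force simp: is_partition_Cons part_def)
    next
      case False
      then show ?thesis using Cons.prems by (simp add: part_def)
    qed
    ultimately show ?thesis by simp
  qed
qed

lemma diagram_subset_iff_conj_part:
  assumes "is_partition \<mu>" "is_partition \<kappa>"
  shows "diagram_subset \<mu> \<kappa> \<longleftrightarrow> (\<forall>j\<ge>1. conj_part \<mu> j \<le> conj_part \<kappa> j)"
proof
  assume "diagram_subset \<mu> \<kappa>"
  then show "\<forall>j\<ge>1. conj_part \<mu> j \<le> conj_part \<kappa> j"
    using less_conj_part_iff[OF assms(1)] less_conj_part_iff[OF assms(2)]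
    unfolding diagram_subset_def by (meson le_trans linorder_not_le order_less_irrefl)
next
  assume le: "\<forall>j\<ge>1. conj_part \<mu> j \<le> conj_part \<kappa> j"
  show "diagram_subset \<mu> \<kappa>"
    unfolding diagram_subset_def
  proof
    fix i
    show "part \<mu> i \<le> part \<kappa> i"
    proof (cases "part \<mu> i = 0")
      case False
      then have "i < conj_part \<mu> (part \<mu> i)"
        using less_conj_part_iff[OF assms(1)] by simp
      then have "i < conj_part \<kappa> (part \<mu> i)"
        using le False by (metis One_nat_def Suc_leI less_le_trans neq0_conv)
      then show ?thesis
        using less_conj_part_iff[OF assms(2)] False by simp
    qed simp
  qed
qed

lemma rows_conj_part:
  assumes "is_partition \<kappa>"
  shows "rows m (conj_part \<kappa>) = filter (\<lambda>x. x \<le> m) \<kappa>"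
proof (induction m)
  case 0
  have "filter (\<lambda>x. x \<le> 0) \<kappa> = []"
    using assms by (intro filter_False ballI) (metis is_partition_def le_zero_eq)
  then show ?case by simp
next
  case (Suc m)
  have "filter (\<lambda>x. x \<le> Suc m) \<kappa> = replicate (count_list \<kappa> (Suc m)) (Suc m) @ filter (\<lambda>x. x \<le> m) \<kappa>"
    using assms
  proof (induction \<kappa>)
    case (Cons x \<kappa>)
    show ?case
    proof (cases "x \<le> m")
      case True
      then have "Suc m \<notin> set \<kappa>" using Cons.prems by (force simp: is_partition_Cons)
      then show ?thesis using Cons True by (auto simp: is_partition_Cons count_list_0_iff)
    next
      case False
      then show ?thesis using Cons by (auto simp: is_partition_Cons)
    qed
  qed simp
  then show ?case
    using Suc conj_part_Suc[of \<kappa> "Suc m"] by simp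
qed

lemma set_rows: "set (rows m c) \<subseteq> {1..m}"
  by (induction m) (auto split: if_splits)

lemma is_partition_rows: "is_partition (rows m c)"
proof (induction m)
  case (Suc m)
  have "x \<le> m" if "x \<in> set (rows m c)" for x
    using set_rows[of m c] that by auto
  moreover have "sorted_wrt (\<ge>) (replicate n (Suc m))" for n
    by (induction n) auto
  ultimately show ?case
    using Suc by (auto simp: is_partition_def sorted_wrt_append le_SucI)
qed (simp add: is_partition_def)

lemma conj_part_rows:
  assumes "\<And>i. 1 \<le> i \<Longrightarrow> i \<le> m \<Longrightarrow> c (Suc i) \<le> c i" "j \<ge> 1" "j \<le> m"
  shows "conj_part (rows m c) j = c j - c (Suc m)"
  using assms
proof (induction m)
  case (Suc m)
  have le: "c (Suc (Suc m)) \<le> c (Suc m)" using Suc.prems(1)[of "Suc m"] by simp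
  show ?case
  proof (cases "j = Suc m")
    case True
    have "conj_part (rows m c) (Suc m) = 0"
      using set_rows[of m c] by (intro conj_part_eq_0) auto
    then show ?thesis using True by (simp add: conj_part_append conj_part_replicate)
  next
    case False
    then have j: "j \<le> m" using Suc.prems by simp
    have "c (Suc m) \<le> c j" using j
    proof (induction rule: inc_induct)
      case base
      then show ?case using Suc.prems(1)[of m] Suc.prems(2) j by simp
    next
      case (step n)
      then show ?case using Suc.prems(1)[of n] Suc.prems(2) by simp
    qed
    then show ?thesis
      using Suc.IH Suc.prems j le by (simp add: conj_part_append conj_part_replicate)
  qed
qed simp

lemma parts_le_first:
  assumes "is_partition \<kappa>" "x \<in> set \<kappa>"
  shows "x \<le> part \<kappa> 0"
  using assms by (cases \<kappa>) (auto simp: is_partition_Cons part_def)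

text \<open>Index 0 is set to 0 so that the function belongs to a \<open>box\<close>;
  \<open>conj_part \<mu> 0\<close> would be the length of \<open>\<mu>\<close>.\<close>

definition cols :: "nat list \<Rightarrow> nat \<Rightarrow> nat" where
  "cols \<mu> j = (if j = 0 then 0 else conj_part \<mu> j)"

lemma bij_betw_rows:
  assumes \<kappa>: "is_partition \<kappa>"
  defines "M \<equiv> part \<kappa> 0"
  shows "bij_betw (rows M) (cols_below M (conj_part \<kappa>)) {\<mu>. is_partition \<mu> \<and> diagram_subset \<mu> \<kappa>}"
proof (rule bij_betw_byWitness[where f' = cols])
  have eq: "cols (rows M c) = c" "is_partition (rows M c)" if c: "c \<in> cols_below M (conj_part \<kappa>)" for c
  proof -
    show "is_partition (rows M c)" by (rule is_partition_rows)
    have c0: "c i = 0" if "i \<notin> {1..M}" for i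
      using c that by (auto simp: cols_below_def box_def)
    show "cols (rows M c) = c"
    proof
      fix j
      show "cols (rows M c) j = c j"
      proof (cases "j \<in> {1..M}")
        case True
        then show ?thesis
          using c c0[of "Suc M"] by (simp add: cols_def conj_part_rows cols_below_def)
      next
        case False
        then have "j \<noteq> 0 \<Longrightarrow> conj_part (rows M c) j = 0"
          using set_rows[of M c] by (intro conj_part_eq_0) auto
        then show ?thesis using False c0 by (simp add: cols_def)
      qed
    qed
  qed
  then show "\<forall>c\<in>cols_below M (conj_part \<kappa>). cols (rows M c) = c" by blast
  have inv: "rows M (cols \<mu>) = \<mu>" "cols \<mu> \<in> cols_below M (conj_part \<kappa>)"
    if \<mu>: "is_partition \<mu>" "diagram_subset \<mu> \<kappa>" for \<mu>
  proof -
    have le: "x \<le> M" if "x \<in> set \<mu>" for x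
      using parts_le_first[OF \<mu>(1) that] \<mu>(2) by (auto simp: diagram_subset_def M_def intro: le_trans)
    have "rows M (cols \<mu>) = rows M (conj_part \<mu>)"
      by (rule rows_cong) (simp add: cols_def)
    then show "rows M (cols \<mu>) = \<mu>"
      using le by (simp add: rows_conj_part \<mu>)
    have "conj_part \<mu> j = 0" if "j > M" for j
      using le that by (intro conj_part_eq_0) force
    then show "cols \<mu> \<in> cols_below M (conj_part \<kappa>)"
      using diagram_subset_iff_conj_part[OF \<mu>(1) \<kappa>] \<mu>(2)
      by (auto simp: cols_below_def box_def cols_def conj_part_antimono)
  qed
  then show "\<forall>\<mu>\<in>{\<mu>. is_partition \<mu> \<and> diagram_subset \<mu> \<kappa>}. rows M (cols \<mu>) = \<mu>"
    and "cols ` {\<mu>. is_partition \<mu> \<and> diagram_subset \<mu> \<kappa>} \<subseteq> cols_below M (conj_part \<kappa>)"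
    by auto
  have "diagram_subset (rows M c) \<kappa>" if c: "c \<in> cols_below M (conj_part \<kappa>)" for c
  proof -
    have "conj_part (rows M c) j \<le> conj_part \<kappa> j" if "j \<ge> 1" for j
    proof -
      have "conj_part (rows M c) j = c j"
        using eq(1)[OF c] that by (metis cols_def not_one_le_zero)
      also have "\<dots> \<le> conj_part \<kappa> j"
        using c by (cases "j \<in> {1..M}") (auto simp: cols_below_def box_def)
      finally show ?thesis .
    qed
    then show ?thesis
      by (simp add: diagram_subset_iff_conj_part[OF is_partition_rows \<kappa>])
  qed
  then show "rows M ` cols_below M (conj_part \<kappa>) \<subseteq> {\<mu>. is_partition \<mu> \<and> diagram_subset \<mu> \<kappa>}"
    using eq(2) by auto
qed

lemma prod_lessThan_add:
  fixes f :: "nat \<Rightarrow> 'a::comm_monoid_mult"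
  shows "(\<Prod>i<n + k. f i) = (\<Prod>i<n. f i) * (\<Prod>i<k. f (n + i))"
  by (induction k) (simp_all add: mult_ac)

text \<open>The rows of length \<open>j\<close> occupy the positions from \<open>c (Suc j)\<close>
  up to \<open>c j - 1\<close> of the full partition. The offset \<open>c (Suc m)\<close> stands for
  the rows longer than \<open>m\<close> that precede \<open>rows m c\<close>.\<close>

lemma prod_rows:
  fixes f :: "nat \<Rightarrow> nat \<Rightarrow> 'a::comm_monoid_mult"
  assumes "\<And>i. 1 \<le> i \<Longrightarrow> i \<le> m \<Longrightarrow> c (Suc i) \<le> c i"
  shows "(\<Prod>i<length (rows m c). f (rows m c ! i) (i + c (Suc m))) =
    (\<Prod>j=1..m. \<Prod>i=c (Suc j)..<c j. f j i)"
  using assms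
proof (induction m)
  case (Suc m)
  let ?b = "c (Suc (Suc m))" and ?n = "c (Suc m) - c (Suc (Suc m))"
  have le: "?b \<le> c (Suc m)" using Suc.prems[of "Suc m"] by simp
  have "(\<Prod>i<?n. f (Suc m) (i + ?b)) = (\<Prod>i=?b..<c (Suc m). f (Suc m) i)"
    using prod.shift_bounds_nat_ivl[of "f (Suc m)" 0 ?b ?n] le
    by (simp add: atLeast0LessThan)
  moreover have "(\<Prod>i<length (rows m c). f (rows m c ! i) (?n + i + ?b)) =
      (\<Prod>j=1..m. \<Prod>i=c (Suc j)..<c j. f j i)"
  proof -
    have "?n + i + ?b = i + c (Suc m)" for i using le by simp
    then show ?thesis using Suc by simp
  qed
  ultimately show ?case
    by (simp add: prod_lessThan_add nth_append mult.commute)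
qed simp

lemma qfact_falling:
  "b \<le> a \<Longrightarrow> a \<le> l \<Longrightarrow> (\<Prod>i=b..<a. 1 - t ^ (l - i)) = qbin (l - b) (a - b) * qfact (a - b)"
proof -
  assume ab: "b \<le> a" and al: "a \<le> l"
  have "(\<Prod>i=b..<a. 1 - t ^ (l - i)) * qfact (l - a) = qfact (l - b)"
    using ab al
  proof (induction a rule: dec_induct)
    case (step n)
    have "qfact (l - n) = qfact (l - Suc n) * (1 - t ^ (l - n))"
      using step.prems by (metis Suc_diff_Suc Suc_le_lessD qfact_Suc)
    then show ?case using step by (simp add: mult_ac)
  qed simp
  also have "\<dots> = qbin (l - b) (a - b) * qfact (a - b) * qfact (l - a)"
    using qbin_mult_qfact[of "a - b" "l - b"] ab al by (simp add: mult_ac)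
  finally show ?thesis by simp
qed

lemma b_poly_eq_prod_qfact:
  assumes "\<And>x. x \<in> set \<mu> \<Longrightarrow> 1 \<le> x \<and> x \<le> M"
  shows "b_poly \<mu> = (\<Prod>j=1..M. qfact (count_list \<mu> j))"
  unfolding b_poly_def qfact_def[symmetric] using assms
  by (intro prod.mono_neutral_left) (auto simp: count_list_0_iff)

lemma n_skew_eq:
  assumes "is_partition \<mu>" "is_partition \<kappa>" "diagram_subset \<mu> \<kappa>"
  shows "n_skew \<kappa> \<mu> = (\<Sum>j=1..part \<kappa> 0. (conj_part \<kappa> j - conj_part \<mu> j) choose 2)"
proof -
  have "(int a - int b) * (int a - int b - 1) div 2 = int ((a - b) choose 2)" if "b \<le> a" for a b :: nat
  proof -
    have "(int a - int b) * (int a - int b - 1) = int ((a - b) * (a - b - 1))"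
      using that by (cases "a = b") (auto simp: of_nat_diff)
    then show ?thesis by (simp add: choose_two zdiv_int)
  qed
  moreover have "max (part \<kappa> 0) (part \<mu> 0) = part \<kappa> 0"
    using assms(3) by (simp add: diagram_subset_def max_absorb1)
  ultimately have "n_skew \<kappa> \<mu> = nat (\<Sum>j=1..part \<kappa> 0. int ((conj_part \<kappa> j - conj_part \<mu> j) choose 2))"
    using diagram_subset_iff_conj_part[OF assms(1,2)] assms(3) by (simp add: n_skew_def)
  then show ?thesis by (simp flip: of_nat_sum)
qed

text \<open>The rows of length \<open>j\<close> sit at consecutive positions, so their factors form
  a falling product, which is a q-binomial coefficient times \<open>qfact\<close> of the
  multiplicity of \<open>j\<close>. These \<open>qfact\<close> factors multiply to
  \<open>b_poly \<mu>\<close> and cancel its inverse.\<close>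

lemma aleph_eq_aleph_cols:
  assumes \<mu>: "is_partition \<mu>" and \<kappa>: "is_partition \<kappa>" and sub: "diagram_subset \<mu> \<kappa>"
  shows "aleph \<kappa> \<mu> = aleph_cols (part \<kappa> 0) (conj_part \<kappa>) (cols \<mu>)"
proof -
  let ?M = "part \<kappa> 0" and ?l = "conj_part \<kappa>" and ?c = "conj_part \<mu>"
  have le: "1 \<le> x \<and> x \<le> ?M" if "x \<in> set \<mu>" for x
  proof -
    have "x \<noteq> 0" using \<mu> that by (metis is_partition_def)
    then show ?thesis
      using parts_le_first[OF \<mu> that] sub
      by (auto simp: diagram_subset_def Suc_leI intro: le_trans)
  qed
  have cl: "?c j \<le> ?l j" if "j \<ge> 1" for j
    using sub diagram_subset_iff_conj_part[OF \<mu> \<kappa>] that by blast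
  have c0: "?c (Suc ?M) = 0"
    using le by (intro conj_part_eq_0) force
  have rows: "rows ?M ?c = \<mu>"
    using le by (simp add: rows_conj_part[OF \<mu>])
  have cnt: "count_list \<mu> j = ?c j - ?c (Suc j)" for j
    using conj_part_Suc[of \<mu> j] by simp
  have "(\<Prod>i<length \<mu>. 1 - t ^ (?l (part \<mu> i) - i)) = (\<Prod>i<length \<mu>. 1 - t ^ (?l (\<mu> ! i) - (i + 0)))"
    by (simp add: part_def)
  also have "\<dots> = (\<Prod>j=1..?M. \<Prod>i=?c (Suc j)..<?c j. 1 - t ^ (?l j - i))"
    using prod_rows[of ?M ?c "\<lambda>j i. 1 - t ^ (?l j - i)"]
    unfolding rows c0 by (simp add: conj_part_antimono)
  also have "\<dots> = (\<Prod>j=1..?M. qbin (?l j - ?c (Suc j)) (?c j - ?c (Suc j)) * qfact (count_list \<mu> j))"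
    by (intro prod.cong refl) (simp add: qfact_falling conj_part_antimono cl cnt)
  also have "\<dots> = (\<Prod>j=1..?M. qbin (?l j - ?c (Suc j)) (?c j - ?c (Suc j))) * b_poly \<mu>"
    by (simp add: prod.distrib b_poly_eq_prod_qfact[OF le])
  finally have "aleph \<kappa> \<mu> = inverse (b_poly \<mu>) * b_poly \<mu> *
      (t ^ n_skew \<kappa> \<mu> * (\<Prod>j=1..?M. qbin (?l j - ?c (Suc j)) (?c j - ?c (Suc j))))"
    by (simp only: aleph_def mult_ac)
  also have "inverse (b_poly \<mu>) * b_poly \<mu> = 1"
    by (simp add: inverse_mult_eq_1 b_poly_nth_0)
  also have "1 * (t ^ n_skew \<kappa> \<mu> * (\<Prod>j=1..?M. qbin (?l j - ?c (Suc j)) (?c j - ?c (Suc j))))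
      = aleph_cols ?M ?l (cols \<mu>)"
    unfolding n_skew_eq[OF \<mu> \<kappa> sub] power_sum aleph_cols_def mult_1 prod.distrib[symmetric]
    by (intro prod.cong refl) (simp add: cols_def)
  finally show ?thesis .
qed

lemma finite_partitions_below:
  "is_partition \<kappa> \<Longrightarrow> finite {\<mu>. is_partition \<mu> \<and> diagram_subset \<mu> \<kappa>}"
  using bij_betw_finite[OF bij_betw_rows] finite_cols_below by blast

section \<open>Addition of one letter to the alphabet\<close>

definition add_var :: "rat fps \<Rightarrow> sym \<Rightarrow> sym" where
  "add_var s f = eval_at f (\<lambda>k. psum k + scal (s ^ k))"

lemma is_ring_hom_sub_var_plus: "is_ring_hom (add_var s)"
  unfolding add_var_def by (rule is_ring_hom_eval_at)

lemma add_var_sub_var: "add_var s (sub_var s f) = f"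
proof -
  have "add_var s (sub_var s f) = eval_at f psum"
    unfolding add_var_def sub_var_def eval_at_eval_at by (rule eval_at_cong) (simp add: eval_at_simps)
  then show ?thesis by (simp add: eval_at_psum_id)
qed

lemma add_var_jing_prod:
  assumes \<kappa>: "is_partition \<kappa>"
  shows "add_var s (jing_prod \<kappa>) = (\<Sum>\<mu> | is_partition \<mu> \<and> diagram_subset \<mu> \<kappa>.
    scal (aleph \<kappa> \<mu> * s ^ (\<Sum>j=1..part \<kappa> 0. conj_part \<kappa> j - conj_part \<mu> j)) * jing_prod \<mu>)"
proof -
  let ?M = "part \<kappa> 0" and ?l = "conj_part \<kappa>"
  have le: "x \<le> ?M" if "x \<in> set \<kappa>" for x
    using parts_le_first[OF \<kappa> that] .
  have "rows ?M ?l = \<kappa>"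
    using le by (simp add: rows_conj_part[OF \<kappa>])
  moreover have "?l (Suc ?M) = 0"
    using le by (intro conj_part_eq_0) force
  ultimately have "add_var s (jing_prod \<kappa>) = add_var s (sub_var s (\<Sum>c\<in>cols_below ?M ?l.
      scal (aleph_cols ?M ?l c * s ^ (\<Sum>i=1..?M. ?l i - c i)) * jing_prod (rows ?M c)))"
    by (subst sub_var_aleph_sum) (simp_all add: conj_part_antimono)
  also have "\<dots> = (\<Sum>c\<in>cols_below ?M ?l.
      scal (aleph_cols ?M ?l c * s ^ (\<Sum>i=1..?M. ?l i - c i)) * jing_prod (rows ?M c))"
    by (rule add_var_sub_var)
  also have "\<dots> = (\<Sum>c\<in>cols_below ?M ?l. scal (aleph \<kappa> (rows ?M c) *
      s ^ (\<Sum>j=1..?M. ?l j - conj_part (rows ?M c) j)) * jing_prod (rows ?M c))"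
  proof (intro sum.cong refl)
    fix c assume c: "c \<in> cols_below ?M ?l"
    have "c (Suc ?M) = 0" using c by (auto simp: cols_below_def box_def)
    then have conj: "conj_part (rows ?M c) j = c j" if "j \<in> {1..?M}" for j
      using c that by (simp add: conj_part_rows cols_below_def)
    have "rows ?M c \<in> {\<mu>. is_partition \<mu> \<and> diagram_subset \<mu> \<kappa>}"
      using bij_betwE[OF bij_betw_rows[OF \<kappa>]] c by blast
    then have "aleph \<kappa> (rows ?M c) = aleph_cols ?M ?l (cols (rows ?M c))"
      by (intro aleph_eq_aleph_cols \<kappa>) auto
    also have "cols (rows ?M c) = c"
    proof
      fix j
      show "cols (rows ?M c) j = c j"
      proof (cases "j \<in> {1..?M}")
        case True
        then show ?thesis using conj by (simp add: cols_def)
      next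
        case False
        then have "j \<noteq> 0 \<Longrightarrow> conj_part (rows ?M c) j = 0"
          using set_rows[of ?M c] by (intro conj_part_eq_0) auto
        then show ?thesis using False c by (auto simp: cols_def cols_below_def box_def)
      qed
    qed
    finally show "scal (aleph_cols ?M ?l c * s ^ (\<Sum>i=1..?M. ?l i - c i)) * jing_prod (rows ?M c) =
        scal (aleph \<kappa> (rows ?M c) * s ^ (\<Sum>j=1..?M. ?l j - conj_part (rows ?M c) j)) * jing_prod (rows ?M c)"
      using conj by simp
  qed
  finally show ?thesis
    by (simp only: sum.reindex_bij_betw[OF bij_betw_rows[OF \<kappa>],
          of "\<lambda>\<mu>. scal (aleph \<kappa> \<mu> * s ^ (\<Sum>j=1..?M. ?l j - conj_part \<mu> j)) * jing_prod \<mu>"])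
qed

section \<open>Linear independence\<close>

text \<open>The coefficient of \<open>s ^ j\<close> in the translated product. It is given by a
  recursion because \<open>s\<close> is a constant of the coefficient ring and not an indeterminate
  whose coefficients could be extracted.\<close>

fun sub_var_coeff :: "nat list \<Rightarrow> nat \<Rightarrow> sym" where
  "sub_var_coeff [] j = (if j = 0 then 1 else 0)"
| "sub_var_coeff (r # \<kappa>) 0 = jing r (sub_var_coeff \<kappa> 0)"
| "sub_var_coeff (r # \<kappa>) (Suc j) = jing r (sub_var_coeff \<kappa> (Suc j)) - jing (r - 1) (sub_var_coeff \<kappa> j)"

lemma sub_var_coeff_eq_0: "j > length \<kappa> \<Longrightarrow> sub_var_coeff \<kappa> j = 0"
proof (induction \<kappa> arbitrary: j)
  case (Cons r \<kappa>)
  then show ?case by (cases j) simp_all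
qed simp

lemma sub_var_jing_prod_eq_sub_var_coeff:
  assumes "0 \<notin> set \<kappa>"
  shows "sub_var s (jing_prod \<kappa>) = (\<Sum>j\<le>length \<kappa>. scal (s ^ j) * sub_var_coeff \<kappa> j)"
  using assms
proof (induction \<kappa>)
  case Nil
  then show ?case by (simp add: hom_one[OF is_ring_hom_sub_var] hom_one[OF is_ring_hom_scal])
next
  case (Cons r \<kappa>)
  then obtain r' where r: "r = Suc r'" by (cases r) auto
  let ?n = "length \<kappa>"
  have "sub_var s (jing_prod (r # \<kappa>)) = (\<Sum>j\<le>?n. scal (s ^ j) * jing r (sub_var_coeff \<kappa> j))
      - (\<Sum>j\<le>?n. scal (s ^ Suc j) * jing r' (sub_var_coeff \<kappa> j))"
    using Cons by (simp add: jing_prod_Cons r sub_var_B jing_sum jing_scal_mult sum_distrib_left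
        hom_mult[OF is_ring_hom_scal] mult.assoc)
  also have "(\<Sum>j\<le>?n. scal (s ^ j) * jing r (sub_var_coeff \<kappa> j)) =
      (\<Sum>j\<le>Suc ?n. scal (s ^ j) * jing r (sub_var_coeff \<kappa> j))"
    by (simp add: sub_var_coeff_eq_0)
  also have "\<dots> = jing r (sub_var_coeff \<kappa> 0) + (\<Sum>j\<le>?n. scal (s ^ Suc j) * jing r (sub_var_coeff \<kappa> (Suc j)))"
    unfolding sum.atMost_Suc_shift by (simp add: hom_one[OF is_ring_hom_scal])
  also have "\<dots> - (\<Sum>j\<le>?n. scal (s ^ Suc j) * jing r' (sub_var_coeff \<kappa> j)) =
      (\<Sum>j\<le>Suc ?n. scal (s ^ j) * sub_var_coeff (r # \<kappa>) j)"
    unfolding sum.atMost_Suc_shift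
    by (simp add: hom_one[OF is_ring_hom_scal] r right_diff_distrib sum_subtractf)
  finally show ?case by simp
qed

text \<open>The highest power of \<open>s\<close> takes the lowered operator from every
  factor.\<close>

lemma sub_var_coeff_length:
  "sub_var_coeff \<kappa> (length \<kappa>) = (- 1) ^ length \<kappa> * jing_prod (map (\<lambda>x. x - 1) \<kappa>)"
proof (induction \<kappa>)
  case (Cons r \<kappa>)
  have "(- 1) ^ n = (scal ((- 1) ^ n) :: sym)" for n
    by (simp add: hom_simps[OF is_ring_hom_scal])
  then show ?case using Cons
    by (simp add: sub_var_coeff_eq_0 jing_prod_Cons jing_scal_mult)
qed simp

definition peel :: "nat list \<Rightarrow> nat list" where
  "peel \<mu> = filter (\<lambda>x. x \<noteq> 0) (map (\<lambda>x. x - 1) \<mu>)"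

lemma map_pred_eq_peel:
  "is_partition \<mu> \<Longrightarrow> \<exists>k. map (\<lambda>x. x - 1) \<mu> = peel \<mu> @ replicate k 0"
proof (induction \<mu>)
  case (Cons x \<mu>)
  show ?case
  proof (cases "x = 1")
    case True
    then have "\<forall>y\<in>set \<mu>. y = 1"
      using Cons.prems by (auto simp: is_partition_Cons is_partition_def)
        (metis One_nat_def Suc_leI le_antisym neq0_conv)
    then have "map (\<lambda>x. x - 1) (x # \<mu>) = replicate (Suc (length \<mu>)) 0"
      using True by (auto intro!: replicate_eqI)
    then show ?thesis
      unfolding peel_def by (metis append_Nil filter_replicate)
  next
    case False
    then have "x - 1 \<noteq> 0" using Cons.prems by (auto simp: is_partition_Cons)
    then show ?thesis using Cons by (auto simp: peel_def is_partition_Cons)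
  qed
qed (simp add: peel_def)

lemma jing_prod_map_pred: 
  assumes "is_partition \<mu>"
  shows "jing_prod (map (\<lambda>x. x - 1) \<mu>) = jing_prod (peel \<mu>)"
proof -
  have "jing_prod (replicate k 0) = 1" for k
    by (induction k) (simp_all add: jing_prod_Cons jing_0_one)
  then have "jing_prod (xs @ replicate k 0) = jing_prod xs" for xs k
    by (induction xs) (simp_all add: jing_prod_Cons)
  then show ?thesis using map_pred_eq_peel[OF assms] by auto
qed

lemma is_partition_peel: "is_partition \<mu> \<Longrightarrow> is_partition (peel \<mu>)"
  by (induction \<mu>) (auto simp: peel_def is_partition_def)

text \<open>Once the number of rows is known, the removed first column can be restored.\<close>

lemma inj_on_peel: "inj_on peel {\<mu>. is_partition \<mu> \<and> length \<mu> = n}"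
proof (rule inj_onI)
  fix \<mu> \<nu>
  assume A: "\<mu> \<in> {\<mu>. is_partition \<mu> \<and> length \<mu> = n}" "\<nu> \<in> {\<mu>. is_partition \<mu> \<and> length \<mu> = n}"
    and eq: "peel \<mu> = peel \<nu>"
  obtain k l where k: "map (\<lambda>x. x - 1) \<mu> = peel \<mu> @ replicate k 0"
    and l: "map (\<lambda>x. x - 1) \<nu> = peel \<nu> @ replicate l 0"
    using map_pred_eq_peel A by blast
  have "length (peel \<mu> @ replicate k 0) = length (peel \<nu> @ replicate l 0)"
    using A by (simp flip: k l)
  then have "map (\<lambda>x. x - 1) \<mu> = map (\<lambda>x. x - 1) \<nu>"
    using k l eq by simp
  then have *: "map Suc (map (\<lambda>x. x - 1) \<mu>) = map Suc (map (\<lambda>x. x - 1) \<nu>)" by simp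
  have "map Suc (map (\<lambda>x. x - 1) \<kappa>) = \<kappa>" if "is_partition \<kappa>" for \<kappa>
    using that by (induction \<kappa>) (auto simp: is_partition_Cons)
  with * show "\<mu> = \<nu>" using A by auto
qed

lemma sum_list_peel: "is_partition \<mu> \<Longrightarrow> sum_list \<mu> = sum_list (peel \<mu>) + length \<mu>"
  by (induction \<mu>) (auto simp: peel_def is_partition_Cons)

lemma scal_eq_0_iff: "scal c = 0 \<longleftrightarrow> c = 0"
  by (metis lookup_single_eq lookup_zero scal_def single_zero)

text \<open>A polynomial with the \<open>Z j\<close> as coefficients would vanish at all natural
  numbers.\<close>

lemma scal_powers_independent:
  fixes Z :: "nat \<Rightarrow> sym"
  assumes "\<And>s. (\<Sum>j\<le>n. scal (s ^ j) * Z j) = 0" "j \<le> n"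
  shows "Z j = 0"
proof -
  define P where "P = (\<Sum>j\<le>n. monom (Z j) j)"
  have "poly P (scal s) = 0" for s
    using assms(1)[of s] by (simp add: P_def poly_sum poly_monom hom_power[OF is_ring_hom_scal] mult.commute)
  then have "range (\<lambda>k. scal (of_nat k)) \<subseteq> {x. poly P x = 0}" by auto
  moreover have "infinite (range (\<lambda>k. scal (of_nat k) :: sym))"
    unfolding hom_of_nat[OF is_ring_hom_scal] by (simp add: finite_image_iff inj_on_def)
  ultimately have "P = 0"
    using poly_roots_finite[of P] finite_subset by blast
  then have "coeff P j = 0" by simp
  then show ?thesis
    using assms(2) by (simp add: P_def coeff_sum)
qed

text \<open>The coefficient of the highest power of \<open>s\<close> in \<open>sub_var s (jing_prod \<mu>)\<close> removes the first column of \<open>\<mu>\<close>.\<close>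

lemma jing_prod_independent:
  assumes "finite U" "U \<subseteq> {\<mu>. is_partition \<mu>}" "(\<Sum>\<mu>\<in>U. scal (c \<mu>) * jing_prod \<mu>) = 0"
  shows "\<forall>\<mu>\<in>U. c \<mu> = 0"
  using assms
\<comment> \<open>The measure drops in both uses of the hypothesis: peeling removes boxes, and
  discarding \<open>V\<close> removes partitions. The \<open>Suc\<close> makes the empty partition
  count as well.\<close>
proof (induction "\<Sum>\<mu>\<in>U. Suc (sum_list \<mu>)" arbitrary: U c rule: less_induct)
  case less
  note fin = less.prems(1) and part = less.prems(2) and zero = less.prems(3)
  show ?case
  proof (cases "U = {}")
    case False
    define n where "n = Max (length ` U)"
    have len: "length \<mu> \<le> n" if "\<mu> \<in> U" for \<mu>
      using that fin by (simp add: n_def)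
    \<comment> \<open>Only the longest partitions contribute to the coefficient of
      \<open>s ^ n\<close>.\<close>
    define V where "V = {\<mu>\<in>U. length \<mu> = n}"
    have V: "V \<subseteq> U" "finite V" using fin by (auto simp: V_def)
    have "V \<noteq> {}"
    proof -
      have "n \<in> length ` U" unfolding n_def using fin False by (intro Max_in) auto
      then show ?thesis by (auto simp: V_def)
    qed
    define Z where "Z j = (\<Sum>\<mu>\<in>U. scal (c \<mu>) * sub_var_coeff \<mu> j)" for j
    have "(\<Sum>j\<le>n. scal (s ^ j) * Z j) = 0" for s
    proof -
      have "sub_var s (jing_prod \<mu>) = (\<Sum>j\<le>n. scal (s ^ j) * sub_var_coeff \<mu> j)" if "\<mu> \<in> U" for \<mu>
      proof -
        have "0 \<notin> set \<mu>" using part that by (auto simp: is_partition_def)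
        then have "sub_var s (jing_prod \<mu>) = (\<Sum>j\<le>length \<mu>. scal (s ^ j) * sub_var_coeff \<mu> j)"
          by (rule sub_var_jing_prod_eq_sub_var_coeff)
        also have "\<dots> = (\<Sum>j\<le>n. scal (s ^ j) * sub_var_coeff \<mu> j)"
          using len[OF that] by (intro sum.mono_neutral_left) (auto simp: sub_var_coeff_eq_0)
        finally show ?thesis .
      qed
      then have "sub_var s (\<Sum>\<mu>\<in>U. scal (c \<mu>) * jing_prod \<mu>) =
          (\<Sum>\<mu>\<in>U. \<Sum>j\<le>n. scal (s ^ j) * (scal (c \<mu>) * sub_var_coeff \<mu> j))"
        by (simp add: hom_simps[OF is_ring_hom_sub_var] sub_var_scal sum_distrib_left mult_ac)
      also have "\<dots> = (\<Sum>j\<le>n. scal (s ^ j) * Z j)"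
        unfolding Z_def sum_distrib_left by (rule sum.swap)
      finally show ?thesis using zero by (simp add: hom_zero[OF is_ring_hom_sub_var])
    qed
    then have "Z n = 0" by (rule scal_powers_independent) simp
    moreover have "Z n = (- 1) ^ n * (\<Sum>\<mu>\<in>V. scal (c \<mu>) * jing_prod (peel \<mu>))"
    proof -
      have "Z n = (\<Sum>\<mu>\<in>V. scal (c \<mu>) * sub_var_coeff \<mu> n)"
        unfolding Z_def V_def using fin len
        by (intro sum.mono_neutral_right) (force intro!: sub_var_coeff_eq_0 simp: le_less)+
      also have "\<dots> = (\<Sum>\<mu>\<in>V. (- 1) ^ n * (scal (c \<mu>) * jing_prod (peel \<mu>)))"
      proof (intro sum.cong refl)
        fix \<mu> assume "\<mu> \<in> V"
        then have "length \<mu> = n" "is_partition \<mu>" using part by (auto simp: V_def)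
        then show "scal (c \<mu>) * sub_var_coeff \<mu> n = (- 1) ^ n * (scal (c \<mu>) * jing_prod (peel \<mu>))"
          using sub_var_coeff_length[of \<mu>] by (simp add: jing_prod_map_pred[unfolded One_nat_def] mult_ac)
      qed
      finally show ?thesis by (simp add: sum_distrib_left)
    qed
    ultimately have peel0: "(\<Sum>\<mu>\<in>V. scal (c \<mu>) * jing_prod (peel \<mu>)) = 0" by simp
    have cV: "\<forall>\<mu>\<in>V. c \<mu> = 0"
    \<comment> \<open>Peeling leaves the empty partition unchanged, so the induction hypothesis does
      not cover this case.\<close>
    proof (cases "n = 0")
      case True
      then have "V \<subseteq> {[]}" by (auto simp: V_def)
      then have "V = {[]}" using \<open>V \<noteq> {}\<close> by auto
      then show ?thesis using peel0 by (simp add: peel_def scal_eq_0_iff)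
    next
      case False
      have inj: "inj_on peel V"
        by (rule inj_on_subset[OF inj_on_peel[of n]]) (use part in \<open>auto simp: V_def\<close>)
      define d where "d \<nu> = c (the_inv_into V peel \<nu>)" for \<nu>
      have d: "d (peel \<mu>) = c \<mu>" if "\<mu> \<in> V" for \<mu>
        by (simp add: d_def the_inv_into_f_f[OF inj that])
      have "(\<Sum>\<nu>\<in>peel ` V. Suc (sum_list \<nu>)) = (\<Sum>\<mu>\<in>V. Suc (sum_list (peel \<mu>)))"
        by (simp add: sum.reindex[OF inj])
      also have "\<dots> < (\<Sum>\<mu>\<in>V. Suc (sum_list \<mu>))"
        using V \<open>V \<noteq> {}\<close> False part sum_list_peel
        by (intro sum_strict_mono) (auto simp: V_def)
      also have "\<dots> \<le> (\<Sum>\<mu>\<in>U. Suc (sum_list \<mu>))"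
        using V fin by (intro sum_mono2) auto
      finally have less': "(\<Sum>\<nu>\<in>peel ` V. Suc (sum_list \<nu>)) < (\<Sum>\<mu>\<in>U. Suc (sum_list \<mu>))" .
      have "\<forall>\<nu>\<in>peel ` V. d \<nu> = 0"
      proof (rule less.hyps[OF less'])
        show "finite (peel ` V)" using V by simp
        show "peel ` V \<subseteq> {\<mu>. is_partition \<mu>}"
          using part V is_partition_peel by auto
        show "(\<Sum>\<nu>\<in>peel ` V. scal (d \<nu>) * jing_prod \<nu>) = 0"
          using peel0 by (simp add: sum.reindex[OF inj] d)
      qed
      then show ?thesis using d by auto
    qed
    have "\<forall>\<mu>\<in>U - V. c \<mu> = 0"
    proof (rule less.hyps)
      show "(\<Sum>\<mu>\<in>U - V. Suc (sum_list \<mu>)) < (\<Sum>\<mu>\<in>U. Suc (sum_list \<mu>))"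
      proof -
        obtain v where "v \<in> V" using \<open>V \<noteq> {}\<close> by blast
        then show ?thesis
          using V fin by (intro sum_strict_mono2[where b = v]) auto
      qed
      show "(\<Sum>\<mu>\<in>U - V. scal (c \<mu>) * jing_prod \<mu>) = 0"
        using zero cV V fin sum.subset_diff[OF V(1) fin, of "\<lambda>\<mu>. scal (c \<mu>) * jing_prod \<mu>"]
        by (simp add: hom_zero[OF is_ring_hom_scal])
    qed (use fin part in auto)
    then show ?thesis using cV by blast
  qed simp
qed

section \<open>The span of the functions Q'\<close>

definition jing_prod_comb :: "(nat list \<Rightarrow> rat fps) \<Rightarrow> sym" where
  "jing_prod_comb c = (\<Sum>\<mu> | c \<mu> \<noteq> 0. scal (c \<mu>) * jing_prod \<mu>)"

definition fin_part :: "(nat list \<Rightarrow> 'a::zero) \<Rightarrow> bool" where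
  "fin_part c \<longleftrightarrow> finite {\<mu>. c \<mu> \<noteq> 0} \<and> (\<forall>\<mu>. c \<mu> \<noteq> 0 \<longrightarrow> is_partition \<mu>)"

lemma jing_prod_comb_superset:
  "finite U \<Longrightarrow> (\<And>\<mu>. c \<mu> \<noteq> 0 \<Longrightarrow> \<mu> \<in> U) \<Longrightarrow> jing_prod_comb c = (\<Sum>\<mu>\<in>U. scal (c \<mu>) * jing_prod \<mu>)"
  unfolding jing_prod_comb_def
  by (intro sum.mono_neutral_left) (auto simp: hom_zero[OF is_ring_hom_scal])

lemma jing_prod_comb_inject:
  assumes "fin_part c" "fin_part d" "jing_prod_comb c = jing_prod_comb d"
  shows "c = d"
proof
  fix \<mu>
  let ?U = "{\<mu>. c \<mu> \<noteq> 0} \<union> {\<mu>. d \<mu> \<noteq> 0}"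
  have U: "finite ?U" "?U \<subseteq> {\<mu>. is_partition \<mu>}"
    using assms(1,2) by (auto simp: fin_part_def)
  have "jing_prod_comb c = (\<Sum>\<mu>\<in>?U. scal (c \<mu>) * jing_prod \<mu>)" "jing_prod_comb d = (\<Sum>\<mu>\<in>?U. scal (d \<mu>) * jing_prod \<mu>)"
    by (rule jing_prod_comb_superset[OF U(1)], simp)+
  then have "(\<Sum>\<mu>\<in>?U. scal (c \<mu> - d \<mu>) * jing_prod \<mu>) = jing_prod_comb c - jing_prod_comb d"
    by (simp only: hom_diff[OF is_ring_hom_scal] left_diff_distrib sum_subtractf)
  then have "(\<Sum>\<mu>\<in>?U. scal (c \<mu> - d \<mu>) * jing_prod \<mu>) = 0"
    unfolding assms(3) by simp
  note zero = jing_prod_independent[OF U this]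
  show "c \<mu> = d \<mu>"
  proof (cases "\<mu> \<in> ?U")
    case True
    from bspec[OF zero this] show ?thesis by simp
  qed simp
qed

lemma fin_part_add:
  fixes c d :: "nat list \<Rightarrow> 'a::monoid_add"
  assumes "fin_part c" "fin_part d"
  shows "fin_part (\<lambda>\<mu>. c \<mu> + d \<mu>)"
proof -
  have sub: "c \<mu> \<noteq> 0 \<or> d \<mu> \<noteq> 0" if "c \<mu> + d \<mu> \<noteq> 0" for \<mu>
    using that by auto
  then have "{\<mu>. c \<mu> + d \<mu> \<noteq> 0} \<subseteq> {\<mu>. c \<mu> \<noteq> 0} \<union> {\<mu>. d \<mu> \<noteq> 0}"
    by blast
  then have "finite {\<mu>. c \<mu> + d \<mu> \<noteq> 0}"
    using assms unfolding fin_part_def by (meson finite_UnI finite_subset)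
  then show ?thesis
    using assms sub unfolding fin_part_def by blast
qed

definition jing_prod_span :: "sym set" where
  "jing_prod_span = {jing_prod_comb c | c. fin_part c}"

lemma jing_prod_span_add: "f \<in> jing_prod_span \<Longrightarrow> g \<in> jing_prod_span \<Longrightarrow> f + g \<in> jing_prod_span"
proof -
  assume "f \<in> jing_prod_span" "g \<in> jing_prod_span"
  then obtain c d where cd: "f = jing_prod_comb c" "fin_part c" "g = jing_prod_comb d" "fin_part d"
    by (auto simp: jing_prod_span_def)
  let ?U = "{\<mu>. c \<mu> \<noteq> 0} \<union> {\<mu>. d \<mu> \<noteq> 0}"
  have U: "finite ?U" using cd by (auto simp: fin_part_def)
  have "jing_prod_comb c = (\<Sum>\<mu>\<in>?U. scal (c \<mu>) * jing_prod \<mu>)" "jing_prod_comb d = (\<Sum>\<mu>\<in>?U. scal (d \<mu>) * jing_prod \<mu>)"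
    by (rule jing_prod_comb_superset[OF U], simp)+
  moreover have "jing_prod_comb (\<lambda>\<mu>. c \<mu> + d \<mu>) = (\<Sum>\<mu>\<in>?U. scal (c \<mu> + d \<mu>) * jing_prod \<mu>)"
    by (rule jing_prod_comb_superset[OF U]) auto
  ultimately have "f + g = jing_prod_comb (\<lambda>\<mu>. c \<mu> + d \<mu>)"
    using cd(1,3) by (simp only: hom_add[OF is_ring_hom_scal] distrib_right sum.distrib)
  then show ?thesis using cd fin_part_add unfolding jing_prod_span_def by blast
qed

lemma jing_prod_span_scal: "f \<in> jing_prod_span \<Longrightarrow> scal q * f \<in> jing_prod_span"
proof -
  assume "f \<in> jing_prod_span"
  then obtain c where c: "f = jing_prod_comb c" "fin_part c" by (auto simp: jing_prod_span_def)
  have fin: "finite {\<mu>. c \<mu> \<noteq> 0}" using c by (simp add: fin_part_def)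
  have "scal q * f = jing_prod_comb (\<lambda>\<mu>. q * c \<mu>)"
    using c(1) fin jing_prod_comb_superset[of "{\<mu>. c \<mu> \<noteq> 0}" "\<lambda>\<mu>. q * c \<mu>"]
    by (simp add: jing_prod_comb_def sum_distrib_left hom_mult[OF is_ring_hom_scal] mult.assoc)
  moreover have "fin_part (\<lambda>\<mu>. q * c \<mu>)"
    using c(2) finite_subset[OF _ fin, of "{\<mu>. q * c \<mu> \<noteq> 0}"] by (auto simp: fin_part_def)
  ultimately show ?thesis unfolding jing_prod_span_def by blast
qed

lemma jing_prod_span_zero: "0 \<in> jing_prod_span"
  unfolding jing_prod_span_def
  by (rule CollectI, rule exI[of _ "\<lambda>_. 0"]) (simp add: jing_prod_comb_def fin_part_def)

lemma jing_prod_in_span: "is_partition \<mu> \<Longrightarrow> jing_prod \<mu> \<in> jing_prod_span"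
  unfolding jing_prod_span_def
  by (rule CollectI, rule exI[of _ "\<lambda>\<nu>. if \<nu> = \<mu> then 1 else 0"])
    (simp add: jing_prod_comb_def fin_part_def hom_one[OF is_ring_hom_scal])

lemma jing_prod_span_sum: "(\<And>i. i \<in> A \<Longrightarrow> f i \<in> jing_prod_span) \<Longrightarrow> sum f A \<in> jing_prod_span"
  by (induction A rule: infinite_finite_induct) (auto intro: jing_prod_span_zero jing_prod_span_add)

lemma jing_prod_span_sub_var_plus:
  assumes "f \<in> jing_prod_span"
  shows "add_var s f \<in> jing_prod_span"
proof -
  obtain c where c: "f = jing_prod_comb c" "fin_part c" using assms by (auto simp: jing_prod_span_def)
  have "scal (c \<mu>) * add_var s (jing_prod \<mu>) \<in> jing_prod_span" if "c \<mu> \<noteq> 0" for \<mu>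
  proof -
    have "is_partition \<mu>" using c(2) that by (simp add: fin_part_def)
    then show ?thesis
      by (auto simp: add_var_jing_prod intro!: jing_prod_span_scal jing_prod_span_sum jing_prod_in_span)
  qed
  moreover have "add_var s (scal a) = scal a" for a
    by (simp add: add_var_def eval_at_scal)
  ultimately show ?thesis
    unfolding c(1) jing_prod_comb_def by (auto simp: hom_simps[OF is_ring_hom_sub_var_plus] intro!: jing_prod_span_sum)
qed

lemma shift_in_jing_prod_span:
  assumes "f \<in> jing_prod_span"
  shows "eval_at f (\<lambda>k. psum k + scal (fps_const (psum_list k rs))) \<in> jing_prod_span"
  using assms
proof (induction rs arbitrary: f)
  case Nil
  then show ?case
    by (simp add: psum_list_def hom_zero[OF is_ring_hom_scal] eval_at_psum_id)
next
  case (Cons r rs)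
  have "eval_at f (\<lambda>k. psum k + scal (fps_const (psum_list k (r # rs)))) =
      eval_at (add_var (fps_const r) f) (\<lambda>k. psum k + scal (fps_const (psum_list k rs)))"
    unfolding add_var_def eval_at_eval_at
  proof (rule eval_at_cong)
    fix k :: nat assume k: "k \<ge> 1"
    have "scal (fps_const (psum_list k (r # rs))) = scal (fps_const r ^ k) + (scal (fps_const (psum_list k rs)) :: sym)"
      by (simp only: psum_list_def list.map sum_list.Cons hom_add[OF is_ring_hom_fps_const]
          hom_power[OF is_ring_hom_fps_const] hom_add[OF is_ring_hom_scal])
    then show "psum k + scal (fps_const (psum_list k (r # rs))) =
        eval_at (psum k + scal (fps_const r ^ k)) (\<lambda>k. psum k + scal (fps_const (psum_list k rs)))"
      using k by (simp only: hom_add[OF is_ring_hom_eval_at] eval_at_scal eval_at_psum add_ac)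
  qed
  then show ?case using Cons jing_prod_span_sub_var_plus by simp
qed

section \<open>Skew functions and the theorem\<close>

text \<open>The tensor square of the ring of symmetric functions inside the polynomial ring of both
  alphabets. Its closure under products shows that a function of X + Y is a finite sum of products,
  without a formula for the coproduct.\<close>

inductive_set tensors :: "((nat + nat \<Rightarrow>\<^sub>0 nat) \<Rightarrow>\<^sub>0 rat fps) set" where
  pure: "eval_at a pX * eval_at b pY \<in> tensors"
| add: "x \<in> tensors \<Longrightarrow> y \<in> tensors \<Longrightarrow> x + y \<in> tensors"

lemma tensors_mult:
  assumes "x \<in> tensors" "y \<in> tensors"
  shows "x * y \<in> tensors"
  using assms(1)
proof induction
  case (pure a b)
  show ?case using assms(2)
  proof induction
    case (pure c d)
    have "eval_at a pX * eval_at b pY * (eval_at c pX * eval_at d pY) =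
        eval_at (a * c) pX * eval_at (b * d) pY"
      by (simp add: hom_mult[OF is_ring_hom_eval_at] mult_ac)
    then show ?case by (simp only: tensors.pure)
  next
    case (add x y)
    then show ?case by (simp only: distrib_left tensors.add)
  qed
next
  case (add x y)
  then show ?case by (simp only: distrib_right tensors.add)
qed

lemma eval_sum_alphabets_in_tensors: "eval_at f (\<lambda>i. pX i + pY i) \<in> tensors"
proof (induction f rule: poly_induct)
  case (scal c)
  have "eval_at (scal c) (\<lambda>i. pX i + pY i) = eval_at (scal c) pX * eval_at 1 pY"
    by (simp add: eval_at_scal hom_one[OF is_ring_hom_eval_at])
  then show ?case by (simp only: tensors.pure)
next
  case (indet k)
  have "eval_at (indet k) (\<lambda>i. pX i + pY i) =
      eval_at (psum (Suc k)) pX * eval_at 1 pY + eval_at 1 pX * eval_at (psum (Suc k)) pY"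
    by (simp add: indet_eq_psum eval_at_psum hom_one[OF is_ring_hom_eval_at])
  then show ?case by (simp only: tensors.pure tensors.add)
next
  case (add f g)
  then show ?case by (simp only: hom_add[OF is_ring_hom_eval_at] tensors.add)
next
  case (mult f g)
  then show ?case by (simp only: hom_mult[OF is_ring_hom_eval_at] tensors_mult)
qed

lemma tensors_expand:
  assumes "x \<in> tensors"
  shows "\<exists>S g. finite S \<and> (\<forall>m. m \<notin> S \<longrightarrow> g m = 0) \<and>
    x = (\<Sum>m\<in>S. mon_val (\<lambda>k. pX (Suc k)) m * eval_at (g m) pY)"
  using assms
proof induction
  case (pure a b)
  let ?g = "\<lambda>m. scal (Poly_Mapping.lookup a m) * b"
  have "eval_at a pX * eval_at b pY =
      (\<Sum>m\<in>Poly_Mapping.keys a. mon_val (\<lambda>k. pX (Suc k)) m * eval_at (?g m) pY)"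
    unfolding eval_at_def[of a] eval_with_eq_peval peval_def
    by (simp add: eval_at_simps sum_distrib_left mult_ac)
  moreover have "\<forall>m. m \<notin> Poly_Mapping.keys a \<longrightarrow> ?g m = 0"
    by (simp add: in_keys_iff hom_zero[OF is_ring_hom_scal])
  ultimately show ?case
    by (intro exI[of _ "Poly_Mapping.keys a"] exI[of _ ?g] conjI finite_keys)
next
  case (add x y)
  then obtain S g S' g' where S: "finite S" "\<forall>m. m \<notin> S \<longrightarrow> g m = 0"
      "x = (\<Sum>m\<in>S. mon_val (\<lambda>k. pX (Suc k)) m * eval_at (g m) pY)"
    and S': "finite S'" "\<forall>m. m \<notin> S' \<longrightarrow> g' m = 0"
      "y = (\<Sum>m\<in>S'. mon_val (\<lambda>k. pX (Suc k)) m * eval_at (g' m) pY)"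
    by blast
  let ?U = "S \<union> S'"
  have "x = (\<Sum>m\<in>?U. mon_val (\<lambda>k. pX (Suc k)) m * eval_at (g m) pY)"
    unfolding S(3) using S S' by (intro sum.mono_neutral_left) (auto simp: eval_at_simps)
  moreover have "y = (\<Sum>m\<in>?U. mon_val (\<lambda>k. pX (Suc k)) m * eval_at (g' m) pY)"
    unfolding S'(3) using S S' by (intro sum.mono_neutral_left) (auto simp: eval_at_simps)
  ultimately have "x + y = (\<Sum>m\<in>?U. mon_val (\<lambda>k. pX (Suc k)) m * eval_at (g m + g' m) pY)"
    by (simp only: hom_add[OF is_ring_hom_eval_at] distrib_left sum.distrib)
  moreover have "\<forall>m. m \<notin> ?U \<longrightarrow> g m + g' m = 0" "finite ?U" using S S' by auto
  ultimately show ?case by (intro exI[of _ ?U] exI[of _ "\<lambda>m. g m + g' m"] conjI)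
qed

text \<open>X becomes the numerical alphabet with power sums \<open>a\<close> and Y becomes the
  generic one. An identity in X + Y turns into an expansion of a translated symmetric
  function.\<close>

definition specialize :: "(nat \<Rightarrow> rat fps) \<Rightarrow> ((nat + nat \<Rightarrow>\<^sub>0 nat) \<Rightarrow>\<^sub>0 rat fps) \<Rightarrow> sym" where
  "specialize a = peval scal (case_sum (\<lambda>k. scal (a (Suc k))) indet)"

lemma is_ring_hom_specialize: "is_ring_hom (specialize a)"
  unfolding specialize_def by (rule is_ring_hom_peval[OF is_ring_hom_scal])

lemma specialize_scal: "specialize a (scal c) = scal c"
  by (simp add: specialize_def peval_scal is_ring_hom_scal)

lemma specialize_pX: "k \<ge> 1 \<Longrightarrow> specialize a (pX k) = scal (a k)"
  by (simp add: specialize_def pX_def peval_indet is_ring_hom_scal)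

lemma specialize_pY: "specialize a (pY k) = psum k"
  by (simp add: specialize_def pY_def peval_indet is_ring_hom_scal psum_def)

lemma specialize_eval_at: "specialize a (eval_at f X) = eval_at f (\<lambda>k. specialize a (X k))"
  unfolding eval_at_def hom_eval_with[OF is_ring_hom_specialize] specialize_scal ..

lemma specialize_eval_pX: "specialize a (eval_at f pX) = scal (eval_with (\<lambda>c. c) f a)"
proof -
  have "specialize a (eval_at f pX) = eval_at f (\<lambda>k. scal (a k))"
    unfolding specialize_eval_at by (rule eval_at_cong) (rule specialize_pX)
  also have "\<dots> = scal (eval_with (\<lambda>c. c) f a)"
    unfolding eval_at_def hom_eval_with[OF is_ring_hom_scal] ..
  finally show ?thesis .
qed

lemma specialize_eval_pY: "specialize a (eval_at f pY) = f"
  unfolding specialize_eval_at specialize_pY by (rule eval_at_psum_id)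

lemma specialize_eval_sum:
  "specialize a (eval_at f (\<lambda>i. pX i + pY i)) = eval_at f (\<lambda>k. psum k + scal (a k))"
  unfolding specialize_eval_at
  by (rule eval_at_cong) (simp add: hom_add[OF is_ring_hom_specialize] specialize_pX specialize_pY add.commute)

section \<open>Existence and uniqueness of the skew expansion\<close>

definition is_skew_expansion :: "nat list \<Rightarrow> (nat list \<Rightarrow> sym) \<Rightarrow> bool" where
  "is_skew_expansion \<kappa> F \<longleftrightarrow> fin_part F \<and>
    eval_at (jing_prod \<kappa>) (\<lambda>i. pX i + pY i) = (\<Sum>\<mu> | F \<mu> \<noteq> 0. eval_at (F \<mu>) pX * eval_at (jing_prod \<mu>) pY)"

lemma specialize_skew_expansion:
  assumes "is_skew_expansion \<kappa> F"
  shows "eval_at (jing_prod \<kappa>) (\<lambda>k. psum k + scal (a k)) = jing_prod_comb (\<lambda>\<mu>. eval_with (\<lambda>c. c) (F \<mu>) a)"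
    and "fin_part (\<lambda>\<mu>. eval_with (\<lambda>c. c) (F \<mu>) a)"
proof -
  have F: "finite {\<mu>. F \<mu> \<noteq> 0}" "\<And>\<mu>. F \<mu> \<noteq> 0 \<Longrightarrow> is_partition \<mu>"
    "eval_at (jing_prod \<kappa>) (\<lambda>i. pX i + pY i) = (\<Sum>\<mu> | F \<mu> \<noteq> 0. eval_at (F \<mu>) pX * eval_at (jing_prod \<mu>) pY)"
    using assms unfolding is_skew_expansion_def fin_part_def by blast+
  have nz: "F \<mu> \<noteq> 0" if "eval_with (\<lambda>c. c) (F \<mu>) a \<noteq> 0" for \<mu>
  proof
    assume "F \<mu> = 0"
    then show False
      using that by (simp add: hom_zero[OF is_ring_hom_eval_with[OF is_ring_hom_id]])
  qed
  have "finite {\<mu>. eval_with (\<lambda>c. c) (F \<mu>) a \<noteq> 0}"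
    by (rule finite_subset[OF _ F(1)]) (intro Collect_mono impI nz)
  then show "fin_part (\<lambda>\<mu>. eval_with (\<lambda>c. c) (F \<mu>) a)"
    unfolding fin_part_def by (intro conjI allI impI F(2) nz)
  have "eval_at (jing_prod \<kappa>) (\<lambda>k. psum k + scal (a k)) =
      (\<Sum>\<mu> | F \<mu> \<noteq> 0. scal (eval_with (\<lambda>c. c) (F \<mu>) a) * jing_prod \<mu>)"
    unfolding specialize_eval_sum[symmetric] F(3)
    by (simp only: hom_sum[OF is_ring_hom_specialize] hom_mult[OF is_ring_hom_specialize] specialize_eval_pX specialize_eval_pY)
  also have "\<dots> = jing_prod_comb (\<lambda>\<mu>. eval_with (\<lambda>c. c) (F \<mu>) a)"
    by (rule jing_prod_comb_superset[symmetric, OF F(1)]) (intro CollectI nz)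
  finally show "eval_at (jing_prod \<kappa>) (\<lambda>k. psum k + scal (a k)) = jing_prod_comb (\<lambda>\<mu>. eval_with (\<lambda>c. c) (F \<mu>) a)" .
qed

text \<open>With X specialized to a rational alphabet, linear independence forces the coefficients
  to have equal values, and such values determine a symmetric function.\<close>

lemma skew_expansion_unique:
  assumes "is_skew_expansion \<kappa> F" "is_skew_expansion \<kappa> F'"
  shows "F = F'"
proof
  fix \<mu>
  show "F \<mu> = F' \<mu>"
  proof (rule sym_eqI)
    fix rs
    let ?a = "\<lambda>k. fps_const (psum_list k rs)"
    note F = specialize_skew_expansion[OF assms(1), of ?a] and F' = specialize_skew_expansion[OF assms(2), of ?a]
    have "(\<lambda>\<mu>. eval_with (\<lambda>c. c) (F \<mu>) ?a) = (\<lambda>\<mu>. eval_with (\<lambda>c. c) (F' \<mu>) ?a)"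
      by (rule jing_prod_comb_inject[OF F(2) F'(2) trans[OF F(1)[symmetric] F'(1)]])
    then show "eval_with (\<lambda>c. c) (F \<mu>) ?a = eval_with (\<lambda>c. c) (F' \<mu>) ?a"
      by (rule fun_cong)
  qed
qed

text \<open>The factors \<open>g m\<close>, which accompany the monomials in the power sums of X,
  need not lie in the span for an obvious reason. Each rational specialization of X puts one
  combination of them there, and density isolates the individual \<open>g m\<close>.\<close>

lemma skew_expansion_exists:
  assumes "is_partition \<kappa>"
  shows "\<exists>F. is_skew_expansion \<kappa> F"
proof -
  let ?mX = "mon_val (\<lambda>k. pX (Suc k))"
  obtain S g where S: "finite S"
    and eq: "eval_at (jing_prod \<kappa>) (\<lambda>i. pX i + pY i) = (\<Sum>m\<in>S. ?mX m * eval_at (g m) pY)"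
    using tensors_expand[OF eval_sum_alphabets_in_tensors[of "jing_prod \<kappa>"]]
    by (elim exE conjE) (rule that)
  let ?\<psi> = "\<lambda>q. scal (fps_const q) :: sym"
  have \<psi>: "is_ring_hom ?\<psi>"
    by (rule is_ring_hom_comp[OF is_ring_hom_scal is_ring_hom_fps_const])
  have sub: "rat_subspace ?\<psi> jing_prod_span"
    by (auto simp: rat_subspace_def intro: jing_prod_span_zero jing_prod_span_add jing_prod_span_scal)
  have "(\<Sum>m\<in>S. ?\<psi> (mon_val (\<lambda>k. psum_list (Suc k) rs) m) * g m) \<in> jing_prod_span" for rs
  proof -
    let ?a = "\<lambda>k. fps_const (psum_list k rs)"
    have mX: "specialize ?a (?mX m) = ?\<psi> (mon_val (\<lambda>k. psum_list (Suc k) rs) m)" for m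
      unfolding hom_mon_val[OF is_ring_hom_specialize] hom_mon_val[OF \<psi>] by (simp add: specialize_pX)
    have "(\<Sum>m\<in>S. ?\<psi> (mon_val (\<lambda>k. psum_list (Suc k) rs) m) * g m) =
        specialize ?a (eval_at (jing_prod \<kappa>) (\<lambda>i. pX i + pY i))"
      unfolding eq by (simp only: hom_sum[OF is_ring_hom_specialize] hom_mult[OF is_ring_hom_specialize] mX specialize_eval_pY)
    also have "\<dots> = eval_at (jing_prod \<kappa>) (\<lambda>k. psum k + scal (fps_const (psum_list k rs)))"
      by (rule specialize_eval_sum)
    also have "\<dots> \<in> jing_prod_span"
      by (intro shift_in_jing_prod_span jing_prod_in_span assms)
    finally show ?thesis .
  qed
  then have "g m \<in> jing_prod_span" if "m \<in> S" for m
    using that by (rule power_sums_dense[OF \<psi> sub S])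
  then have "\<forall>m\<in>S. \<exists>c. fin_part c \<and> g m = jing_prod_comb c"
    unfolding jing_prod_span_def by blast
  then obtain c where c: "\<And>m. m \<in> S \<Longrightarrow> fin_part (c m)" "\<And>m. m \<in> S \<Longrightarrow> g m = jing_prod_comb (c m)"
    by metis
  define U where "U = (\<Union>m\<in>S. {\<mu>. c m \<mu> \<noteq> 0})"
  have U: "finite U" "U \<subseteq> {\<mu>. is_partition \<mu>}"
    using c(1) S by (auto simp: U_def fin_part_def)
  \<comment> \<open>Expanding each \<open>g m\<close> and exchanging the sums collects the
    coefficient of \<open>jing_prod \<mu>\<close>, now as a symmetric function of X.\<close>
  define F where "F \<mu> = (\<Sum>m\<in>S. scal (c m \<mu>) * mon_val indet m)" for \<mu>
  have F: "\<mu> \<in> U" if "F \<mu> \<noteq> 0" for \<mu>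
  proof (rule ccontr)
    assume "\<mu> \<notin> U"
    then have "c m \<mu> = 0" if "m \<in> S" for m
      using that by (auto simp: U_def)
    then have "F \<mu> = 0"
      unfolding F_def by (intro sum.neutral) (simp add: hom_zero[OF is_ring_hom_scal])
    then show False using that by simp
  qed
  have gm: "g m = (\<Sum>\<mu>\<in>U. scal (c m \<mu>) * jing_prod \<mu>)" if "m \<in> S" for m
    unfolding c(2)[OF that] using that by (intro jing_prod_comb_superset U) (auto simp: U_def)
  have FX: "eval_at (F \<mu>) pX = (\<Sum>m\<in>S. scal (c m \<mu>) * ?mX m)" for \<mu>
    unfolding F_def
    by (simp only: hom_sum[OF is_ring_hom_eval_at] hom_mult[OF is_ring_hom_eval_at] eval_at_scal
        hom_mon_val[OF is_ring_hom_eval_at] indet_eq_psum) (simp add: eval_at_psum)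
  have "eval_at (jing_prod \<kappa>) (\<lambda>i. pX i + pY i) =
      (\<Sum>m\<in>S. \<Sum>\<mu>\<in>U. scal (c m \<mu>) * ?mX m * eval_at (jing_prod \<mu>) pY)"
    unfolding eq
    by (intro sum.cong refl)
      (simp add: gm hom_sum[OF is_ring_hom_eval_at] hom_mult[OF is_ring_hom_eval_at] eval_at_scal
        sum_distrib_left mult_ac)
  also have "\<dots> = (\<Sum>\<mu>\<in>U. eval_at (F \<mu>) pX * eval_at (jing_prod \<mu>) pY)"
    unfolding FX sum_distrib_right by (rule sum.swap)
  also have "\<dots> = (\<Sum>\<mu> | F \<mu> \<noteq> 0. eval_at (F \<mu>) pX * eval_at (jing_prod \<mu>) pY)"
    using F U by (intro sum.mono_neutral_right) (auto simp: hom_zero[OF is_ring_hom_eval_at])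
  finally have "is_skew_expansion \<kappa> F"
    using F U finite_subset[of "{\<mu>. F \<mu> \<noteq> 0}" U]
    unfolding is_skew_expansion_def fin_part_def by blast
  then show ?thesis by blast
qed

lemma is_partition_nonzero: "is_partition \<kappa> \<Longrightarrow> 0 \<notin> set \<kappa>"
  by (simp add: is_partition_def)

lemma skew_expansion_HL_Q'_skew:
  assumes "is_partition \<kappa>"
  shows "is_skew_expansion \<kappa> (HL_Q'_skew \<kappa>)"
proof -
  have iff: "finite {\<mu>. F \<mu> \<noteq> 0} \<and> (\<forall>\<mu>. F \<mu> \<noteq> 0 \<longrightarrow> is_partition \<mu>) \<and>
     eval_at (HL_Q' \<kappa>) (\<lambda>i. pX i + pY i) =
       (\<Sum>\<mu> | F \<mu> \<noteq> 0. eval_at (F \<mu>) pX * eval_at (HL_Q' \<mu>) pY) \<longleftrightarrow> is_skew_expansion \<kappa> F" for F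
  proof -
    have eq: "(\<Sum>\<mu> | F \<mu> \<noteq> 0. eval_at (F \<mu>) pX * eval_at (HL_Q' \<mu>) pY) =
        (\<Sum>\<mu> | F \<mu> \<noteq> 0. eval_at (F \<mu>) pX * eval_at (jing_prod \<mu>) pY)"
      if "\<forall>\<mu>. F \<mu> \<noteq> 0 \<longrightarrow> is_partition \<mu>"
      using that by (intro sum.cong refl) (simp add: HL_Q'_eq_jing_prod is_partition_nonzero)
    show ?thesis
    proof (cases "\<forall>\<mu>. F \<mu> \<noteq> 0 \<longrightarrow> is_partition \<mu>")
      case True
      show ?thesis
        unfolding is_skew_expansion_def fin_part_def conj_assoc eq[OF True]
          HL_Q'_eq_jing_prod[OF is_partition_nonzero[OF assms]] ..
    next
      case False
      then show ?thesis unfolding is_skew_expansion_def fin_part_def by blast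
    qed
  qed
  obtain F where F: "is_skew_expansion \<kappa> F"
    using skew_expansion_exists[OF assms] ..
  have "HL_Q'_skew \<kappa> = F"
    unfolding HL_Q'_skew_def iff
    by (rule the_equality) (use F skew_expansion_unique in blast)+
  then show ?thesis using F by simp
qed

theorem theorem1:
  fixes \<kappa> :: "nat list" and X :: "nat \<Rightarrow> ('m::comm_monoid_add \<Rightarrow>\<^sub>0 rat fps)"
  assumes "is_partition \<kappa>"
  shows "eval_at (HL_Q' \<kappa>) (\<lambda>i. X i + 1) =
           (\<Sum>\<mu> | is_partition \<mu> \<and> diagram_subset \<mu> \<kappa>. eval_at (HL_Q' \<mu>) X * scal (aleph \<kappa> \<mu>))
       \<and> (\<forall>\<mu>. is_partition \<mu> \<and> diagram_subset \<mu> \<kappa> \<longrightarrow> eval_one (HL_Q'_skew \<kappa> \<mu>) = aleph \<kappa> \<mu>)"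
proof
  have Q: "HL_Q' \<mu> = jing_prod \<mu>" if "is_partition \<mu>" for \<mu>
    using that by (simp add: HL_Q'_eq_jing_prod is_partition_nonzero)
  let ?below = "{\<mu>. is_partition \<mu> \<and> diagram_subset \<mu> \<kappa>}"
  have univ: "add_var 1 (jing_prod \<kappa>) = (\<Sum>\<mu>\<in>?below. scal (aleph \<kappa> \<mu>) * jing_prod \<mu>)"
    using add_var_jing_prod[OF assms, of 1] by simp
  have "eval_at (HL_Q' \<kappa>) (\<lambda>i. X i + 1) = eval_at (add_var 1 (jing_prod \<kappa>)) X"
    unfolding Q[OF assms] add_var_def eval_at_eval_at
    by (rule eval_at_cong) (simp add: eval_at_simps hom_one[OF is_ring_hom_scal])
  also have "\<dots> = (\<Sum>\<mu>\<in>?below. eval_at (HL_Q' \<mu>) X * scal (aleph \<kappa> \<mu>))"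
    unfolding univ hom_sum[OF is_ring_hom_eval_at]
    by (intro sum.cong refl) (simp add: eval_at_simps Q mult.commute)
  finally show "eval_at (HL_Q' \<kappa>) (\<lambda>i. X i + 1) =
      (\<Sum>\<mu>\<in>?below. eval_at (HL_Q' \<mu>) X * scal (aleph \<kappa> \<mu>))" .
  \<comment> \<open>The alphabet 1 has all power sums equal to 1. The specialized skew expansion and
    the expansion over the partitions below \<open>\<kappa>\<close> are two expansions of the same
    function in independent functions, so their coefficients agree.\<close>
  note skew = specialize_skew_expansion[OF skew_expansion_HL_Q'_skew[OF assms], of "\<lambda>_. 1"]
  define c where "c \<mu> = (if \<mu> \<in> ?below then aleph \<kappa> \<mu> else 0)" for \<mu>
  have "finite {\<mu>. c \<mu> \<noteq> 0}"
    by (rule finite_subset[OF _ finite_partitions_below[OF assms]]) (auto simp: c_def)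
  then have fin: "fin_part c" by (auto simp: fin_part_def c_def)
  have "add_var 1 (jing_prod \<kappa>) = jing_prod_comb c"
    unfolding univ
    by (subst jing_prod_comb_superset[OF finite_partitions_below[OF assms]]) (auto simp: c_def split: if_splits)
  moreover have "add_var 1 (jing_prod \<kappa>) = jing_prod_comb (\<lambda>\<mu>. eval_with (\<lambda>c. c) (HL_Q'_skew \<kappa> \<mu>) (\<lambda>_. 1))"
    using skew(1) by (simp add: add_var_def)
  ultimately have "(\<lambda>\<mu>. eval_one (HL_Q'_skew \<kappa> \<mu>)) = c"
    unfolding eval_one_def by (intro jing_prod_comb_inject[OF skew(2) fin]) (rule trans[OF sym])
  then have "eval_one (HL_Q'_skew \<kappa> \<mu>) = c \<mu>" for \<mu>
    by (rule fun_cong)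
  then show "\<forall>\<mu>. is_partition \<mu> \<and> diagram_subset \<mu> \<kappa> \<longrightarrow> eval_one (HL_Q'_skew \<kappa> \<mu>) = aleph \<kappa> \<mu>"
    by (simp add: c_def)
qed

end
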